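(* Let $n,m\in\mathbb{N}$, let $0\le\alpha<n$, and let $0<\alpha_i<n$ for $1\le i\le m$ satisfy $\alpha_1+\dots+\alpha_m=n-\alpha$. Let $A_1,\dots,A_m$ be invertible real $n\times n$ matrices such that $A_i-A_j$ is invertible for $i\ne j$, $1\le i,j\le m$. Let $T_\alpha$ be the integral operator $$T_\alpha f(x)=\int_{\mathbb{R}^n}\frac{1}{|x-A_1y|^{\alpha_1}\cdots|x-A_my|^{\alpha_m}}\,f(y)\,dy .$$ Let $p:\mathbb{R}^n\to[1,\infty)$ be a measurable function such that $1<p_-\le p_+<\frac{n}{\alpha}$ and such that $p(A_ix)=p(x)$ for a.e. $x\in\mathbb{R}^n$, for every $1\le i\le m$. Let $q(\cdot)$ be defined by $\frac{1}{p(x)}-\frac{1}{q(x)}=\frac{\alpha}{n}$. If the Hardy--Littlewood maximal operator $\mathcal{M}$ is bounded on $L^{\left(\frac{n-\alpha p_-}{np_-}q(\cdot)\right)'}(\mathbb{R}^n)$, then $T_\alpha$ is bounded from $L^{p(\cdot)}(\mathbb{R}^n)$ into $L^{q(\cdot)}(\mathbb{R}^n)$.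
   Context: For a measurable function $p:\mathbb{R}^n\to[1,\infty)$, $p_-=\operatorname{ess\,inf}p$ and $p_+=\operatorname{ess\,sup}p$. The variable exponent space $L^{p(\cdot)}(\mathbb{R}^n)$ is the Banach space of measurable functions $f$ on $\mathbb{R}^n$ such that $\int (|f(x)|/\lambda)^{p(x)}dx<\infty$ for some $\lambda>0$, with norm $\|f\|_{p(\cdot)}=\inf\{\lambda>0:\int (|f(x)|/\lambda)^{p(x)}dx\le1\}$. For $\alpha=0$, $n/\alpha$ is read as $\infty$. For an exponent $r(\cdot)$ with values in $[1,\infty)$, $r(\cdot)'$ denotes the pointwise conjugate exponent, $\frac1{r(x)}+\frac1{r(x)'}=1$ (with $r(x)'=\infty$ where $r(x)=1$). Note that $\frac{n-\alpha p_-}{np_-}q(\cdot)\ge1$ a.e. For an exponent $s(\cdot)$ with values in $[1,\infty]$, the norm of $L^{s(\cdot)}(\mathbb{R}^n)$ is $\|f\|_{s(\cdot)}=\inf\{\lambda>0:\int_{\{s<\infty\}}(|f(x)|/\lambda)^{s(x)}dx+\|f/\lambda\|_{L^\infty(\{s=\infty\})}\le1\}$. The Hardy--Littlewood maximal operator is $\mathcal{M}f(x)=\sup_{B}\frac1{|B|}\int_B|f(y)|dy$, the supremum being taken over all balls $B$ containing $x$. An operator $S$ is bounded from $X$ into $Y$ if there is a constant $C$ with $\|Sf\|_Y\le C\|f\|_X$ for all $f\in X$; "bounded on $X$" means bounded from $X$ into $X$. *)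

theory Defs
  imports "HOL-Probability.Essential_Supremum"
begin

definition ess_inf :: "'a measure \<Rightarrow> ('a \<Rightarrow> ereal) \<Rightarrow> ereal" where
  "ess_inf M f = - esssup M (\<lambda>x. - f x)"

text \<open>The pair below is \<open>p\<^sub>-\<close> and \<open>p\<^sub>+\<close>. For a measurable \<open>p\<close> with real values \<open>\<ge> 1\<close> the essential
  infimum is finite, so the coercion loses nothing; \<open>p\<^sub>+\<close> can be infinite.\<close>

definition exponent_lower :: "(real^'n \<Rightarrow> real) \<Rightarrow> real" where
  "exponent_lower p = real_of_ereal (ess_inf lebesgue (\<lambda>x. ereal (p x)))"

definition exponent_upper :: "(real^'n \<Rightarrow> real) \<Rightarrow> ereal" where
  "exponent_upper p = esssup lebesgue (\<lambda>x. ereal (p x))"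

text \<open>\<open>conj_exponent r\<close> is \<open>r'\<close>; it is only meaningful for \<open>r \<ge> 1\<close>.\<close>

definition conj_exponent :: "real \<Rightarrow> ereal" where
  "conj_exponent r = (if r = 1 then \<infinity> else ereal (r / (r - 1)))"

lemma conj_exponent_eq:
  assumes "1 \<le> r"
  shows "1 / ereal r + 1 / conj_exponent r = 1"
proof (cases "r = 1")
  case True
  then show ?thesis by (simp add: conj_exponent_def one_ereal_def)
next
  case False
  with assms have "r > 1" by simp
  then have "1 / r + 1 / (r / (r - 1)) = 1"
    by (simp add: field_simps)
  with \<open>r > 1\<close> show ?thesis
    by (simp add: conj_exponent_def one_ereal_def)
qed

text \<open>The power \<open>t\<^sup>a\<close> for \<open>t \<in> [0, \<infinity>]\<close> and real \<open>a > 0\<close>.\<close>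

definition ennreal_powr :: "ennreal \<Rightarrow> real \<Rightarrow> ennreal" where
  "ennreal_powr t a = (if t = \<infinity> then \<infinity> else ennreal (enn2real t powr a))"

text \<open>Exponents take values in \<open>[1, \<infinity>]\<close>. Modular and norm are defined on functions with values in
  \<open>[0, \<infinity>]\<close> and applied to \<open>|f|\<close>: a maximal function may be infinite at some points.\<close>

definition modular :: "(real^'n \<Rightarrow> ereal) \<Rightarrow> (real^'n \<Rightarrow> ennreal) \<Rightarrow> ennreal" where
  "modular s g =
     (\<integral>\<^sup>+x\<in>{x. s x < \<infinity>}. ennreal_powr (g x) (real_of_ereal (s x)) \<partial>lebesgue)
     + esssup lebesgue (\<lambda>x. g x * indicator {x. s x = \<infinity>} x)"

definition var_norm :: "(real^'n \<Rightarrow> ereal) \<Rightarrow> (real^'n \<Rightarrow> ennreal) \<Rightarrow> ennreal" where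
  "var_norm s g =
     Inf {ennreal l | l::real. l > 0 \<and> modular s (\<lambda>x. g x / ennreal l) \<le> 1}"

abbreviation absf :: "(real^'n \<Rightarrow> complex) \<Rightarrow> real^'n \<Rightarrow> ennreal" where
  "absf f \<equiv> \<lambda>x. ennreal (norm (f x))"

definition var_space :: "(real^'n \<Rightarrow> ereal) \<Rightarrow> (real^'n \<Rightarrow> complex) set" where
  "var_space s = {f \<in> borel_measurable lebesgue.
     \<exists>l::real. l > 0 \<and> modular s (\<lambda>x. absf f x / ennreal l) < \<infinity>}"

text \<open>For exponents with finite values the modular is the plain integral.\<close>

lemma modular_finite_exponent:
  fixes p :: "real^'n \<Rightarrow> real"
  shows "modular (\<lambda>x. ereal (p x)) g = (\<integral>\<^sup>+x. ennreal_powr (g x) (p x) \<partial>lebesgue)"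
proof -
  have "esssup (lebesgue :: (real^'n) measure) (\<lambda>x. 0 :: ennreal) = 0"
    by (intro esssup_const) simp
  then show ?thesis by (simp add: modular_def)
qed

text \<open>\<open>S f\<close> stands for the absolute value of the image of \<open>f\<close>.\<close>

definition bounded_from_into ::
  "(real^'n \<Rightarrow> ereal) \<Rightarrow> (real^'n \<Rightarrow> ereal) \<Rightarrow> ((real^'n \<Rightarrow> complex) \<Rightarrow> real^'n \<Rightarrow> ennreal) \<Rightarrow> bool" where
  "bounded_from_into s t S \<longleftrightarrow>
     (\<exists>C::real. C \<ge> 0 \<and> (\<forall>f\<in>var_space s. var_norm t (S f) \<le> ennreal C * var_norm s (absf f)))"

definition hl_maximal :: "(real^'n \<Rightarrow> complex) \<Rightarrow> real^'n \<Rightarrow> ennreal" where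
  "hl_maximal f x = (SUP (c, r) \<in> {(c, r). r > 0 \<and> x \<in> ball c r}.
     (\<integral>\<^sup>+y\<in>ball c r. absf f y \<partial>lebesgue) / emeasure lebesgue (ball c r))"

text \<open>The kernel takes the value \<open>0\<close> at its singularities, which form a null set in \<open>y\<close> for every \<open>x\<close>
  when the matrices are invertible.\<close>

definition frac_kernel ::
  "nat \<Rightarrow> (nat \<Rightarrow> real) \<Rightarrow> (nat \<Rightarrow> real^'n^'n) \<Rightarrow> real^'n \<Rightarrow> real^'n \<Rightarrow> real" where
  "frac_kernel m a A x y = 1 / (\<Prod>i=1..m. norm (x - A i *v y) powr a i)"

definition frac_op ::
  "nat \<Rightarrow> (nat \<Rightarrow> real) \<Rightarrow> (nat \<Rightarrow> real^'n^'n) \<Rightarrow> (real^'n \<Rightarrow> complex) \<Rightarrow> real^'n \<Rightarrow> complex" where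
  "frac_op m a A f x = (\<integral>y. frac_kernel m a A x y *\<^sub>R f y \<partial>lebesgue)"

end

theory Submission
  imports Defs
begin

text \<open>
  Rubio de Francia extrapolation with A1 weights. Near a point the kernel of \<open>T\<^sub>\<alpha>\<close> is governed by the
  factor \<open>|x - A\<^sub>i y|\<close> that is smallest there; after the substitution \<open>z = A\<^sub>i y\<close>, which costs a constant because
  \<open>p \<circ> A\<^sub>i = p\<close>, it is dominated by the Riesz kernel \<open>|x - z|\<^bsup>\<alpha>-n\<^esup>\<close> if \<open>\<alpha> > 0\<close>, and by
  \<open>|x - z|\<^bsup>-b\<^esup> (|x| + |z|)\<^bsup>b-n\<^esup>\<close> with \<open>b = \<alpha>\<^sub>i\<close> if \<open>\<alpha> = 0\<close> (only there the differences \<open>A\<^sub>i - A\<^sub>j\<close> matter).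

  Let \<open>p\<^sub>0 = p\<^sub>-\<close> and \<open>1/q\<^sub>0 = 1/p\<^sub>0 - \<alpha>/n\<close>. For a weight \<open>W\<close> in A1 these operators map \<open>L\<^bsup>p0\<^esup>(W\<^bsup>p0/q0\<^esup>)\<close> into
  \<open>L\<^bsup>q0\<^esup>(W)\<close>. For the Riesz potential this is a pointwise estimate of Hedberg type: with \<open>h = G W\<^bsup>\<alpha>/n\<^esup>\<close>, the part of the
  potential over the dyadic shell of radius \<open>r\<close> is at most a constant times
  \<open>W(B\<^sub>r)\<^bsup>\<alpha>/n\<^esup> min(M\<^sub>W G, W(B\<^sub>r)\<^bsup>-1/p0\<^esup>)\<close>, and by reverse doubling the shells sum up to \<open>(M\<^sub>W G)\<^bsup>p0/q0\<^esup>\<close>.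

  Finally \<open>\<parallel>(T f)\<^bsup>q0\<^esup>\<parallel>\<close> in \<open>L\<^bsup>q(\<cdot>)/q0\<^esup>\<close> is tested against functions \<open>g\<close> in the unit ball of the dual space, on which \<open>M\<close> is
  bounded, so that \<open>\<Sum> M\<^sup>k g / (2c)\<^sup>k\<close> is an A1 weight above \<open>g\<close> that still lies in a fixed ball of that space.
\<close>

text \<open>The choice p0 = p_- makes q(.)/q0 at least 1, with equality exactly where p = p0. There
  the dual exponent is \<infinity>, so the essential supremum in the modular has to be carried
  through the whole argument. One weight serves on both sides because of the identity (p0/q0)
  (p/p0)' = (q/q0)'. Young's inequality with the exponents p/p0 and (p/p0)' bounds
  \<open>h powr p0 * W powr (p0 / q0)\<close> by the integrand of h for the exponent p plus that of
  W for the dual exponent. Hence h lies in a fixed ball of the weighted space for every W that the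
  algorithm produces, and the weighted bounds must depend on W only through its A1 constant. Norms
  enter only at the two ends; in between, every estimate compares modulars at level 1, with the
  constants put inside the functions. In two places a function is tested against a power of itself,
  once for the case \<alpha> = 0 and once in the duality step. Both need a quantity that is finite
  in advance, hence the truncations in height and support.\<close>

section \<open>Powers of extended nonnegative numbers\<close>

lemma ennreal_powr_ennreal: "0 \<le> t \<Longrightarrow> ennreal_powr (ennreal t) a = ennreal (t powr a)"
  by (simp add: ennreal_powr_def)

lemma ennreal_powr_top [simp]: "ennreal_powr top a = top"
  by (simp add: ennreal_powr_def)

lemma ennreal_powr_eq_top_iff [simp]: "ennreal_powr t a = top \<longleftrightarrow> t = top"
  by (simp add: ennreal_powr_def)

lemma ennreal_powr_0 [simp]: "ennreal_powr 0 a = 0"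
  by (simp add: ennreal_powr_def)

lemma ennreal_powr_mono: "0 \<le> a \<Longrightarrow> s \<le> t \<Longrightarrow> ennreal_powr s a \<le> ennreal_powr t a"
  by (cases s; cases t) (auto simp: ennreal_powr_def top_unique intro!: ennreal_leI powr_mono2)

lemma ennreal_powr_cmult:
  "0 < c \<Longrightarrow> ennreal_powr (ennreal c * t) a = ennreal (c powr a) * ennreal_powr t a"
  by (cases t) (auto simp: ennreal_powr_def ennreal_mult_top powr_mult ennreal_mult simp flip: ennreal_mult)

lemma ennreal_powr_powr: "ennreal_powr (ennreal_powr t a) b = ennreal_powr t (a * b)"
  by (cases t) (auto simp: ennreal_powr_def powr_powr)

lemma measurable_ennreal_powr [measurable (raw)]:
  assumes [measurable]: "f \<in> borel_measurable M" "e \<in> borel_measurable M"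
  shows "(\<lambda>x. ennreal_powr (f x) (e x)) \<in> borel_measurable M"
  unfolding ennreal_powr_def infinity_ennreal_def by measurable

lemma ennreal_powr_add_le:
  assumes "0 \<le> a"
  shows "ennreal_powr (s + t) a \<le> ennreal (2 powr a) * (ennreal_powr s a + ennreal_powr t a)"
proof -
  have "ennreal_powr (s + t) a \<le> ennreal_powr (ennreal 2 * max s t) a"
    using assms by (intro ennreal_powr_mono) (auto simp: max_def mult_2 add_mono)
  also have "\<dots> = ennreal (2 powr a) * ennreal_powr (max s t) a"
    by (subst ennreal_powr_cmult) auto
  also have "\<dots> \<le> ennreal (2 powr a) * (ennreal_powr s a + ennreal_powr t a)"
    by (intro mult_left_mono) (auto simp: max_def)
  finally show ?thesis .
qed

section \<open>Linear changes of variables\<close>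

lemma nn_integral_lborel_translate:
  fixes h :: "'a::euclidean_space \<Rightarrow> ennreal"
  assumes [measurable]: "h \<in> borel_measurable borel"
  shows "(\<integral>\<^sup>+x. h (v + x) \<partial>lborel) = (\<integral>\<^sup>+x. h x \<partial>lborel)"
proof -
  have "(\<integral>\<^sup>+x. h x \<partial>lborel) = (\<integral>\<^sup>+x. h x \<partial>distr lborel borel ((+) v))"
    by (simp add: lborel_distr_plus)
  then show ?thesis by (simp add: nn_integral_distr)
qed

lemma nn_integral_lborel_reflect:
  fixes h :: "'a::euclidean_space \<Rightarrow> ennreal"
  assumes [measurable]: "h \<in> borel_measurable borel"
  shows "(\<integral>\<^sup>+x. h (v - x) \<partial>lborel) = (\<integral>\<^sup>+x. h x \<partial>lborel)"
proof -
  have "(\<integral>\<^sup>+x. h x \<partial>lborel) = (\<integral>\<^sup>+x. h x \<partial>density (distr lborel borel (\<lambda>x. v + (-1) *\<^sub>R x)) (\<lambda>_. ennreal (\<bar>-1\<bar>^DIM('a))))"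
    using lborel_affine[of "-1" v] by simp
  also have "\<dots> = (\<integral>\<^sup>+x. h (v - x) \<partial>lborel)"
    by (simp add: nn_integral_density nn_integral_distr)
  finally show ?thesis by simp
qed

text \<open>Uniqueness of Haar measure: \<open>\<integral>\<integral> s(x) h(A y - x) dx dy\<close> is computed in two ways, with \<open>s\<close> the
  indicator of the unit ball. (The determinant formula of the library needs a well-ordered index type.)\<close>

lemma nn_integral_lborel_linear:
  fixes A :: "'a::euclidean_space \<Rightarrow> 'a"
  assumes "linear A" "bij A"
  obtains c :: real where "0 \<le> c"
    "\<And>h. h \<in> borel_measurable borel \<Longrightarrow> (\<integral>\<^sup>+y. h (A y) \<partial>lborel) = ennreal c * (\<integral>\<^sup>+x. h x \<partial>lborel)"
proof -
  obtain B where B: "linear B" "B \<circ> A = id"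
    using linear_injective_left_inverse[of A] assms by (auto simp: bij_def)
  have AB: "A (B x) = x" "B (A x) = x" for x
    using B assms by (metis bij_pointE comp_apply id_apply)+
  have cA: "continuous_on UNIV A" "continuous_on UNIV B"
    using assms B by (auto intro: linear_continuous_on simp: linear_conv_bounded_linear)
  then have [measurable]: "A \<in> borel_measurable borel" "B \<in> borel_measurable borel"
    by (auto intro: borel_measurable_continuous_onI)
  define N where "N h = (\<integral>\<^sup>+y. h (A y) \<partial>lborel)" for h :: "'a \<Rightarrow> ennreal"
  have trans: "(\<integral>\<^sup>+y. h (A y - v) \<partial>lborel) = N h" if [measurable]: "h \<in> borel_measurable borel" for h v
  proof -
    have "A y - v = A (- B v + y)" for y
      using assms AB linear_diff[of A y "B v"] by simp
    then show ?thesis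
      unfolding N_def using nn_integral_lborel_translate[of "\<lambda>y. h (A y)" "- B v"] by simp
  qed
  have key: "(\<integral>\<^sup>+x. s x \<partial>lborel) * N h = (\<integral>\<^sup>+x. h x \<partial>lborel) * N s"
    if [measurable]: "h \<in> borel_measurable borel" "s \<in> borel_measurable borel" and
      even: "\<And>x. s (- x) = s x" for h s
  proof -
    have [measurable]: "(\<lambda>x. h (A x - v)) \<in> borel_measurable borel" "(\<lambda>x. s (A x - v)) \<in> borel_measurable borel" for v
      by measurable
    have "(\<integral>\<^sup>+x. s x \<partial>lborel) * N h = (\<integral>\<^sup>+x. s x * (\<integral>\<^sup>+y. h (A y - x) \<partial>lborel) \<partial>lborel)"
      by (simp add: trans nn_integral_multc)
    also have "\<dots> = (\<integral>\<^sup>+x. (\<integral>\<^sup>+y. s x * h (A y - x) \<partial>lborel) \<partial>lborel)"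
      by (intro nn_integral_cong) (simp add: nn_integral_cmult)
    also have "\<dots> = (\<integral>\<^sup>+y. (\<integral>\<^sup>+x. s x * h (A y - x) \<partial>lborel) \<partial>lborel)"
      by (intro lborel_pair.Fubini') measurable
    also have "\<dots> = (\<integral>\<^sup>+y. (\<integral>\<^sup>+x. s (A y - x) * h x \<partial>lborel) \<partial>lborel)"
    proof (rule nn_integral_cong)
      fix y
      show "(\<integral>\<^sup>+x. s x * h (A y - x) \<partial>lborel) = (\<integral>\<^sup>+x. s (A y - x) * h x \<partial>lborel)"
        using nn_integral_lborel_reflect[of "\<lambda>x. s x * h (A y - x)" "A y"] by simp
    qed
    also have "\<dots> = (\<integral>\<^sup>+x. (\<integral>\<^sup>+y. s (A y - x) * h x \<partial>lborel) \<partial>lborel)"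
      by (intro lborel_pair.Fubini') measurable
    also have "\<dots> = (\<integral>\<^sup>+x. h x * N s \<partial>lborel)"
      by (intro nn_integral_cong) (subst nn_integral_multc, simp_all add: trans mult.commute)
    also have "\<dots> = (\<integral>\<^sup>+x. h x \<partial>lborel) * N s"
      by (simp add: nn_integral_multc)
    finally show ?thesis .
  qed
  define s :: "'a \<Rightarrow> ennreal" where "s = indicator (ball 0 1)"
  have [measurable]: "s \<in> borel_measurable borel" 
    unfolding s_def by (intro borel_measurable_indicator borel_open open_ball)
  have s_even: "s (- x) = s x" for x by (simp add: s_def indicator_def)
  have v: "(\<integral>\<^sup>+x. s x \<partial>lborel) = ennreal (unit_ball_vol (DIM('a)))"
    by (simp add: s_def emeasure_ball)
  have "N s < top"
  proof -
    have "B ` cball 0 1 \<in> sets lborel" "bounded (B ` cball 0 1)"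
      using cA compact_continuous_image[of "cball 0 1" B] continuous_on_subset[of UNIV B]
      by (auto intro: compact_imp_bounded borel_compact)
    then have "emeasure lborel (B ` cball 0 1) < top"
      using emeasure_bounded_finite[of "B ` cball 0 1"] by simp
    moreover have "N s \<le> (\<integral>\<^sup>+x. indicator (B ` cball 0 1) x \<partial>lborel)"
      unfolding N_def s_def
      by (intro nn_integral_mono) (auto simp: indicator_def AB intro!: image_eqI[of _ B "A x" for x])
    ultimately show ?thesis
      using \<open>B ` cball 0 1 \<in> sets lborel\<close> by simp
  qed
  then obtain c where c: "0 \<le> c" "N s = ennreal c" by (cases "N s") auto
  have vpos: "0 < unit_ball_vol (DIM('a))" by simp
  then have v0: "unit_ball_vol (DIM('a)) \<noteq> 0" by linarith
  show ?thesis
  proof (rule that[of "c / unit_ball_vol (DIM('a))"])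
    fix h :: "'a \<Rightarrow> ennreal" assume [measurable]: "h \<in> borel_measurable borel"
    have "ennreal (unit_ball_vol (DIM('a))) * N h = (\<integral>\<^sup>+x. h x \<partial>lborel) * ennreal c"
      using key[of h s] v c s_even by simp
    then have "ennreal (1 / unit_ball_vol (DIM('a))) * (ennreal (unit_ball_vol (DIM('a))) * N h)
       = ennreal (1 / unit_ball_vol (DIM('a))) * ((\<integral>\<^sup>+x. h x \<partial>lborel) * ennreal c)" by simp
    moreover have "ennreal (1 / unit_ball_vol (DIM('a))) * (ennreal (unit_ball_vol (DIM('a))) * N h) = N h"
      using vpos v0 by (simp add: mult.assoc[symmetric] flip: ennreal_mult)
    moreover have "ennreal (c / unit_ball_vol (DIM('a))) = ennreal (1 / unit_ball_vol (DIM('a))) * ennreal c"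
      using vpos v0 c by (simp flip: ennreal_mult)
    ultimately show "(\<integral>\<^sup>+y. h (A y) \<partial>lborel) = ennreal (c / unit_ball_vol (DIM('a))) * (\<integral>\<^sup>+x. h x \<partial>lborel)"
      by (simp add: N_def mult_ac)
  qed (use c in simp)
qed

text \<open>Carries the almost everywhere equality of the exponent with its Borel version through
  the matrices: the integration formula, applied to the indicator of a null set, has right side
  zero.\<close>

lemma AE_lborel_linear:
  fixes A :: "'a::euclidean_space \<Rightarrow> 'a"
  assumes "linear A" "bij A" "AE x in lborel. P x"
  shows "AE y in lborel. P (A y)"
proof -
  obtain c :: real where c: "0 \<le> c"
    "\<And>h. h \<in> borel_measurable borel \<Longrightarrow> (\<integral>\<^sup>+y. h (A y) \<partial>lborel) = ennreal c * (\<integral>\<^sup>+x. h x \<partial>lborel)"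
    using nn_integral_lborel_linear[OF assms(1,2)] by blast
  have [measurable]: "A \<in> borel_measurable borel"
    using assms by (auto intro!: borel_measurable_continuous_onI linear_continuous_on
        simp: linear_conv_bounded_linear)
  obtain N where N: "N \<in> null_sets lborel" "{x. \<not> P x} \<subseteq> N"
    using assms(3) by (auto simp: eventually_ae_filter)
  have [measurable]: "N \<in> sets borel" using N by auto
  have "(\<integral>\<^sup>+y. indicator N (A y) \<partial>lborel) = 0"
    using N c(2)[of "indicator N"] by (simp add: null_setsD1)
  then have "AE y in lborel. indicator N (A y) = (0::ennreal)"
    by (subst (asm) nn_integral_0_iff_AE) auto
  then show ?thesis
    using N by (auto simp: indicator_def split: if_splits elim!: eventually_mono)
qed

section \<open>Maximal functions of doubling measures\<close>

text \<open>One definition for both maximal functions in use: with \<open>lborel\<close> it is the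
  Hardy-Littlewood operator, with \<mu> = W dx it is the M_W of the overview. Being uncentred, it
  has open superlevel sets whatever G and \<mu> are.\<close>

definition avg_max :: "'a::metric_space measure \<Rightarrow> ('a \<Rightarrow> ennreal) \<Rightarrow> 'a \<Rightarrow> ennreal" where
  "avg_max \<mu> G x = (SUP (c, r) \<in> {(c, r). r > 0 \<and> x \<in> ball c r}.
     (\<integral>\<^sup>+y\<in>ball c r. G y \<partial>\<mu>) / emeasure \<mu> (ball c r))"

lemma less_avg_max_iff:
  "t < avg_max \<mu> G x \<longleftrightarrow>
    (\<exists>c r. r > 0 \<and> x \<in> ball c r \<and> t < (\<integral>\<^sup>+y\<in>ball c r. G y \<partial>\<mu>) / emeasure \<mu> (ball c r))"
  by (auto simp: avg_max_def less_SUP_iff)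

lemma open_avg_max_gt: "open {x. t < avg_max \<mu> G x}"
proof (subst open_subopen, rule ballI)
  fix x assume "x \<in> {x. t < avg_max \<mu> G x}"
  then obtain c r where "r > 0" "x \<in> ball c r" "t < (\<integral>\<^sup>+y\<in>ball c r. G y \<partial>\<mu>) / emeasure \<mu> (ball c r)"
    by (auto simp: less_avg_max_iff)
  then show "\<exists>T. open T \<and> x \<in> T \<and> T \<subseteq> {x. t < avg_max \<mu> G x}"
    by (intro exI[of _ "ball c r"]) (simp add: less_avg_max_iff subset_iff, blast)
qed

lemma borel_measurable_avg_max [measurable]: "avg_max \<mu> G \<in> borel_measurable borel"
  by (rule borel_measurableI_greater) (simp add: open_avg_max_gt)

lemma avg_max_ge:
  assumes "x \<in> ball c r"
  shows "(\<integral>\<^sup>+y\<in>ball c r. G y \<partial>\<mu>) / emeasure \<mu> (ball c r) \<le> avg_max \<mu> G x"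
proof -
  have "r > 0" using assms by (metis mem_ball dist_not_less_zero le_less_trans not_le zero_le_dist)
  with assms show ?thesis
    unfolding avg_max_def by (intro SUP_upper2[of "(c, r)"]) auto
qed

lemma layer_cake:
  fixes v :: ennreal
  assumes "0 < p"
  shows "ennreal_powr v p
    = (\<integral>\<^sup>+t. ennreal (p * t powr (p - 1)) * indicator {t. 0 < t \<and> ennreal t < v} t \<partial>lborel)" (is "_ = ?I v")
proof -
  have fin: "?I (ennreal c) = ennreal (c powr p)" if "0 \<le> c" for c
  proof -
    have "((\<lambda>t. p * t powr (p - 1)) has_integral p * (c powr (p - 1 + 1) / (p - 1 + 1))) {0..c}"
      using that assms by (intro has_integral_mult_right has_integral_powr_from_0) auto
    then have "(\<integral>\<^sup>+t. ennreal (p * t powr (p - 1)) * indicator {0..c} t \<partial>lborel) = ennreal (c powr p)"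
      using assms by (subst nn_integral_has_integral_lebesgue') auto
    moreover have "AE t in lborel. ennreal (p * t powr (p - 1)) * indicator {t. 0 < t \<and> ennreal t < ennreal c} t
        = ennreal (p * t powr (p - 1)) * indicator {0..c} t"
      using AE_lborel_singleton[of 0] AE_lborel_singleton[of c]
      by eventually_elim (auto simp: indicator_def ennreal_less_iff)
    then have "?I (ennreal c) = (\<integral>\<^sup>+t. ennreal (p * t powr (p - 1)) * indicator {0..c} t \<partial>lborel)"
      by (rule nn_integral_cong_AE)
    ultimately show ?thesis by simp
  qed
  show ?thesis
  proof (cases v)
    case (real c)
    then show ?thesis using fin[of c] by (simp add: ennreal_powr_ennreal)
  next
    case top
    have "ennreal c \<le> ?I v" if "0 \<le> c" for c
    proof -
      have "ennreal c = ?I (ennreal (c powr (1 / p)))"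
        using fin[of "c powr (1 / p)"] that assms by (simp add: powr_powr)
      also have "\<dots> \<le> ?I v"
        using top by (intro nn_integral_mono mult_left_mono) (auto simp: indicator_def)
      finally show ?thesis .
    qed
    from this[of "enn2real (?I v) + 1"] have "?I v = top"
      by (cases "?I v") auto
    then show ?thesis using top by simp
  qed
qed

text \<open>Doubling is stated with the factor 5 because the Vitali covering lemma enlarges the
  selected balls five times.\<close>

locale doubling_measure =
  fixes \<mu> :: "'a::euclidean_space measure" and D :: real
  assumes sets_mu [measurable_cong]: "sets \<mu> = sets borel"
    and D_pos: "0 < D"
    and ball_pos: "\<And>c r. 0 < r \<Longrightarrow> 0 < emeasure \<mu> (ball c r)"
    and ball_finite: "\<And>c r. emeasure \<mu> (ball c r) < top"
    and doubling: "\<And>c r. 0 < r \<Longrightarrow> emeasure \<mu> (ball c (5 * r)) \<le> ennreal D * emeasure \<mu> (ball c r)"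
begin

lemma ball_in_sets [measurable, simp]: "ball c r \<in> sets \<mu>"
  by (simp add: sets_mu)

lemma ball_nonzero: "0 < r \<Longrightarrow> emeasure \<mu> (ball c r) \<noteq> 0"
  using ball_pos[of r c] by auto

lemma ball_not_top [simp]: "emeasure \<mu> (ball c r) \<noteq> top"
  using ball_finite[of c r] by auto

lemma space_mu [simp]: "space \<mu> = UNIV"
  using sets_eq_imp_space_eq[OF sets_mu] by simp

lemma sigma_finite: "sigma_finite_measure \<mu>"
proof (intro sigma_finite_measure.intro exI[of _ "range (\<lambda>n::nat. ball 0 (real n))"] conjI)
  show "\<Union> (range (\<lambda>n::nat. ball 0 (real n))) = space \<mu>"
    using reals_Archimedean2 by (auto simp: dist_norm)
qed (use ball_finite in \<open>auto simp: less_top\<close>)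

lemma nn_integral_ball_le_avg_max:
  assumes "x \<in> ball c r"
  shows "(\<integral>\<^sup>+y\<in>ball c r. G y \<partial>\<mu>) \<le> emeasure \<mu> (ball c r) * avg_max \<mu> G x"
proof -
  have "r > 0" using assms by (metis mem_ball dist_not_less_zero le_less_trans not_le zero_le_dist)
  have "(\<integral>\<^sup>+y\<in>ball c r. G y \<partial>\<mu>) = emeasure \<mu> (ball c r) * ((\<integral>\<^sup>+y\<in>ball c r. G y \<partial>\<mu>) / emeasure \<mu> (ball c r))"
    using ball_nonzero[OF \<open>r > 0\<close>, of c]
    by (simp add: ennreal_times_divide mult.commute[of "emeasure \<mu> (ball c r)"] mult_divide_eq_ennreal)
  also have "\<dots> \<le> emeasure \<mu> (ball c r) * avg_max \<mu> G x"
    using avg_max_ge[OF assms, of \<mu> G] by (intro mult_left_mono) auto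
  finally show ?thesis .
qed

text \<open>Each point of the superlevel set lies in a ball on which the average of G exceeds t.
  Vitali selects disjoint balls whose fivefold enlargements still cover; doubling pays for the
  enlargement, and disjointness bounds the sum by the full integral. The covering lemma needs
  bounded radii, so radii up to N are treated first and the sets \<open>E N\<close> increase to the
  whole set.\<close>

lemma weak_type:
  assumes [measurable]: "G \<in> borel_measurable borel"
  shows "t * emeasure \<mu> {x. t < avg_max \<mu> G x} \<le> ennreal D * (\<integral>\<^sup>+x. G x \<partial>\<mu>)"
proof -
  define S where "S N = {(c, r). 0 < r \<and> r \<le> real N \<and>
     t < (\<integral>\<^sup>+y\<in>ball c r. G y \<partial>\<mu>) / emeasure \<mu> (ball c r)}" for N
  define E where "E N = (\<Union>i\<in>S N. ball (fst i) (snd i))" for N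
  have E_sets: "E N \<in> sets \<mu>" for N
    unfolding E_def sets_mu by (intro borel_open open_UN) auto
  have bound: "t * emeasure \<mu> (E N) \<le> ennreal D * (\<integral>\<^sup>+x. G x \<partial>\<mu>)" for N
  proof -
    obtain C where C: "countable C" "C \<subseteq> S N"
      and disj: "pairwise (\<lambda>i j. disjnt (ball (fst i) (snd i)) (ball (fst j) (snd j))) C"
      and cov: "E N \<subseteq> (\<Union>i\<in>C. ball (fst i) (5 * snd i))"
    proof (rule Vitali_covering_lemma_balls)
      show "E N \<subseteq> (\<Union>i\<in>S N. ball (fst i) (snd i))" by (simp add: E_def)
      show "0 < snd i \<and> snd i \<le> real N" if "i \<in> S N" for i
        using that by (auto simp: S_def)
    qed blast
    have small: "t * emeasure \<mu> (ball (fst i) (5 * snd i))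
       \<le> ennreal D * emeasure (density \<mu> G) (ball (fst i) (snd i))" if "i \<in> C" for i
    proof -
      obtain c r where i: "i = (c, r)" by (cases i)
      have r: "0 < r" "t < (\<integral>\<^sup>+y\<in>ball c r. G y \<partial>\<mu>) / emeasure \<mu> (ball c r)"
        using subsetD[OF C(2) that] unfolding i S_def by simp_all
      have "t * emeasure \<mu> (ball c r)
        \<le> ((\<integral>\<^sup>+y\<in>ball c r. G y \<partial>\<mu>) / emeasure \<mu> (ball c r)) * emeasure \<mu> (ball c r)"
        using r by (intro mult_right_mono) auto
      also have "\<dots> = emeasure (density \<mu> G) (ball c r)"
        using ball_nonzero[OF \<open>r > 0\<close>, of c]
        by (simp add: ennreal_divide_times ennreal_divide_self ball_finite emeasure_density)
      finally have *: "t * emeasure \<mu> (ball c r) \<le> emeasure (density \<mu> G) (ball c r)" .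
      have "t * emeasure \<mu> (ball c (5 * r)) \<le> t * (ennreal D * emeasure \<mu> (ball c r))"
        using doubling[OF r(1)] by (intro mult_left_mono) auto
      also have "\<dots> = ennreal D * (t * emeasure \<mu> (ball c r))"
        by (rule mult.left_commute)
      also have "\<dots> \<le> ennreal D * emeasure (density \<mu> G) (ball c r)"
        using * by (rule mult_left_mono) simp
      finally show ?thesis by (simp add: i)
    qed
    have "t * emeasure \<mu> (E N) = t * (\<integral>\<^sup>+x. indicator (E N) x \<partial>\<mu>)"
      by (subst nn_integral_indicator) (rule E_sets, rule refl)
    \<comment> \<open>The sum over the countable family C is written as an integral over the
      counting measure, which allows exchanging it with the integral over \<mu>.\<close>
    also have "\<dots> \<le> t * (\<integral>\<^sup>+x. (\<integral>\<^sup>+i. indicator (ball (fst i) (5 * snd i)) x \<partial>count_space C) \<partial>\<mu>)"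
    proof (intro mult_left_mono nn_integral_mono)
      fix x show "(indicator (E N) x :: ennreal) \<le> (\<integral>\<^sup>+i. indicator (ball (fst i) (5 * snd i)) x \<partial>count_space C)"
      proof (cases "x \<in> E N")
        case True
        with cov obtain i where "i \<in> C" "x \<in> ball (fst i) (5 * snd i)" by auto
        then show ?thesis
          using nn_integral_ge_point[of i C "\<lambda>i. indicator (ball (fst i) (5 * snd i)) x"] True by simp
      qed auto
    qed auto
    also have "\<dots> = (\<integral>\<^sup>+i. t * emeasure \<mu> (ball (fst i) (5 * snd i)) \<partial>count_space C)"
      by (subst nn_integral_count_space_nn_integral) (auto simp: C nn_integral_cmult)
    also have "\<dots> \<le> (\<integral>\<^sup>+i. ennreal D * emeasure (density \<mu> G) (ball (fst i) (snd i)) \<partial>count_space C)"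
      using small by (intro nn_integral_mono) auto
    also have "\<dots> = ennreal D * emeasure (density \<mu> G) (\<Union>i\<in>C. ball (fst i) (snd i))"
      using disj C by (subst emeasure_UN_countable)
        (auto simp: nn_integral_cmult disjoint_family_on_def pairwise_def disjnt_def)
    also have "\<dots> \<le> ennreal D * emeasure (density \<mu> G) (space (density \<mu> G))"
      by (intro mult_left_mono emeasure_space) auto
    also have "\<dots> = ennreal D * (\<integral>\<^sup>+x. G x \<partial>\<mu>)"
      by (simp add: emeasure_density)
    finally show ?thesis .
  qed
  have "{x. t < avg_max \<mu> G x} = (\<Union>N. E N)"
  proof (intro equalityI subsetI)
    fix x assume "x \<in> {x. t < avg_max \<mu> G x}"
    then obtain c r where "r > 0" "x \<in> ball c r" "t < (\<integral>\<^sup>+y\<in>ball c r. G y \<partial>\<mu>) / emeasure \<mu> (ball c r)"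
      by (auto simp: less_avg_max_iff)
    moreover obtain N :: nat where "r \<le> real N" using real_arch_simple by blast
    ultimately show "x \<in> (\<Union>N. E N)" by (auto simp: E_def S_def intro!: exI[of _ N] bexI[of _ "(c, r)"])
  qed (auto simp: E_def S_def less_avg_max_iff)
  moreover have "incseq E" 
    unfolding E_def S_def incseq_def by fastforce
  then have "(SUP N. emeasure \<mu> (E N)) = emeasure \<mu> (\<Union>N. E N)"
    using E_sets by (intro SUP_emeasure_incseq) auto
  ultimately have "t * emeasure \<mu> {x. t < avg_max \<mu> G x} = (SUP N. t * emeasure \<mu> (E N))"
    unfolding SUP_mult_left_ennreal[symmetric] by simp
  then show ?thesis using bound by (simp add: SUP_le_iff)
qed

text \<open>The part of G below t/2 contributes at most t/2 to any average, so the part above must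
  account for the remaining t/2; the weak type bound is applied to that part alone.\<close>

lemma weak_type_truncated:
  assumes [measurable]: "G \<in> borel_measurable borel" and "0 < t"
  shows "ennreal t * emeasure \<mu> {x. ennreal t < avg_max \<mu> G x}
    \<le> ennreal (2 * D) * (\<integral>\<^sup>+x. G x * indicator {x. ennreal (t / 2) < G x} x \<partial>\<mu>)"
proof -
  define H where "H x = G x * indicator {x. ennreal (t / 2) < G x} x" for x
  have [measurable]: "H \<in> borel_measurable borel" unfolding H_def by measurable
  have t2: "ennreal t = ennreal (t / 2) + ennreal (t / 2)" using \<open>0 < t\<close> by (simp flip: ennreal_plus)
  have "{x. ennreal t < avg_max \<mu> G x} \<subseteq> {x. ennreal (t / 2) < avg_max \<mu> H x}"
  proof safe
    fix x assume "ennreal t < avg_max \<mu> G x"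
    then obtain c r where r: "r > 0" "x \<in> ball c r" "ennreal t < (\<integral>\<^sup>+y\<in>ball c r. G y \<partial>\<mu>) / emeasure \<mu> (ball c r)"
      by (auto simp: less_avg_max_iff)
    have "(\<integral>\<^sup>+y\<in>ball c r. G y \<partial>\<mu>) \<le> (\<integral>\<^sup>+y. ennreal (t / 2) * indicator (ball c r) y + H y * indicator (ball c r) y \<partial>\<mu>)"
      by (intro nn_integral_mono) (auto simp: H_def indicator_def not_less)
    also have "\<dots> = ennreal (t / 2) * emeasure \<mu> (ball c r) + (\<integral>\<^sup>+y\<in>ball c r. H y \<partial>\<mu>)"
      by (subst nn_integral_add) (auto simp: nn_integral_cmult)
    finally have "(\<integral>\<^sup>+y\<in>ball c r. G y \<partial>\<mu>) / emeasure \<mu> (ball c r)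
      \<le> (ennreal (t / 2) * emeasure \<mu> (ball c r) + (\<integral>\<^sup>+y\<in>ball c r. H y \<partial>\<mu>)) / emeasure \<mu> (ball c r)"
      by (rule divide_right_mono_ennreal)
    also have "\<dots> = ennreal (t / 2) + (\<integral>\<^sup>+y\<in>ball c r. H y \<partial>\<mu>) / emeasure \<mu> (ball c r)"
      using ball_nonzero[OF r(1), of c]
      by (simp add: add_divide_distrib_ennreal mult_divide_eq_ennreal)
    finally have "ennreal t < ennreal (t / 2) + (\<integral>\<^sup>+y\<in>ball c r. H y \<partial>\<mu>) / emeasure \<mu> (ball c r)"
      using r by simp
    then have "ennreal (t / 2) < (\<integral>\<^sup>+y\<in>ball c r. H y \<partial>\<mu>) / emeasure \<mu> (ball c r)"
      unfolding t2 by (meson add_left_mono not_le)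
    then show "ennreal (t / 2) < avg_max \<mu> H x" using r by (auto simp: less_avg_max_iff)
  qed
  then have "ennreal t * emeasure \<mu> {x. ennreal t < avg_max \<mu> G x}
    \<le> 2 * (ennreal (t / 2) * emeasure \<mu> {x. ennreal (t / 2) < avg_max \<mu> H x})"
    using \<open>0 < t\<close> t2
    by (subst mult.assoc[symmetric]) (intro mult_mono emeasure_mono, auto simp: mult_2)
  also have "\<dots> \<le> 2 * (ennreal D * (\<integral>\<^sup>+x. H x \<partial>\<mu>))"
    by (intro mult_left_mono weak_type) auto
  finally show ?thesis
    using D_pos by (simp add: H_def ennreal_mult mult.assoc)
qed

text \<open>Marcinkiewicz interpolation between the weak bound and the trivial supremum bound. In
  the constant, 2 D is the truncated weak bound, p comes from the layer cake formula, and the rest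
  from integrating t^(p-2) over 0 < t < 2 G(x), which again is the layer cake formula, with p -
  1.\<close>

lemma strong_type:
  fixes G :: "'a \<Rightarrow> real"
  assumes [measurable]: "G \<in> borel_measurable borel" and nonneg: "\<And>x. 0 \<le> G x" and "1 < p"
  shows "(\<integral>\<^sup>+x. ennreal_powr (avg_max \<mu> G x) p \<partial>\<mu>)
    \<le> ennreal (2 * D * p * 2 powr (p - 1) / (p - 1)) * (\<integral>\<^sup>+x. ennreal (G x powr p) \<partial>\<mu>)"
proof -
  interpret sigma_finite_measure \<mu> by (rule sigma_finite)
  interpret pair_sigma_finite lborel \<mu> ..
  have "(\<integral>\<^sup>+x. ennreal_powr (avg_max \<mu> G x) p \<partial>\<mu>)
    = (\<integral>\<^sup>+x. (\<integral>\<^sup>+t. ennreal (p * t powr (p - 1)) * indicator {t. 0 < t \<and> ennreal t < avg_max \<mu> G x} t \<partial>lborel) \<partial>\<mu>)"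
    using \<open>1 < p\<close> by (subst layer_cake) auto
  also have "\<dots> = (\<integral>\<^sup>+t. (\<integral>\<^sup>+x. ennreal (p * t powr (p - 1)) * indicator {t. 0 < t \<and> ennreal t < avg_max \<mu> G x} t \<partial>\<mu>) \<partial>lborel)"
    by (intro Fubini') measurable
  also have "\<dots> \<le> (\<integral>\<^sup>+t. (\<integral>\<^sup>+x. ennreal (2 * D * p) * (G x * (ennreal (t powr (p - 2)) * indicator {t. 0 < t \<and> t < 2 * G x} t)) \<partial>\<mu>) \<partial>lborel)"
  proof (rule nn_integral_mono)
    fix t :: real
    show "(\<integral>\<^sup>+x. ennreal (p * t powr (p - 1)) * indicator {t. 0 < t \<and> ennreal t < avg_max \<mu> G x} t \<partial>\<mu>)
      \<le> (\<integral>\<^sup>+x. ennreal (2 * D * p) * (G x * (ennreal (t powr (p - 2)) * indicator {t. 0 < t \<and> t < 2 * G x} t)) \<partial>\<mu>)"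
    proof (cases "0 < t")
      case False
      then show ?thesis by (simp add: indicator_def)
    next
      case True
      have "(\<integral>\<^sup>+x. ennreal (p * t powr (p - 1)) * indicator {t. 0 < t \<and> ennreal t < avg_max \<mu> G x} t \<partial>\<mu>)
        = (\<integral>\<^sup>+x. ennreal (p * t powr (p - 1)) * indicator {x. ennreal t < avg_max \<mu> G x} x \<partial>\<mu>)"
        using True by (intro nn_integral_cong) (auto simp: indicator_def)
      also have "\<dots> = ennreal (p * t powr (p - 1)) * emeasure \<mu> {x. ennreal t < avg_max \<mu> G x}"
        by (subst nn_integral_cmult_indicator) auto
      also have "\<dots> = ennreal (p * t powr (p - 2)) * (ennreal t * emeasure \<mu> {x. ennreal t < avg_max \<mu> G x})"
      proof -
        have "p * t powr (p - 1) = p * t powr (p - 2) * t"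
          using True powr_mult_base[of t "p - 2"] by (simp add: mult.commute)
        then show ?thesis using True \<open>1 < p\<close> by (simp add: ennreal_mult mult.assoc)
      qed
      also have "\<dots> \<le> ennreal (p * t powr (p - 2)) * (ennreal (2 * D) * (\<integral>\<^sup>+x. ennreal (G x) * indicator {x. ennreal (t / 2) < G x} x \<partial>\<mu>))"
        using weak_type_truncated[of "\<lambda>x. ennreal (G x)" t] True by (intro mult_left_mono) simp_all
      also have "\<dots> = (\<integral>\<^sup>+x. ennreal (p * t powr (p - 2)) * (ennreal (2 * D) * (ennreal (G x) * indicator {x. ennreal (t / 2) < G x} x)) \<partial>\<mu>)"
        by (simp add: nn_integral_cmult)
      also have "\<dots> = (\<integral>\<^sup>+x. ennreal (2 * D * p) * (G x * (ennreal (t powr (p - 2)) * indicator {t. 0 < t \<and> t < 2 * G x} t)) \<partial>\<mu>)"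
        using True \<open>1 < p\<close> D_pos nonneg
        by (intro nn_integral_cong) (auto simp: indicator_def ennreal_less_iff mult_ac simp flip: ennreal_mult)
      finally show ?thesis .
    qed
  qed
  also have "\<dots> = (\<integral>\<^sup>+x. (\<integral>\<^sup>+t. ennreal (2 * D * p) * (G x * (ennreal (t powr (p - 2)) * indicator {t. 0 < t \<and> t < 2 * G x} t)) \<partial>lborel) \<partial>\<mu>)"
    by (intro Fubini'[symmetric]) measurable
  also have "\<dots> = (\<integral>\<^sup>+x. ennreal (2 * D * p * 2 powr (p - 1) / (p - 1)) * ennreal (G x powr p) \<partial>\<mu>)"
  proof (intro nn_integral_cong)
    fix x
    have less: "ennreal t < 2 * ennreal (G x) \<longleftrightarrow> t < 2 * G x" if "0 < t" for t
      using that ennreal_less_iff[of t "2 * G x"] nonneg[of x] by (simp add: ennreal_mult)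
    have "(\<integral>\<^sup>+t. ennreal ((p - 1) * t powr (p - 1 - 1)) * indicator {t. 0 < t \<and> ennreal t < ennreal (2 * G x)} t \<partial>lborel)
      = ennreal ((2 * G x) powr (p - 1))"
      using layer_cake[of "p - 1" "ennreal (2 * G x)"] \<open>1 < p\<close> nonneg[of x]
      by (simp add: ennreal_powr_ennreal)
    moreover have "(\<integral>\<^sup>+t. ennreal ((p - 1) * t powr (p - 1 - 1)) * indicator {t. 0 < t \<and> ennreal t < ennreal (2 * G x)} t \<partial>lborel)
      = (\<integral>\<^sup>+t. ennreal (p - 1) * (ennreal (t powr (p - 2)) * indicator {t. 0 < t \<and> t < 2 * G x} t) \<partial>lborel)"
      using \<open>1 < p\<close> nonneg[of x]
      by (intro nn_integral_cong) (auto simp: indicator_def less ennreal_mult)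
    ultimately have "ennreal (p - 1) * (\<integral>\<^sup>+t. ennreal (t powr (p - 2)) * indicator {t. 0 < t \<and> t < 2 * G x} t \<partial>lborel)
      = ennreal ((2 * G x) powr (p - 1))"
      by (simp add: nn_integral_cmult)
    then have "ennreal (1 / (p - 1)) * (ennreal (p - 1) * (\<integral>\<^sup>+t. ennreal (t powr (p - 2)) * indicator {t. 0 < t \<and> t < 2 * G x} t \<partial>lborel))
      = ennreal (1 / (p - 1)) * ennreal ((2 * G x) powr (p - 1))" by simp
    then have I: "(\<integral>\<^sup>+t. ennreal (t powr (p - 2)) * indicator {t. 0 < t \<and> t < 2 * G x} t \<partial>lborel)
      = ennreal ((2 * G x) powr (p - 1) / (p - 1))"
      using \<open>1 < p\<close> by (simp add: mult.assoc[symmetric] flip: ennreal_mult)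
    have "G x * (2 * G x) powr (p - 1) = 2 powr (p - 1) * G x powr p"
      using nonneg[of x] \<open>1 < p\<close> powr_mult_base[of "G x" "p - 1"]
      by (simp add: powr_mult)
    then have e: "2 * D * p * (G x * ((2 * G x) powr (p - 1) / (p - 1)))
        = 2 * D * p * 2 powr (p - 1) / (p - 1) * G x powr p"
      by simp
    have "(\<integral>\<^sup>+t. ennreal (2 * D * p) * (G x * (ennreal (t powr (p - 2)) * indicator {t. 0 < t \<and> t < 2 * G x} t)) \<partial>lborel)
      = ennreal (2 * D * p) * (ennreal (G x) * ennreal ((2 * G x) powr (p - 1) / (p - 1)))"
      by (simp add: nn_integral_cmult I)
    also have "\<dots> = ennreal (2 * D * p * (G x * ((2 * G x) powr (p - 1) / (p - 1))))"
      using nonneg[of x] \<open>1 < p\<close> D_pos by (simp flip: ennreal_mult)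
    also have "\<dots> = ennreal (2 * D * p * 2 powr (p - 1) / (p - 1)) * ennreal (G x powr p)"
      unfolding e using nonneg[of x] \<open>1 < p\<close> D_pos by (intro ennreal_mult) auto
    finally show "(\<integral>\<^sup>+t. ennreal (2 * D * p) * (G x * (ennreal (t powr (p - 2)) * indicator {t. 0 < t \<and> t < 2 * G x} t)) \<partial>lborel)
      = ennreal (2 * D * p * 2 powr (p - 1) / (p - 1)) * ennreal (G x powr p)" .
  qed
  also have "\<dots> = ennreal (2 * D * p * 2 powr (p - 1) / (p - 1)) * (\<integral>\<^sup>+x. ennreal (G x powr p) \<partial>\<mu>)"
    by (simp add: nn_integral_cmult)
  finally show ?thesis .
qed

end

section \<open>Muckenhoupt A1 weights\<close>

text \<open>The inequality M W \<le> K W with the supremum spelled out over balls; the exceptional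
  null set is the same for all balls. W is real and positive at every point, so all its real powers
  and quotients make sense without exceptions.\<close>

locale A1_weight =
  fixes W :: "'a::euclidean_space \<Rightarrow> real" and K :: real
  assumes W_measurable [measurable]: "W \<in> borel_measurable borel"
    and W_pos: "\<And>x. 0 < W x"
    and K_ge_1: "1 \<le> K"
    and A1: "AE z in lborel. \<forall>c r. z \<in> ball c r \<longrightarrow>
      (\<integral>\<^sup>+y\<in>ball c r. ennreal (W y) \<partial>lborel) \<le> ennreal K * emeasure lborel (ball c r) * ennreal (W z)"
begin

abbreviation \<mu> :: "'a measure" where "\<mu> \<equiv> density lborel (\<lambda>x. ennreal (W x))"

lemma ball_borel [measurable]: "ball c r \<in> sets (borel :: 'a measure)"
  by (simp add: borel_open)

lemma W_nonzero [simp]: "ennreal (W x) \<noteq> 0"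
  using W_pos[of x] by simp

lemma emeasure_mu: "S \<in> sets borel \<Longrightarrow> emeasure \<mu> S = (\<integral>\<^sup>+y\<in>S. ennreal (W y) \<partial>lborel)"
  by (simp add: emeasure_density)

lemma lborel_ball_pos: "0 < r \<Longrightarrow> 0 < emeasure lborel (ball (c :: 'a) r)"
  by (simp add: emeasure_ball)

lemma AE_A1: "AE z in lborel. z \<in> ball c r \<longrightarrow>
    emeasure \<mu> (ball c r) \<le> ennreal K * emeasure lborel (ball c r) * ennreal (W z)"
  using A1 by eventually_elim (simp add: emeasure_mu)

text \<open>Local integrability is a consequence of A1: a single point of the ball at which the
  inequality holds bounds the mass by a finite number.\<close>

lemma mu_ball_finite: "emeasure \<mu> (ball c r) < top"
proof (cases "0 < r")
  case True
  have "\<exists>z\<in>ball c r. emeasure \<mu> (ball c r) \<le> ennreal K * emeasure lborel (ball c r) * ennreal (W z)"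
  proof (rule ccontr)
    assume "\<not> ?thesis"
    with AE_A1[of c r] have "AE z in lborel. z \<notin> ball c r" by (auto elim!: eventually_mono)
    then have "emeasure lborel (ball c r) = 0"
      by (subst (asm) AE_iff_measurable[of "ball c r"]) auto
    with lborel_ball_pos[OF True, of c] show False by simp
  qed
  then obtain z where "emeasure \<mu> (ball c r) \<le> ennreal K * emeasure lborel (ball c r) * ennreal (W z)" by auto
  also have "\<dots> < top"
    using emeasure_lborel_ball_finite[of c r] by (simp add: ennreal_mult_less_top less_top)
  finally show ?thesis .
qed (simp add: ball_empty)

text \<open>The A1 inequality integrated over S. With S a smaller concentric ball it yields
  doubling, with S an annulus reverse doubling.\<close>

lemma A1_subset:
  assumes [measurable]: "S \<in> sets borel" and "S \<subseteq> ball c R"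
  shows "emeasure \<mu> (ball c R) * emeasure lborel S \<le> ennreal K * emeasure lborel (ball c R) * emeasure \<mu> S"
proof -
  have "emeasure \<mu> (ball c R) * emeasure lborel S = (\<integral>\<^sup>+z\<in>S. emeasure \<mu> (ball c R) \<partial>lborel)"
    by (subst nn_integral_cmult_indicator) auto
  also have "\<dots> \<le> (\<integral>\<^sup>+z. (ennreal K * emeasure lborel (ball c R)) * (ennreal (W z) * indicator S z) \<partial>lborel)"
  proof (rule nn_integral_mono_AE)
    show "AE z in lborel. emeasure \<mu> (ball c R) * indicator S z
        \<le> (ennreal K * emeasure lborel (ball c R)) * (ennreal (W z) * indicator S z)"
      using AE_A1[of c R]
    proof eventually_elim
      case (elim z)
      with assms(2) show ?case by (cases "z \<in> S") (auto simp: mult.assoc)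
    qed
  qed
  also have "\<dots> = ennreal K * emeasure lborel (ball c R) * emeasure \<mu> S"
    by (subst nn_integral_cmult) (auto simp: emeasure_mu)
  finally show ?thesis .
qed

lemma mu_ball_pos:
  assumes "0 < r"
  shows "0 < emeasure \<mu> (ball c r)"
proof (rule ccontr)
  assume "\<not> ?thesis"
  then have "(\<integral>\<^sup>+y. ennreal (W y) * indicator (ball c r) y \<partial>lborel) = 0" by (simp add: emeasure_mu)
  then have "AE y in lborel. ennreal (W y) * indicator (ball c r) y = 0"
    by (subst (asm) nn_integral_0_iff_AE) auto
  then have "AE z in lborel. z \<notin> ball c r"
    by (rule eventually_mono) (auto simp: indicator_def split: if_splits)
  then have "emeasure lborel (ball c r) = 0"
    by (subst (asm) AE_iff_measurable[of "ball c r"]) auto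
  with lborel_ball_pos[OF assms, of c] show False by simp
qed

definition wt :: "'a \<Rightarrow> real \<Rightarrow> real" where "wt c r = measure \<mu> (ball c r)"

lemma emeasure_mu_ball: "emeasure \<mu> (ball c r) = ennreal (wt c r)"
  using mu_ball_finite[of c r] by (simp add: wt_def emeasure_eq_ennreal_measure less_top)

lemma wt_pos: "0 < r \<Longrightarrow> 0 < wt c r"
  using mu_ball_pos[of r c] by (simp add: emeasure_mu_ball)

lemma wt_nonneg: "0 \<le> wt c r"
  by (simp add: wt_def)

lemma wt_quintuple:
  assumes "0 < r"
  shows "wt c (5 * r) \<le> K * 5 ^ DIM('a) * wt c r"
proof -
  let ?v = "unit_ball_vol (real DIM('a))"
  have v: "0 < ?v" by simp
  have "ennreal (wt c (5 * r)) * ennreal (?v * r ^ DIM('a)) \<le> ennreal K * ennreal (?v * (5 * r) ^ DIM('a)) * ennreal (wt c r)"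
    using A1_subset[OF ball_borel subset_ball, of r "5 * r" c] assms by (simp add: emeasure_ball emeasure_mu_ball)
  then have "wt c (5 * r) * (?v * r ^ DIM('a)) \<le> K * (?v * (5 * r) ^ DIM('a)) * wt c r"
    using assms K_ge_1 wt_nonneg v by (simp add: ennreal_mult[symmetric] wt_nonneg)
  then have "(?v * r ^ DIM('a)) * wt c (5 * r) \<le> (?v * r ^ DIM('a)) * (K * 5 ^ DIM('a) * wt c r)"
    by (simp add: power_mult_distrib mult_ac)
  moreover have "0 < ?v * r ^ DIM('a)" using v assms by (intro mult_pos_pos) auto
  ultimately show ?thesis by (subst (asm) mult_le_cancel_left_pos)
qed

text \<open>Reverse doubling. The annulus carries at least half of the Lebesgue measure of the large
  ball, hence by \<open>A1_subset\<close> at least the fraction 1/(2K) of its weighted mass.\<close>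

lemma wt_double:
  assumes "0 < r"
  shows "wt c r \<le> (1 - 1 / (2 * K)) * wt c (2 * r)"
proof -
  let ?v = "unit_ball_vol (real DIM('a))" and ?S = "ball c (2 * r) - ball c r"
  have v: "0 < ?v" by simp
  have sub: "ball c r \<subseteq> ball c (2 * r)" using assms by (intro subset_ball) simp
  have e1: "emeasure \<mu> ?S = ennreal (wt c (2 * r) - wt c r)"
    using sub mu_ball_finite[of c r]
    by (subst emeasure_Diff) (auto simp: emeasure_mu_ball wt_nonneg ennreal_minus)
  have e2: "emeasure lborel ?S = ennreal (?v * (2 * r) ^ DIM('a) - ?v * r ^ DIM('a))"
    using sub emeasure_lborel_ball_finite[of c r] assms v
    by (subst emeasure_Diff) (auto simp: emeasure_ball ennreal_minus)
  have le: "wt c r \<le> wt c (2 * r)"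
    using emeasure_mono[OF sub, of \<mu>] wt_nonneg by (simp add: emeasure_mu_ball)
  have "r ^ DIM('a) = (1/2) ^ DIM('a) * (2 * r) ^ DIM('a)"
    by (simp add: power_mult_distrib field_simps)
  also have "\<dots> \<le> (1/2) * (2 * r) ^ DIM('a)"
  proof (intro mult_right_mono)
    show "(1/2 :: real) ^ DIM('a) \<le> 1/2"
      using power_decreasing[of 1 "DIM('a)" "1/2 :: real"] DIM_positive[where 'a='a] by simp
  qed (use assms in auto)
  finally have half: "?v * (2 * r) ^ DIM('a) / 2 \<le> ?v * (2 * r) ^ DIM('a) - ?v * r ^ DIM('a)"
    using mult_left_mono[of "r ^ DIM('a)" "(1/2) * (2 * r) ^ DIM('a)" ?v] v by (simp add: mult_ac)
  have P: "0 < ?v * (2 * r) ^ DIM('a)" using v assms by (intro mult_pos_pos) auto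
  have "ennreal (wt c (2 * r)) * ennreal (?v * (2 * r) ^ DIM('a) - ?v * r ^ DIM('a))
     \<le> ennreal K * ennreal (?v * (2 * r) ^ DIM('a)) * ennreal (wt c (2 * r) - wt c r)"
    using A1_subset[of ?S c "2 * r"] assms unfolding e1 e2 by (simp add: emeasure_ball emeasure_mu_ball)
  then have "wt c (2 * r) * (?v * (2 * r) ^ DIM('a) - ?v * r ^ DIM('a))
     \<le> K * (?v * (2 * r) ^ DIM('a)) * (wt c (2 * r) - wt c r)"
  proof -
    have "0 \<le> ?v * (2 * r) ^ DIM('a) - ?v * r ^ DIM('a)" using half P by linarith
    moreover have "0 \<le> K * (?v * (2 * r) ^ DIM('a)) * (wt c (2 * r) - wt c r)"
      using K_ge_1 P le mult_nonneg_nonneg[of K "?v * (2 * r) ^ DIM('a)"]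
      by (intro mult_nonneg_nonneg[of "K * _"]) linarith+
    moreover have "ennreal K * ennreal (?v * (2 * r) ^ DIM('a)) * ennreal (wt c (2 * r) - wt c r)
      = ennreal (K * (?v * (2 * r) ^ DIM('a)) * (wt c (2 * r) - wt c r))"
      using K_ge_1 P le by (subst (1 2) ennreal_mult) auto
    ultimately show ?thesis
      using \<open>ennreal (wt c (2 * r)) * _ \<le> _\<close> wt_nonneg[of c "2 * r"]
      by (metis ennreal_le_iff ennreal_mult)
  qed
  moreover have "wt c (2 * r) * (?v * (2 * r) ^ DIM('a) / 2) \<le> wt c (2 * r) * (?v * (2 * r) ^ DIM('a) - ?v * r ^ DIM('a))"
    using half wt_nonneg by (rule mult_left_mono)
  moreover have "a * (w / 2) \<le> a * (K * d)" if "w * (a - b) \<le> K * a * d" "w * (a / 2) \<le> w * (a - b)" for a b w d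
    using order_trans[OF that(2,1)] by (simp add: mult_ac)
  ultimately have "(?v * (2 * r) ^ DIM('a)) * (wt c (2 * r) / 2) \<le> (?v * (2 * r) ^ DIM('a)) * (K * (wt c (2 * r) - wt c r))"
    by blast
  then have "wt c (2 * r) / 2 \<le> K * (wt c (2 * r) - wt c r)"
    using P by (subst (asm) mult_le_cancel_left_pos)
  then show ?thesis using K_ge_1 by (simp add: field_simps)
qed

sublocale doubling_measure \<mu> "K * 5 ^ DIM('a)"
proof
  show "0 < r \<Longrightarrow> emeasure \<mu> (ball c (5 * r)) \<le> ennreal (K * 5 ^ DIM('a)) * emeasure \<mu> (ball c r)" for c r
    using wt_quintuple[of r c] K_ge_1 wt_nonneg
    by (simp add: emeasure_mu_ball ennreal_mult[symmetric])
qed (use K_ge_1 mu_ball_pos mu_ball_finite in auto)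

text \<open>The factor gained in weighted mass whenever a radius is halved; it is the ratio behind
  the geometric series over dyadic shells.\<close>

definition decay :: real where "decay = 1 - 1 / (2 * K)"

lemma decay: "0 < decay" "decay < 1"
  using K_ge_1 by (auto simp: decay_def field_simps)

lemma wt_shrink: "0 < r \<Longrightarrow> wt c (r * (1/2) ^ j) \<le> decay ^ j * wt c r"
proof (induction j)
  case (Suc j)
  have "wt c (r * (1/2) ^ Suc j) \<le> decay * wt c (r * (1/2) ^ j)"
    using wt_double[of "r * (1/2) ^ Suc j" c] Suc by (simp add: decay_def)
  also have "\<dots> \<le> decay * (decay ^ j * wt c r)"
    using Suc decay by (intro mult_left_mono) auto
  finally show ?case by simp
qed simp

lemma wt_grow: "0 < r \<Longrightarrow> wt c r \<le> decay ^ j * wt c (r * 2 ^ j)"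
proof -
  assume "0 < r"
  moreover have "r * 2 ^ j * (1/2) ^ j = r" by (simp add: power_one_over)
  ultimately show ?thesis using wt_shrink[of "r * 2 ^ j" c j] by (metis mult_pos_pos zero_less_numeral zero_less_power)
qed

text \<open>By reverse doubling the masses of concentric dyadic balls tend to 0 and to \<infinity>,
  so some pair of consecutive dyadic radii has the level t between its masses.\<close>

lemma exists_radius:
  assumes "0 < t"
  obtains R where "0 < R" "wt c R \<le> t" "t < wt c (2 * R)"
proof (cases "wt c 1 \<le> t")
  case True
  have "\<exists>j. t < wt c (2 ^ j)"
  proof -
    obtain j where "decay ^ j < wt c 1 / t"
      using real_arch_pow_inv[of "wt c 1 / t" decay] decay wt_pos[of 1 c] assms by auto
    then have "decay ^ j * t < decay ^ j * wt c (2 ^ j)"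
      using wt_grow[of 1 c j] assms by (simp add: field_simps)
    then have "t < wt c (2 ^ j)" using decay by (subst (asm) mult_less_cancel_left_pos) auto
    then show ?thesis ..
  qed
  define j where "j = (LEAST j. t < wt c (2 ^ j))"
  have j: "t < wt c (2 ^ j)" unfolding j_def using \<open>\<exists>j. _\<close> by (rule LeastI_ex)
  with True have "j \<noteq> 0" by (intro notI) simp
  then obtain k where k: "j = Suc k" by (cases j) auto
  have "\<not> t < wt c (2 ^ k)" using not_less_Least[of k "\<lambda>j. t < wt c (2 ^ j)"] k by (simp add: j_def)
  with j k show ?thesis by (intro that[of "2 ^ k"]) auto
next
  case False
  have "\<exists>j. wt c ((1/2) ^ j) \<le> t"
  proof -
    obtain j where "decay ^ j < t / wt c 1"
      using real_arch_pow_inv[of "t / wt c 1" decay] decay wt_pos[of 1 c] assms by auto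
    then have "decay ^ j * wt c 1 < t" using wt_pos[of 1 c] by (simp add: field_simps)
    then show ?thesis using wt_shrink[of 1 c j] by (intro exI[of _ j]) simp
  qed
  define j where "j = (LEAST j. wt c ((1/2) ^ j) \<le> t)"
  have j: "wt c ((1/2) ^ j) \<le> t" unfolding j_def using \<open>\<exists>j. _\<close> by (rule LeastI_ex)
  with False have "j \<noteq> 0" by (intro notI) simp
  then obtain k where k: "j = Suc k" by (cases j) auto
  have "\<not> wt c ((1/2) ^ k) \<le> t" using not_less_Least[of k "\<lambda>j. wt c ((1/2) ^ j) \<le> t"] k by (simp add: j_def)
  with j k show ?thesis by (intro that[of "(1/2) ^ j"]) auto
qed

text \<open>On the ball, A1 bounds 1 / W from above by K |B| / W(B). Writing W^(1-e) as W^(-e) W and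
  estimating the first factor turns a Lebesgue integral into one over \<mu>. The uses are e = 1 -
  \<alpha>/n for the Riesz potential and e = 1 for the kernel of the case \<alpha> = 0.\<close>

lemma nn_integral_ball_powr_le:
  assumes [measurable]: "G \<in> borel_measurable borel" and "0 < r" and "0 \<le> e" and "\<And>x. 0 \<le> G x"
  shows "(\<integral>\<^sup>+z\<in>ball c r. ennreal (G z * W z powr (1 - e)) \<partial>lborel)
    \<le> ennreal ((K * unit_ball_vol (real DIM('a)) * r ^ DIM('a) / wt c r) powr e) * (\<integral>\<^sup>+z\<in>ball c r. ennreal (G z) \<partial>\<mu>)"
proof -
  let ?v = "unit_ball_vol (real DIM('a))"
  have v: "0 < ?v" by simp
  have "AE z in lborel. z \<in> ball c r \<longrightarrow> wt c r \<le> K * (?v * r ^ DIM('a)) * W z"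
    using AE_A1[of c r]
  proof (rule eventually_mono, intro impI)
    fix z assume "z \<in> ball c r \<longrightarrow> emeasure \<mu> (ball c r) \<le> ennreal K * emeasure lborel (ball c r) * ennreal (W z)"
      and "z \<in> ball c r"
    then have "ennreal (wt c r) \<le> ennreal (K * (?v * r ^ DIM('a)) * W z)"
      using K_ge_1 \<open>0 < r\<close> v W_pos[of z]
      by (simp add: emeasure_ball emeasure_mu_ball ennreal_mult)
    then show "wt c r \<le> K * (?v * r ^ DIM('a)) * W z"
      using K_ge_1 \<open>0 < r\<close> v W_pos[of z] by (subst (asm) ennreal_le_iff) auto
  qed
  then have "(\<integral>\<^sup>+z\<in>ball c r. ennreal (G z * W z powr (1 - e)) \<partial>lborel)
    \<le> (\<integral>\<^sup>+z. ennreal ((K * ?v * r ^ DIM('a) / wt c r) powr e) * (ennreal (W z) * (ennreal (G z) * indicator (ball c r) z)) \<partial>lborel)"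
  proof (intro nn_integral_mono_AE, elim eventually_mono)
    fix z assume *: "z \<in> ball c r \<longrightarrow> wt c r \<le> K * (?v * r ^ DIM('a)) * W z"
    show "ennreal (G z * W z powr (1 - e)) * indicator (ball c r) z
      \<le> ennreal ((K * ?v * r ^ DIM('a) / wt c r) powr e) * (ennreal (W z) * (ennreal (G z) * indicator (ball c r) z))"
    proof (cases "z \<in> ball c r")
      case True
      have "1 / W z \<le> K * ?v * r ^ DIM('a) / wt c r"
        using * True W_pos[of z] wt_pos[OF \<open>0 < r\<close>, of c] by (simp add: field_simps)
      then have "(1 / W z) powr e \<le> (K * ?v * r ^ DIM('a) / wt c r) powr e"
        using W_pos[of z] \<open>0 \<le> e\<close> by (intro powr_mono2) (auto simp: less_imp_le)
      moreover have "W z powr (1 - e) = (1 / W z) powr e * W z"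
        using W_pos[of z] by (simp add: powr_diff powr_divide)
      ultimately have "W z powr (1 - e) \<le> (K * ?v * r ^ DIM('a) / wt c r) powr e * W z"
        using W_pos[of z] by (simp add: mult_right_mono)
      then have "G z * W z powr (1 - e) \<le> (K * ?v * r ^ DIM('a) / wt c r) powr e * (W z * G z)"
        using assms(4)[of z] by (subst mult.commute[of "G z"]) (metis mult.assoc mult_right_mono)
      then have "ennreal (G z * W z powr (1 - e)) \<le> ennreal ((K * ?v * r ^ DIM('a) / wt c r) powr e * (W z * G z))"
        by (rule ennreal_leI)
      then show ?thesis using True W_pos[of z] assms(4)[of z] by (simp add: ennreal_mult)
    qed simp
  qed
  also have "\<dots> = ennreal ((K * ?v * r ^ DIM('a) / wt c r) powr e) * (\<integral>\<^sup>+z\<in>ball c r. ennreal (G z) \<partial>\<mu>)"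
    by (subst nn_integral_cmult) (auto simp: nn_integral_density)
  finally show ?thesis .
qed

text \<open>Hoelder's inequality up to the factor 2, from \<open>g \<le> s + s\<^bsup>1-p\<^esup> g\<^sup>p\<close> with \<open>s\<close> adapted to the ball.\<close>

lemma nn_integral_ball_le_wt:
  fixes G :: "'a \<Rightarrow> real"
  assumes [measurable]: "G \<in> borel_measurable borel" and "0 < r" and "1 < p" and "\<And>x. 0 \<le> G x"
    and "(\<integral>\<^sup>+z. ennreal (G z powr p) \<partial>\<mu>) \<le> 1"
  shows "(\<integral>\<^sup>+z\<in>ball c r. ennreal (G z) \<partial>\<mu>) \<le> ennreal (2 * wt c r powr (1 - 1 / p))"
proof -
  \<comment> \<open>This s balances the two terms: \<open>s * wt c r\<close> and
    \<open>s powr (1 - p)\<close> are both equal to wt^(1-1/p).\<close>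
  define s where "s = wt c r powr (- 1 / p)"
  have w: "0 < wt c r" using assms by (simp add: wt_pos)
  have s: "0 < s" using w by (simp add: s_def)
  have le: "g \<le> s + s powr (1 - p) * g powr p" if "0 \<le> g" for g :: real
  proof (cases "g \<le> s")
    case True
    moreover have "0 \<le> s powr (1 - p) * g powr p" by (intro mult_nonneg_nonneg) auto
    ultimately show ?thesis by linarith
  next
    case False
    have "g = g powr 1" using that by simp
    also have "\<dots> = g powr (1 - p) * g powr p" using that by (simp flip: powr_add)
    also have "\<dots> \<le> s powr (1 - p) * g powr p"
      using False s assms by (intro mult_right_mono powr_mono2') auto
    finally show ?thesis using s by linarith
  qed
  have "(\<integral>\<^sup>+z\<in>ball c r. ennreal (G z) \<partial>\<mu>) \<le> (\<integral>\<^sup>+z. ennreal s * indicator (ball c r) z + ennreal (s powr (1 - p)) * ennreal (G z powr p) \<partial>\<mu>)"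
  proof (intro nn_integral_mono)
    fix z
    show "ennreal (G z) * indicator (ball c r) z \<le> ennreal s * indicator (ball c r) z + ennreal (s powr (1 - p)) * ennreal (G z powr p)"
      using ennreal_leI[OF le[OF assms(4), of z]] s
      by (auto simp: indicator_def ennreal_mult[symmetric] ennreal_plus[symmetric] simp del: ennreal_plus)
  qed
  also have "\<dots> = ennreal s * emeasure \<mu> (ball c r) + ennreal (s powr (1 - p)) * (\<integral>\<^sup>+z. ennreal (G z powr p) \<partial>\<mu>)"
    by (subst nn_integral_add) (auto simp: nn_integral_cmult)
  also have "\<dots> \<le> ennreal s * ennreal (wt c r) + ennreal (s powr (1 - p)) * 1"
    using assms by (intro add_mono mult_left_mono) (auto simp: emeasure_mu_ball)
  also have "\<dots> = ennreal (s * wt c r + s powr (1 - p))"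
    using s w by (simp add: ennreal_mult)
  also have "s * wt c r + s powr (1 - p) = 2 * wt c r powr (1 - 1 / p)"
  proof -
    have "s * wt c r = wt c r powr (1 - 1 / p)"
      using w powr_mult_base[of "wt c r" "- 1 / p"] by (simp add: s_def mult.commute)
    moreover have "s powr (1 - p) = wt c r powr (1 - 1 / p)"
    proof -
      have "- 1 / p * (1 - p) = 1 - 1 / p" using assms by (simp add: field_simps)
      then show ?thesis by (simp add: s_def powr_powr)
    qed
    ultimately show ?thesis by simp
  qed
  finally show ?thesis .
qed

end

section \<open>Dyadic decomposition of singular kernels\<close>

lemma dyadic_annulus_near:
  fixes t R :: real
  assumes "0 < t" "t < R"
  obtains j :: nat where "R * (1/2) ^ j / 2 \<le> t" "t < R * (1/2) ^ j"
proof -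
  have "\<exists>j. R * (1/2) ^ j / 2 \<le> t"
  proof -
    obtain j :: nat where "(1/2) ^ j < 2 * t / R"
      using real_arch_pow_inv[of "2 * t / R" "1/2"] assms by auto
    then show ?thesis using assms by (intro exI[of _ j]) (simp add: field_simps)
  qed
  define j where "j = (LEAST j. R * (1/2) ^ j / 2 \<le> t)"
  have j: "R * (1/2) ^ j / 2 \<le> t" unfolding j_def using \<open>\<exists>j. _\<close> by (rule LeastI_ex)
  have "t < R * (1/2) ^ j"
  proof (cases j)
    case (Suc k)
    then have "\<not> R * (1/2) ^ k / 2 \<le> t"
      using not_less_Least[of k "\<lambda>j. R * (1/2) ^ j / 2 \<le> t"] by (simp add: j_def)
    with Suc show ?thesis by simp
  qed (use assms in simp)
  with j show ?thesis by (rule that)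
qed

lemma dyadic_annulus_far:
  fixes t R :: real
  assumes "0 < R" "R \<le> t"
  obtains j :: nat where "R * 2 ^ Suc j / 2 \<le> t" "t < R * 2 ^ Suc j"
proof -
  have "\<exists>j. t < R * 2 ^ Suc j"
  proof -
    obtain j :: nat where "t / R < 2 ^ j"
      using real_arch_pow[of 2 "t / R"] by auto
    then have "t < R * 2 ^ j" using assms by (simp add: field_simps)
    also have "\<dots> \<le> R * 2 ^ Suc j" using assms by simp
    finally show ?thesis ..
  qed
  define j where "j = (LEAST j. t < R * 2 ^ Suc j)"
  have j: "t < R * 2 ^ Suc j" unfolding j_def using \<open>\<exists>j. _\<close> by (rule LeastI_ex)
  have "R * 2 ^ Suc j / 2 \<le> t"
  proof (cases j)
    case (Suc k)
    then have "\<not> t < R * 2 ^ Suc k"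
      using not_less_Least[of k "\<lambda>j. t < R * 2 ^ Suc j"] by (simp add: j_def)
    with Suc show ?thesis by simp
  qed (use assms in simp)
  from this j show ?thesis by (rule that)
qed

lemma kernel_shell_le:
  fixes s t \<beta> :: real
  assumes "0 < t" "0 \<le> \<beta>" "t / 2 \<le> s"
  shows "s powr - \<beta> \<le> 2 powr \<beta> * t powr - \<beta>"
proof -
  have "s powr - \<beta> \<le> (t / 2) powr - \<beta>"
    using assms by (intro powr_mono2') auto
  also have "\<dots> = 2 powr \<beta> * t powr - \<beta>"
    using assms by (simp add: powr_divide powr_minus_divide)
  finally show ?thesis .
qed

text \<open>On the shell of outer radius \<rho> the kernel is at most 2^\<beta> \<rho>^(-\<beta>),
  after which the shell is enlarged to the full ball. The point z = x need not lie in any shell,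
  because \<open>0 powr _ = 0\<close> makes the integrand vanish there.\<close>

lemma nn_integral_kernel_shells:
  fixes h :: "'a::euclidean_space \<Rightarrow> ennreal" and \<rho> :: "nat \<Rightarrow> real"
  assumes [measurable]: "h \<in> borel_measurable borel" "S \<in> sets borel" and "0 \<le> \<beta>" and pos: "\<And>j. 0 < \<rho> j"
    and shell: "\<And>z. z \<in> S \<Longrightarrow> z \<noteq> x \<Longrightarrow> \<exists>j. \<rho> j / 2 \<le> norm (x - z) \<and> norm (x - z) < \<rho> j"
  shows "(\<integral>\<^sup>+z\<in>S. ennreal (norm (x - z) powr - \<beta>) * h z \<partial>lborel)
    \<le> ennreal (2 powr \<beta>) * (\<Sum>j. ennreal (\<rho> j powr - \<beta>) * (\<integral>\<^sup>+z\<in>ball x (\<rho> j). h z \<partial>lborel))"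
proof -
  have [measurable]: "ball x r \<in> sets borel" for r by (simp add: borel_open)
  have "(\<integral>\<^sup>+z\<in>S. ennreal (norm (x - z) powr - \<beta>) * h z \<partial>lborel)
    \<le> (\<integral>\<^sup>+z. ennreal (2 powr \<beta>) * (\<Sum>j. ennreal (\<rho> j powr - \<beta>) * (h z * indicator (ball x (\<rho> j)) z)) \<partial>lborel)"
  proof (intro nn_integral_mono)
    fix z
    show "ennreal (norm (x - z) powr - \<beta>) * h z * indicator S z
       \<le> ennreal (2 powr \<beta>) * (\<Sum>j. ennreal (\<rho> j powr - \<beta>) * (h z * indicator (ball x (\<rho> j)) z))"
    proof (cases "z \<in> S \<and> z \<noteq> x")
      case True
      then obtain j where j: "\<rho> j / 2 \<le> norm (x - z)" "norm (x - z) < \<rho> j" using shell by blast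
      have "ennreal (norm (x - z) powr - \<beta>) * h z \<le> ennreal (2 powr \<beta> * \<rho> j powr - \<beta>) * h z"
        using kernel_shell_le[OF pos assms(3) j(1)] by (intro mult_right_mono ennreal_leI) auto
      also have "\<dots> = ennreal (2 powr \<beta>) * (\<Sum>i\<in>{j}. ennreal (\<rho> i powr - \<beta>) * (h z * indicator (ball x (\<rho> i)) z))"
        using j by (simp add: dist_norm ennreal_mult mult.assoc)
      also have "\<dots> \<le> ennreal (2 powr \<beta>) * (\<Sum>i. ennreal (\<rho> i powr - \<beta>) * (h z * indicator (ball x (\<rho> i)) z))"
        by (intro mult_left_mono sum_le_suminf) auto
      finally show ?thesis using True by simp
    qed auto
  qed
  also have "\<dots> = ennreal (2 powr \<beta>) * (\<Sum>j. ennreal (\<rho> j powr - \<beta>) * (\<integral>\<^sup>+z\<in>ball x (\<rho> j). h z \<partial>lborel))"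
    by (simp add: nn_integral_cmult nn_integral_suminf)
  finally show ?thesis .
qed

lemma nn_integral_kernel_near:
  fixes h :: "'a::euclidean_space \<Rightarrow> ennreal"
  assumes "h \<in> borel_measurable borel" and "0 \<le> \<beta>" and "0 < R"
  shows "(\<integral>\<^sup>+z\<in>ball x R. ennreal (norm (x - z) powr - \<beta>) * h z \<partial>lborel)
    \<le> ennreal (2 powr \<beta>) * (\<Sum>j. ennreal ((R * (1/2) ^ j) powr - \<beta>) * (\<integral>\<^sup>+z\<in>ball x (R * (1/2) ^ j). h z \<partial>lborel))"
proof (rule nn_integral_kernel_shells)
  fix z assume "z \<in> ball x R" "z \<noteq> x"
  then show "\<exists>j. R * (1/2) ^ j / 2 \<le> norm (x - z) \<and> norm (x - z) < R * (1/2) ^ j"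
    using dyadic_annulus_near[of "norm (x - z)" R] by (auto simp: dist_norm)
qed (use assms in \<open>auto simp: borel_open\<close>)

lemma nn_integral_kernel_far:
  fixes h :: "'a::euclidean_space \<Rightarrow> ennreal"
  assumes "h \<in> borel_measurable borel" and "0 \<le> \<beta>" and "0 < R"
  shows "(\<integral>\<^sup>+z\<in>- ball x R. ennreal (norm (x - z) powr - \<beta>) * h z \<partial>lborel)
    \<le> ennreal (2 powr \<beta>) * (\<Sum>j. ennreal ((R * 2 ^ Suc j) powr - \<beta>) * (\<integral>\<^sup>+z\<in>ball x (R * 2 ^ Suc j). h z \<partial>lborel))"
proof (rule nn_integral_kernel_shells)
  fix z assume "z \<in> - ball x R" "z \<noteq> x"
  then show "\<exists>j. R * 2 ^ Suc j / 2 \<le> norm (x - z) \<and> norm (x - z) < R * 2 ^ Suc j"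
    using dyadic_annulus_far[of R "norm (x - z)"] assms(3) by (auto simp: dist_norm not_less)
qed (use assms in \<open>auto simp: borel_open\<close>)

lemma nn_integral_split_ball:
  fixes f :: "'a::euclidean_space \<Rightarrow> ennreal"
  assumes [measurable]: "f \<in> borel_measurable borel"
  shows "(\<integral>\<^sup>+z. f z \<partial>lborel) = (\<integral>\<^sup>+z\<in>ball x R. f z \<partial>lborel) + (\<integral>\<^sup>+z\<in>- ball x R. f z \<partial>lborel)"
proof -
  have [measurable]: "ball x R \<in> sets borel" by (simp add: borel_open)
  show ?thesis
    by (subst nn_integral_add[symmetric]) (auto intro!: nn_integral_cong simp: indicator_def)
qed

lemma power_powr_commute:
  fixes a b :: real
  shows "0 < a \<Longrightarrow> (a ^ j) powr b = (a powr b) ^ j"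
  by (induction j) (simp_all add: powr_mult)

lemma suminf_geometric_ennreal:
  fixes c x :: real
  assumes "0 \<le> c" "0 \<le> x" "x < 1"
  shows "(\<Sum>j. ennreal (c * x ^ j)) = ennreal (c / (1 - x))"
proof -
  have "(\<lambda>j. c * x ^ j) sums (c * (1 / (1 - x)))"
    using assms by (intro sums_mult geometric_sums) auto
  then show ?thesis
    using assms by (subst suminf_ennreal2) (auto simp: sums_iff)
qed

section \<open>The Riesz potential on A1 weights\<close>

definition riesz :: "real \<Rightarrow> ('a::euclidean_space \<Rightarrow> real) \<Rightarrow> 'a \<Rightarrow> ennreal" where
  "riesz \<alpha> h x = (\<integral>\<^sup>+z. ennreal (norm (x - z) powr (\<alpha> - DIM('a))) * ennreal (h z) \<partial>lborel)"

context A1_weight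
begin

text \<open>With e = 1 - \<alpha>/n the factor |B|^e is proportional to r^(n-\<alpha>) and cancels
  the kernel. What remains depends on the radius only through the weighted mass of the ball.\<close>

lemma riesz_term:
  fixes \<alpha> r :: real
  assumes [measurable]: "G \<in> borel_measurable borel" and "0 < r" and "0 < \<alpha>" "\<alpha> < DIM('a)" and "\<And>x. 0 \<le> G x"
  shows "ennreal (r powr (\<alpha> - DIM('a))) * (\<integral>\<^sup>+z\<in>ball x r. ennreal (G z * W z powr (\<alpha> / DIM('a))) \<partial>lborel)
    \<le> ennreal ((K * unit_ball_vol (real DIM('a))) powr (1 - \<alpha> / DIM('a)) * wt x r powr (\<alpha> / DIM('a) - 1))
       * (\<integral>\<^sup>+z\<in>ball x r. ennreal (G z) \<partial>\<mu>)"
proof -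
  let ?v = "unit_ball_vol (real DIM('a))" and ?n = "real DIM('a)"
  have v: "0 < ?v" and w: "0 < wt x r" using wt_pos assms by auto
  have "ennreal (r powr (\<alpha> - ?n)) * (\<integral>\<^sup>+z\<in>ball x r. ennreal (G z * W z powr (\<alpha> / ?n)) \<partial>lborel)
    \<le> ennreal (r powr (\<alpha> - ?n)) *
      (ennreal ((K * ?v * r ^ DIM('a) / wt x r) powr (1 - \<alpha> / ?n)) * (\<integral>\<^sup>+z\<in>ball x r. ennreal (G z) \<partial>\<mu>))"
    using nn_integral_ball_powr_le[of G r "1 - \<alpha> / ?n" x] assms
    by (intro mult_left_mono) (auto simp: field_simps)
  also have "\<dots> = ennreal (r powr (\<alpha> - ?n) * (K * ?v * r ^ DIM('a) / wt x r) powr (1 - \<alpha> / ?n)) * (\<integral>\<^sup>+z\<in>ball x r. ennreal (G z) \<partial>\<mu>)"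
    by (simp add: ennreal_mult mult.assoc)
  also have "r powr (\<alpha> - ?n) * (K * ?v * r ^ DIM('a) / wt x r) powr (1 - \<alpha> / ?n)
     = (K * ?v) powr (1 - \<alpha> / ?n) * wt x r powr (\<alpha> / ?n - 1)"
  proof -
    have "(r ^ DIM('a)) powr (1 - \<alpha> / ?n) = r powr (?n * (1 - \<alpha> / ?n))"
      using assms by (simp add: powr_powr flip: powr_realpow)
    also have "?n * (1 - \<alpha> / ?n) = ?n - \<alpha>" by (simp add: field_simps)
    finally have "r powr (\<alpha> - ?n) * (r ^ DIM('a)) powr (1 - \<alpha> / ?n) = 1"
      using assms by (simp flip: powr_add)
    moreover have "(1 / wt x r) powr (1 - \<alpha> / ?n) = wt x r powr (\<alpha> / ?n - 1)"
      using w by (simp add: powr_divide powr_minus_divide[symmetric])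
    moreover have "(K * ?v * r ^ DIM('a) / wt x r) powr (1 - \<alpha> / ?n)
      = (K * ?v) powr (1 - \<alpha> / ?n) * (r ^ DIM('a)) powr (1 - \<alpha> / ?n) * (1 / wt x r) powr (1 - \<alpha> / ?n)"
      using w K_ge_1 v assms by (subst powr_mult[symmetric], simp_all)+
    ultimately show ?thesis by simp
  qed
  finally show ?thesis .
qed

text \<open>Inside the radius R the integral of G over a ball is bounded by the mass times the
  maximal function, outside by the normalisation of G. The two summands in C are the sums of the
  corresponding geometric series.\<close>

lemma riesz_le_avg_max:
  fixes \<alpha> p0 q0 x
  defines "n \<equiv> real DIM('a)"
  defines "C \<equiv> 2 powr (n - \<alpha>) * (K * unit_ball_vol n) powr (1 - \<alpha> / n) *
    (1 / (1 - decay powr (\<alpha> / n)) + 2 / (1 - decay powr (1 / q0)))"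
  assumes [measurable]: "G \<in> borel_measurable borel" and G: "\<And>x. 0 \<le> G x"
    and \<alpha>: "0 < \<alpha>" "\<alpha> < n" and p0: "1 < p0" and q0: "0 < q0" "1 / q0 = 1 / p0 - \<alpha> / n"
    and norm1: "(\<integral>\<^sup>+z. ennreal (G z powr p0) \<partial>\<mu>) \<le> 1"
  shows "riesz \<alpha> (\<lambda>z. G z * W z powr (\<alpha> / n)) x \<le> ennreal C * ennreal_powr (avg_max \<mu> G x) (p0 / q0)"
proof -
  define h where "h z = G z * W z powr (\<alpha> / n)" for z
  define c where "c = (K * unit_ball_vol n) powr (1 - \<alpha> / n)"
  have [measurable]: "h \<in> borel_measurable borel" unfolding h_def by measurable
  have v: "0 < unit_ball_vol n" by (simp add: n_def)
  have n: "0 < n" by (simp add: n_def)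
  have c: "0 < c" using v K_ge_1 by (simp add: c_def)
  have d1: "decay powr (\<alpha> / n) < 1" "decay powr (1 / q0) < 1"
    using decay \<alpha> q0(1) n powr_less_mono2[of "\<alpha> / n" decay 1] powr_less_mono2[of "1 / q0" decay 1] by auto
  have C: "C = 2 powr (n - \<alpha>) * (c / (1 - decay powr (\<alpha> / n)) + c * 2 / (1 - decay powr (1 / q0)))"
    by (simp add: C_def c_def algebra_simps add_divide_distrib)
  have ball_le: "ennreal (r powr - (n - \<alpha>)) * (\<integral>\<^sup>+z\<in>ball x r. ennreal (h z) \<partial>lborel)
     \<le> ennreal (c * wt x r powr (\<alpha> / n - 1)) * (\<integral>\<^sup>+z\<in>ball x r. ennreal (G z) \<partial>\<mu>)" if "0 < r" for r
    using riesz_term[of G r \<alpha> x] that G \<alpha> unfolding n_def h_def c_def by simp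
  have split: "riesz \<alpha> h x \<le>
      ennreal (2 powr (n - \<alpha>)) * (\<Sum>j. ennreal ((R * (1/2) ^ j) powr - (n - \<alpha>)) * (\<integral>\<^sup>+z\<in>ball x (R * (1/2) ^ j). ennreal (h z) \<partial>lborel))
    + ennreal (2 powr (n - \<alpha>)) * (\<Sum>j. ennreal ((R * 2 ^ Suc j) powr - (n - \<alpha>)) * (\<integral>\<^sup>+z\<in>ball x (R * 2 ^ Suc j). ennreal (h z) \<partial>lborel))"
    if "0 < R" for R
  proof -
    have "riesz \<alpha> h x = (\<integral>\<^sup>+z\<in>ball x R. ennreal (norm (x - z) powr - (n - \<alpha>)) * ennreal (h z) \<partial>lborel)
       + (\<integral>\<^sup>+z\<in>- ball x R. ennreal (norm (x - z) powr - (n - \<alpha>)) * ennreal (h z) \<partial>lborel)"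
      unfolding riesz_def n_def[symmetric] minus_diff_eq by (rule nn_integral_split_ball) measurable
    also have "\<dots> \<le> ennreal (2 powr (n - \<alpha>)) * (\<Sum>j. ennreal ((R * (1/2) ^ j) powr - (n - \<alpha>)) * (\<integral>\<^sup>+z\<in>ball x (R * (1/2) ^ j). ennreal (h z) \<partial>lborel))
      + ennreal (2 powr (n - \<alpha>)) * (\<Sum>j. ennreal ((R * 2 ^ Suc j) powr - (n - \<alpha>)) * (\<integral>\<^sup>+z\<in>ball x (R * 2 ^ Suc j). ennreal (h z) \<partial>lborel))"
      using \<alpha> that by (intro add_mono nn_integral_kernel_near nn_integral_kernel_far) auto
    finally show ?thesis .
  qed
  have avg: "(\<integral>\<^sup>+z\<in>ball x r. ennreal (G z) \<partial>\<mu>) \<le> ennreal (wt x r) * avg_max \<mu> G x" if "0 < r" for r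
    using nn_integral_ball_le_avg_max[of x x r G] that by (simp add: emeasure_mu_ball)
  have "riesz \<alpha> h x \<le> ennreal C * ennreal_powr (avg_max \<mu> G x) (p0 / q0)"
  proof (cases "avg_max \<mu> G x")
    case top
    have "0 < C" unfolding C using c d1 by (intro mult_pos_pos add_pos_pos divide_pos_pos) auto
    then show ?thesis using top by (simp add: ennreal_mult_top)
  next
    case (real M)
    show ?thesis
    proof (cases "M = 0")
      case True
      have "ennreal (r powr - (n - \<alpha>)) * (\<integral>\<^sup>+z\<in>ball x r. ennreal (h z) \<partial>lborel) = 0" if "0 < r" for r
        using ball_le[OF that] avg[OF that] real True by simp
      then have "riesz \<alpha> h x \<le> 0" using split[of 1] by (simp del: power_Suc)
      then show ?thesis by simp
    next
      case False
      then have M: "0 < M" using real by simp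
      \<comment> \<open>For a ball of mass w the two bounds on the integral of G are w M and 2
        w^(1-1/p0). Up to the factor 2 they agree at w = M^(-p0), so this is where the splitting
        radius belongs.\<close>
      define t where "t = M powr - p0"
      have t: "0 < t" using M by (simp add: t_def)
      obtain R where R: "0 < R" "wt x R \<le> t" "t < wt x (2 * R)" using exists_radius[OF t] .
      have tM: "t powr (\<alpha> / n) * M = M powr (p0 / q0)" "t powr - (1 / q0) = M powr (p0 / q0)"
      proof -
        have "p0 / q0 = 1 - p0 * (\<alpha> / n)" using q0 p0 by (simp add: field_simps)
        then show "t powr (\<alpha> / n) * M = M powr (p0 / q0)"
          using M powr_add[of M "- p0 * (\<alpha> / n)" 1] by (simp add: t_def powr_powr)
        show "t powr - (1 / q0) = M powr (p0 / q0)" by (simp add: t_def powr_powr)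
      qed
      have near: "ennreal ((R * (1/2) ^ j) powr - (n - \<alpha>)) * (\<integral>\<^sup>+z\<in>ball x (R * (1/2) ^ j). ennreal (h z) \<partial>lborel)
         \<le> ennreal (c * M powr (p0 / q0) * (decay powr (\<alpha> / n)) ^ j)" for j
      proof -
        let ?r = "R * (1/2) ^ j"
        have r: "0 < ?r" using R by simp
        have w: "0 < wt x ?r" using r by (rule wt_pos)
        have "ennreal (?r powr - (n - \<alpha>)) * (\<integral>\<^sup>+z\<in>ball x ?r. ennreal (h z) \<partial>lborel)
          \<le> ennreal (c * wt x ?r powr (\<alpha> / n - 1)) * (ennreal (wt x ?r) * ennreal M)"
          using avg[OF r] real by (intro order_trans[OF ball_le[OF r]] mult_left_mono) auto
        also have "\<dots> = ennreal (c * (wt x ?r powr (\<alpha> / n - 1) * wt x ?r) * M)"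
          using c w M by (simp add: ennreal_mult mult_ac)
        also have "wt x ?r powr (\<alpha> / n - 1) * wt x ?r = wt x ?r powr (\<alpha> / n)"
          using w powr_mult_base[of "wt x ?r" "\<alpha> / n - 1"] by (simp add: mult.commute)
        also have "ennreal (c * wt x ?r powr (\<alpha> / n) * M) \<le> ennreal (c * (decay ^ j * t) powr (\<alpha> / n) * M)"
        proof -
          have "wt x ?r \<le> decay ^ j * t"
            using decay by (intro order_trans[OF wt_shrink[OF R(1)]] mult_left_mono R(2)) simp
          then show ?thesis
            using c M w \<alpha> n by (intro ennreal_leI mult_right_mono mult_left_mono powr_mono2) auto
        qed
        also have "c * (decay ^ j * t) powr (\<alpha> / n) * M = c * (t powr (\<alpha> / n) * M) * (decay powr (\<alpha> / n)) ^ j"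
          using decay t by (simp add: powr_mult power_powr_commute)
        finally show ?thesis by (simp add: tM)
      qed
      \<comment> \<open>The exponents of the mass add up to \<alpha>/n - 1/p0 = -1/q0, which is
        negative, so growth of the mass gives decay. The balls start at radius 2 R because only
        there is the mass known to exceed t.\<close>
      have far: "ennreal ((R * 2 ^ Suc j) powr - (n - \<alpha>)) * (\<integral>\<^sup>+z\<in>ball x (R * 2 ^ Suc j). ennreal (h z) \<partial>lborel)
         \<le> ennreal (c * 2 * M powr (p0 / q0) * (decay powr (1 / q0)) ^ j)" for j
      proof -
        let ?r = "R * 2 ^ Suc j"
        have r: "0 < ?r" using R by simp
        have w: "0 < wt x ?r" using r by (rule wt_pos)
        have "ennreal (?r powr - (n - \<alpha>)) * (\<integral>\<^sup>+z\<in>ball x ?r. ennreal (h z) \<partial>lborel)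
          \<le> ennreal (c * wt x ?r powr (\<alpha> / n - 1)) * ennreal (2 * wt x ?r powr (1 - 1 / p0))"
          using nn_integral_ball_le_wt[OF assms(3) r p0 G norm1, of x]
          by (intro order_trans[OF ball_le[OF r]] mult_left_mono) auto
        also have "\<dots> = ennreal (c * 2 * (wt x ?r powr (\<alpha> / n - 1) * wt x ?r powr (1 - 1 / p0)))"
          using c by (simp add: ennreal_mult[symmetric] mult_ac)
        also have "wt x ?r powr (\<alpha> / n - 1) * wt x ?r powr (1 - 1 / p0) = wt x ?r powr - (1 / q0)"
          using q0 by (simp flip: powr_add)
        also have "ennreal (c * 2 * wt x ?r powr - (1 / q0)) \<le> ennreal (c * 2 * (t / decay ^ j) powr - (1 / q0))"
        proof -
          have "t \<le> decay ^ j * wt x ?r"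
            using wt_grow[of "2 * R" x j] R by (simp add: mult_ac)
          then have "t / decay ^ j \<le> wt x ?r" using decay by (simp add: field_simps)
          then show ?thesis
            using c t decay q0(1) by (intro ennreal_leI mult_left_mono powr_mono2') auto
        qed
        also have "c * 2 * (t / decay ^ j) powr - (1 / q0) = c * 2 * t powr - (1 / q0) * (decay powr (1 / q0)) ^ j"
          using decay t by (simp add: powr_divide powr_minus_divide power_powr_commute)
        finally show ?thesis by (simp add: tM)
      qed
      have "riesz \<alpha> h x \<le> ennreal (2 powr (n - \<alpha>)) * (\<Sum>j. ennreal (c * M powr (p0 / q0) * (decay powr (\<alpha> / n)) ^ j))
        + ennreal (2 powr (n - \<alpha>)) * (\<Sum>j. ennreal (c * 2 * M powr (p0 / q0) * (decay powr (1 / q0)) ^ j))"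
        using near far by (intro order_trans[OF split[OF R(1)]] add_mono mult_left_mono suminf_le) auto
      also have "\<dots> = ennreal (2 powr (n - \<alpha>)) * ennreal (c * M powr (p0 / q0) / (1 - decay powr (\<alpha> / n)))
        + ennreal (2 powr (n - \<alpha>)) * ennreal (c * 2 * M powr (p0 / q0) / (1 - decay powr (1 / q0)))"
        using c d1 by (subst (1 2) suminf_geometric_ennreal) auto
      also have "\<dots> = ennreal (2 powr (n - \<alpha>) * (c * M powr (p0 / q0) / (1 - decay powr (\<alpha> / n)))
        + 2 powr (n - \<alpha>) * (c * 2 * M powr (p0 / q0) / (1 - decay powr (1 / q0))))"
        using c d1 by (subst ennreal_plus) (auto simp del: times_divide_eq_right simp: ennreal_mult)
      also have "2 powr (n - \<alpha>) * (c * M powr (p0 / q0) / (1 - decay powr (\<alpha> / n)))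
        + 2 powr (n - \<alpha>) * (c * 2 * M powr (p0 / q0) / (1 - decay powr (1 / q0))) = C * M powr (p0 / q0)"
        unfolding C by (simp add: algebra_simps)
      also have "\<dots> = ennreal C * ennreal_powr (avg_max \<mu> G x) (p0 / q0)"
        using real c d1 unfolding C by (simp add: ennreal_powr_ennreal ennreal_mult)
      finally show ?thesis .
    qed
  qed
  then show ?thesis unfolding h_def[abs_def] .
qed

end

section \<open>Weighted norm inequalities\<close>

text \<open>The quantifier order is the point: B is chosen after K and before W, so the bound is
  uniform over all weights with the same A1 constant. Normalising the right side to 1 replaces the
  homogeneous form of the inequality.\<close>

definition weighted_bound ::
  "(('a::euclidean_space \<Rightarrow> real) \<Rightarrow> 'a \<Rightarrow> ennreal) \<Rightarrow> real \<Rightarrow> real \<Rightarrow> bool" where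
  "weighted_bound S p q \<longleftrightarrow> (\<forall>K\<ge>1. \<exists>B\<ge>0. \<forall>W h. A1_weight W K \<longrightarrow> h \<in> borel_measurable borel \<longrightarrow> (\<forall>x. 0 \<le> h x) \<longrightarrow>
     (\<integral>\<^sup>+x. ennreal (h x powr p * W x powr (p / q)) \<partial>lborel) \<le> 1 \<longrightarrow>
     (\<integral>\<^sup>+x. ennreal_powr (S h x) q * ennreal (W x) \<partial>lborel) \<le> ennreal B)"

text \<open>Cut off in height and in support, so that its powers are integrable for every locally
  finite measure; being real valued, it can also serve as a test function.\<close>

definition trunc_fun :: "nat \<Rightarrow> ('a::real_normed_vector \<Rightarrow> ennreal) \<Rightarrow> 'a \<Rightarrow> real" where
  "trunc_fun N f x = enn2real (min (f x) (of_nat N)) * indicator (ball 0 (real N)) x"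

lemma trunc_fun_nonneg: "0 \<le> trunc_fun N f x"
  by (simp add: trunc_fun_def)

lemma trunc_fun_le: "trunc_fun N f x \<le> real N"
proof -
  have "min (f x) (of_nat N) \<le> of_nat N" by simp
  then have "enn2real (min (f x) (of_nat N)) \<le> real N"
    by (metis enn2real_leI ennreal_of_nat_eq_real_of_nat of_nat_0_le_iff)
  then show ?thesis by (simp add: trunc_fun_def indicator_def)
qed

lemma trunc_fun_outside: "x \<notin> ball 0 (real N) \<Longrightarrow> trunc_fun N f x = 0"
  by (simp add: trunc_fun_def)

lemma ennreal_trunc_fun_le: "ennreal (trunc_fun N f x) \<le> f x"
proof -
  have "min (f x) (of_nat N) < top" by (metis min_less_iff_disj of_nat_less_top)
  then have "ennreal (enn2real (min (f x) (of_nat N))) = min (f x) (of_nat N)"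
    by (simp add: less_top)
  then show ?thesis by (simp add: trunc_fun_def indicator_def)
qed

lemma borel_measurable_trunc_fun [measurable]:
  fixes f :: "'a::euclidean_space \<Rightarrow> ennreal"
  assumes [measurable]: "f \<in> borel_measurable borel"
  shows "trunc_fun N f \<in> borel_measurable borel"
proof -
  have [measurable]: "ball 0 r \<in> sets (borel :: 'a measure)" for r by (simp add: borel_open)
  show ?thesis unfolding trunc_fun_def[abs_def] by measurable
qed

text \<open>Fatou's lemma. Where f is finite the truncations eventually equal f; where f is infinite
  they eventually equal N, and N^e w tends to \<infinity> unless w = 0.\<close>

lemma nn_integral_le_truncated:
  fixes f w :: "'a::euclidean_space \<Rightarrow> ennreal"
  assumes [measurable]: "f \<in> borel_measurable borel" "e \<in> borel_measurable borel" "w \<in> borel_measurable borel"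
    and e: "AE x in lborel. 0 < e x"
    and bound: "\<And>N. (\<integral>\<^sup>+x. ennreal (trunc_fun N f x powr e x) * w x \<partial>lborel) \<le> B"
  shows "(\<integral>\<^sup>+x. ennreal_powr (f x) (e x) * w x \<partial>lborel) \<le> B"
proof -
  have ptw: "ennreal_powr (f x) (e x) * w x \<le> liminf (\<lambda>N. ennreal (trunc_fun N f x powr e x) * w x)" if "0 < e x" for x
  proof -
    obtain N0 :: nat where N0: "norm x < real N0" using reals_Archimedean2 by blast
    show ?thesis
    proof (cases "f x")
      case (real c)
      obtain N1 :: nat where N1: "c \<le> real N1" using real_arch_simple by blast
      have "ennreal_powr (f x) (e x) * w x = ennreal (trunc_fun N f x powr e x) * w x" if "N \<ge> max N0 N1" for N
      proof -
        have "c \<le> real N" "norm x < real N" using that N0 N1 by linarith+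
        then have "trunc_fun N f x = c"
          using real by (simp add: trunc_fun_def min_def ennreal_of_nat_eq_real_of_nat)
        then show ?thesis using real by (simp add: ennreal_powr_ennreal)
      qed
      then have "\<forall>\<^sub>F N in sequentially. ennreal_powr (f x) (e x) * w x \<le> ennreal (trunc_fun N f x powr e x) * w x"
        by (auto simp: eventually_sequentially intro!: exI[of _ "max N0 N1"])
      then show ?thesis by (rule Liminf_bounded)
    next
      case top
      have ev: "\<forall>\<^sub>F N in sequentially. ennreal (trunc_fun N f x powr e x) * w x = ennreal (real N powr e x) * w x"
        unfolding eventually_sequentially
      proof (intro exI[of _ N0] allI impI)
        fix N assume "N0 \<le> N"
        then have "norm x < real N" using N0 by linarith
        then show "ennreal (trunc_fun N f x powr e x) * w x = ennreal (real N powr e x) * w x"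
          using top by (simp add: trunc_fun_def min_def ennreal_of_nat_eq_real_of_nat top_unique)
      qed
      show ?thesis
      proof (cases "w x = 0")
        case False
        \<comment> \<open>Since w may be infinite at x, a positive real number below it is used for
          the divergence.\<close>
        define c where "c = enn2real (min 1 (w x))"
        have "min 1 (w x) < top" by (metis min_less_iff_disj ennreal_one_less_top)
        then have c': "ennreal c = min 1 (w x)" by (simp add: c_def less_top)
        have "0 < min 1 (w x)" using False by (simp add: zero_less_iff_neq_zero)
        then have "0 < ennreal c" using c' by simp
        then have "0 < c" by (simp only: ennreal_less_zero_iff)
        moreover have "ennreal c \<le> w x" using c' by simp
        ultimately have c: "0 < c" "ennreal c \<le> w x" .
        have "filterlim (\<lambda>N. real N powr e x * c) at_top sequentially"
          unfolding filterlim_at_top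
        proof
          fix Z :: real
          obtain N1 :: nat where N1: "(max Z 1 / c) powr (1 / e x) \<le> real N1" using real_arch_simple by blast
          have "Z \<le> real N powr e x * c" if "N1 \<le> N" for N
          proof -
            have "max Z 1 / c = ((max Z 1 / c) powr (1 / e x)) powr e x"
              using c \<open>0 < e x\<close> by (simp add: powr_powr)
            also have "\<dots> \<le> real N powr e x"
              using N1 that \<open>0 < e x\<close> by (intro powr_mono2) auto
            finally show ?thesis using c by (simp add: field_simps)
          qed
          then show "\<forall>\<^sub>F N in sequentially. Z \<le> real N powr e x * c"
            by (auto simp: eventually_sequentially)
        qed
        then have "((\<lambda>N. ennreal (real N powr e x * c)) \<longlongrightarrow> top) sequentially"
          using c by (subst ennreal_tendsto_top_eq_at_top) auto
        then have "liminf (\<lambda>N. ennreal (real N powr e x * c)) = top"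
          by (intro lim_imp_Liminf) auto
        moreover have "liminf (\<lambda>N. ennreal (real N powr e x * c)) \<le> liminf (\<lambda>N. ennreal (trunc_fun N f x powr e x) * w x)"
          using ev
        proof (intro Liminf_mono, elim eventually_mono)
          fix N assume "ennreal (trunc_fun N f x powr e x) * w x = ennreal (real N powr e x) * w x"
          then show "ennreal (real N powr e x * c) \<le> ennreal (trunc_fun N f x powr e x) * w x"
            using c by (simp add: ennreal_mult mult_left_mono)
        qed
        ultimately show ?thesis by (simp add: top_unique)
      qed simp
    qed
  qed
  have "(\<integral>\<^sup>+x. ennreal_powr (f x) (e x) * w x \<partial>lborel) \<le> (\<integral>\<^sup>+x. liminf (\<lambda>N. ennreal (trunc_fun N f x powr e x) * w x) \<partial>lborel)"
    using e ptw by (intro nn_integral_mono_AE) (auto elim!: eventually_mono)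
  also have "\<dots> \<le> liminf (\<lambda>N. \<integral>\<^sup>+x. ennreal (trunc_fun N f x powr e x) * w x \<partial>lborel)"
    by (rule nn_integral_liminf) measurable
  also have "\<dots> \<le> limsup (\<lambda>N. \<integral>\<^sup>+x. ennreal (trunc_fun N f x powr e x) * w x \<partial>lborel)"
    by (intro Liminf_le_Limsup) simp
  also have "\<dots> \<le> B"
    using bound by (intro Limsup_bounded) simp
  finally show ?thesis .
qed

lemma borel_measurable_riesz [measurable]:
  fixes h :: "'a::euclidean_space \<Rightarrow> real"
  assumes [measurable]: "h \<in> borel_measurable borel"
  shows "riesz \<alpha> h \<in> borel_measurable borel"
  unfolding riesz_def[abs_def] by measurable

text \<open>The substitution h = G W^(\<alpha>/n) turns the norm of h with the weight W^(p/q) into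
  the norm of G in L^p(\<mu>), since p/q = 1 - p \<alpha>/n. Raising the pointwise bound to the
  power q leaves (M_W G)^p, which the maximal theorem for \<mu> controls.\<close>

lemma weighted_bound_riesz:
  fixes \<alpha> p q :: real
  assumes \<alpha>: "0 < \<alpha>" "\<alpha> < DIM('a::euclidean_space)" and p: "1 < p" and q: "0 < q" "1 / q = 1 / p - \<alpha> / DIM('a)"
  shows "weighted_bound (riesz \<alpha> :: ('a \<Rightarrow> real) \<Rightarrow> 'a \<Rightarrow> ennreal) p q"
  unfolding weighted_bound_def
proof (intro allI impI)
  fix K :: real assume K: "1 \<le> K"
  define n where "n = real DIM('a)"
  define C where "C = 2 powr (n - \<alpha>) * (K * unit_ball_vol n) powr (1 - \<alpha> / n) *
    (1 / (1 - A1_weight.decay K powr (\<alpha> / n)) + 2 / (1 - A1_weight.decay K powr (1 / q)))"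
  define C2 where "C2 = 2 * (K * 5 ^ DIM('a)) * p * 2 powr (p - 1) / (p - 1)"
  have "0 \<le> C2" unfolding C2_def using K p by (intro divide_nonneg_nonneg mult_nonneg_nonneg) auto
  have n: "0 < n" by (simp add: n_def)
  show "\<exists>B\<ge>0. \<forall>W (h :: 'a \<Rightarrow> real). A1_weight W K \<longrightarrow> h \<in> borel_measurable borel \<longrightarrow> (\<forall>x. 0 \<le> h x) \<longrightarrow>
     (\<integral>\<^sup>+x. ennreal (h x powr p * W x powr (p / q)) \<partial>lborel) \<le> 1 \<longrightarrow>
     (\<integral>\<^sup>+x. ennreal_powr (riesz \<alpha> h x) q * ennreal (W x) \<partial>lborel) \<le> ennreal B"
  proof (intro exI[of _ "C powr q * C2"] conjI allI impI)
    show "0 \<le> C powr q * C2" using \<open>0 \<le> C2\<close> by simp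
    fix W h :: "'a \<Rightarrow> real"
    assume "A1_weight W K" and [measurable]: "h \<in> borel_measurable borel" and h: "\<forall>x. 0 \<le> h x"
      and norm1: "(\<integral>\<^sup>+x. ennreal (h x powr p * W x powr (p / q)) \<partial>lborel) \<le> 1"
    then interpret A1_weight W K by simp
    define G where "G x = h x * W x powr - (\<alpha> / n)" for x
    have [measurable]: "G \<in> borel_measurable borel" unfolding G_def by measurable
    have G: "0 \<le> G x" for x using h by (simp add: G_def)
    have hG: "h = (\<lambda>x. G x * W x powr (\<alpha> / n))"
      using W_pos by (auto simp: G_def fun_eq_iff mult.assoc less_imp_neq[symmetric] simp flip: powr_add)
    have GW: "G x powr p * W x = h x powr p * W x powr (p / q)" for x
    proof -
      have "p / q = 1 - p * (\<alpha> / n)" using q p by (simp add: field_simps n_def)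
      then have "W x powr (p / q) = W x powr (- (\<alpha> / n) * p) * W x"
        using W_pos[of x] powr_add[of "W x" "- (\<alpha> / n) * p" 1] by (simp add: mult.commute)
      then show ?thesis using h W_pos[of x] by (simp add: G_def powr_mult powr_powr)
    qed
    have norm1': "(\<integral>\<^sup>+z. ennreal (G z powr p) \<partial>\<mu>) \<le> 1"
      using norm1 G W_pos by (simp add: nn_integral_density GW[symmetric] ennreal_mult mult.commute less_imp_le)
    have C_pos: "0 < C"
    proof -
      have "decay powr (\<alpha> / n) < 1" "decay powr (1 / q) < 1"
        using decay \<alpha> q(1) n powr_less_mono2[of "\<alpha> / n" decay 1] powr_less_mono2[of "1 / q" decay 1] by auto
      moreover have "0 < K * unit_ball_vol n" using K n by simp
      ultimately show ?thesis unfolding C_def by (intro mult_pos_pos add_pos_pos divide_pos_pos) auto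
    qed
    have R: "riesz \<alpha> h x \<le> ennreal C * ennreal_powr (avg_max \<mu> G x) (p / q)" for x
      unfolding C_def n_def
      by (subst hG) (unfold n_def, rule riesz_le_avg_max, use \<alpha> p q G norm1' in auto)
    have "(\<integral>\<^sup>+x. ennreal_powr (riesz \<alpha> h x) q * ennreal (W x) \<partial>lborel) = (\<integral>\<^sup>+x. ennreal_powr (riesz \<alpha> h x) q \<partial>\<mu>)"
      by (simp add: nn_integral_density mult.commute)
    also have "\<dots> \<le> (\<integral>\<^sup>+x. ennreal (C powr q) * ennreal_powr (avg_max \<mu> G x) p \<partial>\<mu>)"
    proof (rule nn_integral_mono)
      fix x
      have "ennreal_powr (riesz \<alpha> h x) q \<le> ennreal_powr (ennreal C * ennreal_powr (avg_max \<mu> G x) (p / q)) q"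
        using R q(1) by (intro ennreal_powr_mono) auto
      also have "\<dots> = ennreal (C powr q) * ennreal_powr (avg_max \<mu> G x) p"
        using C_pos q(1) by (simp add: ennreal_powr_cmult ennreal_powr_powr)
      finally show "ennreal_powr (riesz \<alpha> h x) q \<le> ennreal (C powr q) * ennreal_powr (avg_max \<mu> G x) p" .
    qed
    also have "\<dots> = ennreal (C powr q) * (\<integral>\<^sup>+x. ennreal_powr (avg_max \<mu> G x) p \<partial>\<mu>)"
      by (rule nn_integral_cmult) measurable
    also have "\<dots> \<le> ennreal (C powr q) * (ennreal C2 * (\<integral>\<^sup>+x. ennreal (G x powr p) \<partial>\<mu>))"
      unfolding C2_def using strong_type[of G p] G p by (intro mult_left_mono) auto
    also have "\<dots> \<le> ennreal (C powr q) * (ennreal C2 * 1)"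
      using norm1' by (intro mult_left_mono) auto
    also have "\<dots> = ennreal (C powr q * C2)" using \<open>0 \<le> C2\<close> by (simp add: ennreal_mult)
    finally show "(\<integral>\<^sup>+x. ennreal_powr (riesz \<alpha> h x) q * ennreal (W x) \<partial>lborel) \<le> ennreal (C powr q * C2)" .
  qed
qed

section \<open>The kernel of homogeneity zero\<close>

text \<open>A positive kernel, homogeneous of degree -n. Its singularity at z = x is only of order b
  < n, and since b - n is negative the second factor can be estimated by the larger of the two
  norms. The split at |z| = |x| gives the two parts below, whose kernels are transposes of each
  other.\<close>

definition stein :: "real \<Rightarrow> ('a::euclidean_space \<Rightarrow> real) \<Rightarrow> 'a \<Rightarrow> ennreal" where
  "stein b h x = (\<integral>\<^sup>+z. ennreal (norm (x - z) powr - b * (norm x + norm z) powr (b - DIM('a))) * ennreal (h z) \<partial>lborel)"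

definition inner_part :: "real \<Rightarrow> ('a::euclidean_space \<Rightarrow> real) \<Rightarrow> 'a \<Rightarrow> ennreal" where
  "inner_part b h x = (\<integral>\<^sup>+z. ennreal (norm (x - z) powr - b * norm x powr (b - DIM('a))) * ennreal (h z)
      * indicator {z. norm z \<le> norm x} z \<partial>lborel)"

definition outer_part :: "real \<Rightarrow> ('a::euclidean_space \<Rightarrow> real) \<Rightarrow> 'a \<Rightarrow> ennreal" where
  "outer_part b h x = (\<integral>\<^sup>+z. ennreal (norm (x - z) powr - b * norm z powr (b - DIM('a))) * ennreal (h z)
      * indicator {z. norm x \<le> norm z} z \<partial>lborel)"

lemma borel_measurable_stein [measurable]:
  fixes h :: "'a::euclidean_space \<Rightarrow> real"
  assumes [measurable]: "h \<in> borel_measurable borel"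
  shows "stein b h \<in> borel_measurable borel"
  unfolding stein_def[abs_def] by measurable

lemma borel_measurable_inner_part [measurable]:
  fixes h :: "'a::euclidean_space \<Rightarrow> real"
  assumes [measurable]: "h \<in> borel_measurable borel"
  shows "inner_part b h \<in> borel_measurable borel"
  unfolding inner_part_def[abs_def] by measurable

lemma borel_measurable_outer_part [measurable]:
  fixes h :: "'a::euclidean_space \<Rightarrow> real"
  assumes [measurable]: "h \<in> borel_measurable borel"
  shows "outer_part b h \<in> borel_measurable borel"
  unfolding outer_part_def[abs_def] by measurable

lemma stein_le:
  fixes h :: "'a::euclidean_space \<Rightarrow> real" and b :: real
  assumes [measurable]: "h \<in> borel_measurable borel" and b: "b < DIM('a)"
  shows "stein b h x \<le> inner_part b h x + outer_part b h x"
proof -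
  have "stein b h x \<le> (\<integral>\<^sup>+z. ennreal (norm (x - z) powr - b * norm x powr (b - DIM('a))) * ennreal (h z)
      * indicator {z. norm z \<le> norm x} z + ennreal (norm (x - z) powr - b * norm z powr (b - DIM('a))) * ennreal (h z)
      * indicator {z. norm x \<le> norm z} z \<partial>lborel)"
    unfolding stein_def
  proof (rule nn_integral_mono)
    fix z :: 'a
    have mono: "(norm x + norm z) powr (b - DIM('a)) \<le> t powr (b - DIM('a))"
      if "t \<le> norm x + norm z" "0 < t" for t
      using that b by (intro powr_mono2') auto
    consider "x = 0" "z = 0" | "norm z \<le> norm x" "0 < norm x" | "norm x < norm z" "0 < norm z"
      by fastforce
    then show "ennreal (norm (x - z) powr - b * (norm x + norm z) powr (b - DIM('a))) * ennreal (h z)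
      \<le> ennreal (norm (x - z) powr - b * norm x powr (b - DIM('a))) * ennreal (h z)
      * indicator {z. norm z \<le> norm x} z + ennreal (norm (x - z) powr - b * norm z powr (b - DIM('a))) * ennreal (h z)
      * indicator {z. norm x \<le> norm z} z"
    proof cases
      case 2
      then have "ennreal (norm (x - z) powr - b * (norm x + norm z) powr (b - DIM('a))) * ennreal (h z)
        \<le> ennreal (norm (x - z) powr - b * norm x powr (b - DIM('a))) * ennreal (h z)"
        by (intro mult_right_mono ennreal_leI mult_left_mono mono) auto
      also have "\<dots> \<le> \<dots> + ennreal (norm (x - z) powr - b * norm z powr (b - DIM('a))) * ennreal (h z)
      * indicator {z. norm x \<le> norm z} z" by simp
      finally show ?thesis using 2 by simp
    next
      case 3
      then have "ennreal (norm (x - z) powr - b * (norm x + norm z) powr (b - DIM('a))) * ennreal (h z)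
        \<le> ennreal (norm (x - z) powr - b * norm z powr (b - DIM('a))) * ennreal (h z)"
        by (intro mult_right_mono ennreal_leI mult_left_mono mono) auto
      then show ?thesis using 3 by simp
    qed simp
  qed
  also have "\<dots> = inner_part b h x + outer_part b h x"
    unfolding inner_part_def outer_part_def by (rule nn_integral_add) measurable
  finally show ?thesis .
qed

lemma outer_part_adjoint:
  fixes g h :: "'a::euclidean_space \<Rightarrow> real"
  assumes [measurable]: "g \<in> borel_measurable borel" "h \<in> borel_measurable borel"
  shows "(\<integral>\<^sup>+x. outer_part b h x * ennreal (g x) \<partial>lborel) = (\<integral>\<^sup>+z. ennreal (h z) * inner_part b g z \<partial>lborel)"
proof -
  have "(\<integral>\<^sup>+x. outer_part b h x * ennreal (g x) \<partial>lborel)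
    = (\<integral>\<^sup>+x. (\<integral>\<^sup>+z. ennreal (norm (x - z) powr - b * norm z powr (b - DIM('a))) * ennreal (h z)
      * indicator {z. norm x \<le> norm z} z * ennreal (g x) \<partial>lborel) \<partial>lborel)"
    unfolding outer_part_def by (intro nn_integral_cong nn_integral_multc[symmetric]) measurable
  also have "\<dots> = (\<integral>\<^sup>+z. (\<integral>\<^sup>+x. ennreal (norm (x - z) powr - b * norm z powr (b - DIM('a))) * ennreal (h z)
      * indicator {z. norm x \<le> norm z} z * ennreal (g x) \<partial>lborel) \<partial>lborel)"
    by (rule lborel_pair.Fubini') measurable
  also have "\<dots> = (\<integral>\<^sup>+z. (\<integral>\<^sup>+x. ennreal (h z) * (ennreal (norm (z - x) powr - b * norm z powr (b - DIM('a))) * ennreal (g x)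
      * indicator {x. norm x \<le> norm z} x) \<partial>lborel) \<partial>lborel)"
    by (intro nn_integral_cong) (auto simp: indicator_def norm_minus_commute mult_ac)
  also have "\<dots> = (\<integral>\<^sup>+z. ennreal (h z) * inner_part b g z \<partial>lborel)"
    unfolding inner_part_def by (intro nn_integral_cong nn_integral_cmult) measurable
  finally show ?thesis .
qed

text \<open>Here 2^b comes from comparing the kernel with its value on a dyadic shell, 4^(n-b) from
  the radius 4 |x|, and the denominator from the geometric series with ratio 2^(b-n).\<close>

definition inner_const :: "'a::euclidean_space itself \<Rightarrow> real \<Rightarrow> real" where
  "inner_const _ b = 2 powr b * 4 powr (real DIM('a) - b) / (1 - (1/2) powr (real DIM('a) - b))"

lemma inner_const_nonneg:
  "b < real DIM('a) \<Longrightarrow> 0 \<le> inner_const TYPE('a::euclidean_space) b"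
  using powr_less_mono2[of "DIM('a) - b" "1/2" 1] by (auto simp: inner_const_def intro!: divide_nonneg_nonneg)

text \<open>Every z with |z| \<le> |x| lies within 4 |x| of x. The dyadic shells inside that ball
  sum up because b < n, and the result has the power |x|^(n-b), which cancels the factor |x|^(b-n).
  Q abstracts the bound on averages because two different ones are inserted below.\<close>

lemma inner_part_le:
  fixes h :: "'a::euclidean_space \<Rightarrow> real" and b :: real
  assumes [measurable]: "h \<in> borel_measurable borel" and b: "0 \<le> b" "b < DIM('a)" and x: "x \<noteq> 0"
    and bound: "\<And>r. 0 < r \<Longrightarrow> (\<integral>\<^sup>+z\<in>ball x r. ennreal (h z) \<partial>lborel) \<le> ennreal (r ^ DIM('a)) * Q"
  shows "inner_part b h x \<le> ennreal (inner_const TYPE('a) b) * Q"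
proof -
  define n where "n = real DIM('a)"
  define d where "d = (1/2 :: real) powr (n - b)"
  define R where "R = 4 * norm x"
  have R: "0 < R" using x by (simp add: R_def)
  have d: "0 \<le> d" "d < 1" using powr_less_mono2[of "n - b" "1/2" 1] b by (auto simp: d_def n_def)
  have [measurable]: "ball x R \<in> sets borel" by (simp add: borel_open)
  have "inner_part b h x \<le> (\<integral>\<^sup>+z. ennreal (norm x powr (b - n)) * (ennreal (norm (x - z) powr - b) * ennreal (h z) * indicator (ball x R) z) \<partial>lborel)"
    unfolding inner_part_def n_def
  proof (rule nn_integral_mono)
    fix z
    show "ennreal (norm (x - z) powr - b * norm x powr (b - DIM('a))) * ennreal (h z) * indicator {z. norm z \<le> norm x} z
      \<le> ennreal (norm x powr (b - DIM('a))) * (ennreal (norm (x - z) powr - b) * ennreal (h z) * indicator (ball x R) z)"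
    proof (cases "norm z \<le> norm x")
      case True
      have "norm (x - z) \<le> norm x + norm z" by (rule norm_triangle_ineq4)
      also have "\<dots> < R" using True R unfolding R_def by linarith
      finally show ?thesis using True by (simp add: dist_norm ennreal_mult mult_ac)
    qed simp
  qed
  also have "\<dots> = ennreal (norm x powr (b - n)) * (\<integral>\<^sup>+z\<in>ball x R. ennreal (norm (x - z) powr - b) * ennreal (h z) \<partial>lborel)"
    by (rule nn_integral_cmult) measurable
  also have "\<dots> \<le> ennreal (norm x powr (b - n)) *
     (ennreal (2 powr b) * (\<Sum>j. ennreal ((R * (1/2) ^ j) powr - b) * (\<integral>\<^sup>+z\<in>ball x (R * (1/2) ^ j). ennreal (h z) \<partial>lborel)))"
    using b R by (intro mult_left_mono nn_integral_kernel_near) auto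
  also have "\<dots> \<le> ennreal (norm x powr (b - n)) * (ennreal (2 powr b) * (\<Sum>j. ennreal (R powr (n - b) * d ^ j) * Q))"
  proof (intro mult_left_mono suminf_le)
    fix j
    let ?r = "R * (1/2) ^ j"
    have r: "0 < ?r" using R by simp
    have "ennreal (?r powr - b) * (\<integral>\<^sup>+z\<in>ball x ?r. ennreal (h z) \<partial>lborel) \<le> ennreal (?r powr - b) * (ennreal (?r ^ DIM('a)) * Q)"
      using bound[OF r] by (intro mult_left_mono) auto
    also have "\<dots> = ennreal (?r powr - b * ?r ^ DIM('a)) * Q"
      using r by (simp add: ennreal_mult mult.assoc)
    also have "?r powr - b * ?r ^ DIM('a) = ?r powr (n - b)"
      using r powr_realpow[of ?r "DIM('a)"] by (simp add: n_def powr_diff powr_minus_divide)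
    also have "\<dots> = R powr (n - b) * d ^ j"
      using R by (simp only: powr_mult power_powr_commute d_def)
    finally show "ennreal (?r powr - b) * (\<integral>\<^sup>+z\<in>ball x ?r. ennreal (h z) \<partial>lborel) \<le> ennreal (R powr (n - b) * d ^ j) * Q" .
  qed auto
  also have "\<dots> = ennreal (norm x powr (b - n)) * (ennreal (2 powr b) * (ennreal (R powr (n - b) / (1 - d)) * Q))"
    unfolding ennreal_suminf_multc using d by (subst suminf_geometric_ennreal) auto
  also have "\<dots> = ennreal (norm x powr (b - n) * (2 powr b * (R powr (n - b) / (1 - d)))) * Q"
    using d by (simp add: ennreal_mult[symmetric] mult.assoc[symmetric])
  also have "norm x powr (b - n) * (2 powr b * (R powr (n - b) / (1 - d))) = inner_const TYPE('a) b"
  proof -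
    have "norm x powr (b - n) * R powr (n - b) = 4 powr (n - b) * (norm x powr (b - n) * norm x powr (n - b))"
      by (simp add: R_def powr_mult)
    also have "norm x powr (b - n) * norm x powr (n - b) = 1" using x by (simp flip: powr_add)
    finally have *: "norm x powr (b - n) * R powr (n - b) = 4 powr (n - b)" by simp
    have "norm x powr (b - n) * (2 powr b * (R powr (n - b) / (1 - d))) = 2 powr b * (norm x powr (b - n) * R powr (n - b)) / (1 - d)"
      by simp
    then show ?thesis unfolding * by (simp add: inner_const_def d_def n_def)
  qed
  finally show ?thesis .
qed

context A1_weight
begin

lemma inner_part_le_avg_max:
  fixes b :: real
  assumes [measurable]: "h \<in> borel_measurable borel" and b: "0 \<le> b" "b < DIM('a)" and x: "x \<noteq> 0" and h: "\<And>x. 0 \<le> h x"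
  shows "inner_part b h x \<le> ennreal (inner_const TYPE('a) b * (K * unit_ball_vol DIM('a))) * avg_max \<mu> h x"
proof -
  let ?v = "unit_ball_vol (real DIM('a))"
  have v: "0 < ?v" by simp
  have "inner_part b h x \<le> ennreal (inner_const TYPE('a) b) * (ennreal (K * ?v) * avg_max \<mu> h x)"
  proof (rule inner_part_le[OF _ b x])
    fix r :: real assume r: "0 < r"
    have w: "0 < wt x r" using r by (rule wt_pos)
    \<comment> \<open>The factor W^(1-1) = 1 is inserted to match the comparison with \<mu> for e =
      1.\<close>
    have "(\<integral>\<^sup>+z\<in>ball x r. ennreal (h z) \<partial>lborel) = (\<integral>\<^sup>+z\<in>ball x r. ennreal (h z * W z powr (1 - 1)) \<partial>lborel)"
      using W_pos by (simp add: less_imp_neq[symmetric])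
    also have "\<dots> \<le> ennreal ((K * ?v * r ^ DIM('a) / wt x r) powr 1) * (\<integral>\<^sup>+z\<in>ball x r. ennreal (h z) \<partial>\<mu>)"
      by (rule nn_integral_ball_powr_le) (use r h in auto)
    also have "\<dots> \<le> ennreal ((K * ?v * r ^ DIM('a) / wt x r) powr 1) * (ennreal (wt x r) * avg_max \<mu> h x)"
      using nn_integral_ball_le_avg_max[of x x r h] r by (intro mult_left_mono) (auto simp: emeasure_mu_ball)
    also have "\<dots> = ennreal (K * ?v * r ^ DIM('a) / wt x r * wt x r) * avg_max \<mu> h x"
      using w v r K_ge_1 by (subst ennreal_mult) (auto simp: mult.assoc)
    also have "K * ?v * r ^ DIM('a) / wt x r * wt x r = r ^ DIM('a) * (K * ?v)"
      using w by simp
    also have "ennreal (r ^ DIM('a) * (K * ?v)) * avg_max \<mu> h x = ennreal (r ^ DIM('a)) * (ennreal (K * ?v) * avg_max \<mu> h x)"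
      using r v K_ge_1 by (subst ennreal_mult) (auto simp: mult.assoc)
    finally show "(\<integral>\<^sup>+z\<in>ball x r. ennreal (h z) \<partial>lborel) \<le> ennreal (r ^ DIM('a)) * (ennreal (K * ?v) * avg_max \<mu> h x)" .
  qed measurable
  then show ?thesis
    using inner_const_nonneg[OF b(2)] v K_ge_1 by (subst ennreal_mult) (auto simp: mult.assoc)
qed

text \<open>Here the weight is inside the operator, and it comes out at the centre: \<mu>(B(x, r))
  \<le> K |B(x, r)| W(x) by A1. This is the form in which the inner part appears as the adjoint of
  the outer part.\<close>

lemma inner_part_weight_le_avg_max:
  fixes b :: real
  assumes [measurable]: "g \<in> borel_measurable borel" and b: "0 \<le> b" "b < DIM('a)" and g: "\<And>x. 0 \<le> g x"
  shows "AE x in lborel. inner_part b (\<lambda>z. g z * W z) x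
     \<le> ennreal (inner_const TYPE('a) b * (K * unit_ball_vol DIM('a))) * (ennreal (W x) * avg_max \<mu> g x)"
  using A1 AE_lborel_singleton[of 0]
proof eventually_elim
  case (elim x)
  let ?v = "unit_ball_vol (real DIM('a))"
  have v: "0 < ?v" by simp
  have "inner_part b (\<lambda>z. g z * W z) x \<le> ennreal (inner_const TYPE('a) b) * (ennreal (K * ?v) * (ennreal (W x) * avg_max \<mu> g x))"
  proof (rule inner_part_le[OF _ b])
    fix r :: real assume r: "0 < r"
    have "(\<integral>\<^sup>+z\<in>ball x r. ennreal (g z * W z) \<partial>lborel) = (\<integral>\<^sup>+z\<in>ball x r. ennreal (g z) \<partial>\<mu>)"
      using g W_pos by (simp add: nn_integral_density ennreal_mult less_imp_le mult_ac)
    also have "\<dots> \<le> emeasure \<mu> (ball x r) * avg_max \<mu> g x"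
      using nn_integral_ball_le_avg_max[of x x r g] r by simp
    also have "\<dots> \<le> (ennreal K * emeasure lborel (ball x r) * ennreal (W x)) * avg_max \<mu> g x"
      using elim(1) r by (intro mult_right_mono) (auto simp: emeasure_mu)
    also have "emeasure lborel (ball x r) = ennreal (?v * r ^ DIM('a))"
      using r by (simp add: emeasure_ball)
    also have "ennreal K * ennreal (?v * r ^ DIM('a)) * ennreal (W x) * avg_max \<mu> g x
      = ennreal (r ^ DIM('a)) * (ennreal (K * ?v) * (ennreal (W x) * avg_max \<mu> g x))"
      using K_ge_1 v r by (simp add: ennreal_mult mult_ac)
    finally show "(\<integral>\<^sup>+z\<in>ball x r. ennreal (g z * W z) \<partial>lborel)
      \<le> ennreal (r ^ DIM('a)) * (ennreal (K * ?v) * (ennreal (W x) * avg_max \<mu> g x))" .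
  qed (use elim in auto)
  then show ?case
    using inner_const_nonneg[OF b(2)] v K_ge_1 by (subst ennreal_mult) (auto simp: mult.assoc)
qed

text \<open>The outer part is tested against the truncation \<open>X\<^sup>p\<^sup>-\<^sup>1\<close> of its own power; the adjoint of the outer
  part is the inner part, and Young's inequality lets the resulting multiple of \<open>\<integral>X\<^sup>p\<close> be absorbed.\<close>

lemma outer_part_bound:
  fixes h :: "'a \<Rightarrow> real" and b p :: real
  defines "p' \<equiv> p / (p - 1)"
  defines "C \<equiv> inner_const TYPE('a) b * (K * unit_ball_vol DIM('a))"
  defines "C2 \<equiv> 2 * (K * 5 ^ DIM('a)) * p' * 2 powr (p' - 1) / (p' - 1)"
  assumes [measurable]: "h \<in> borel_measurable borel" and b: "0 \<le> b" "b < DIM('a)" and h: "\<And>x. 0 \<le> h x"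
    and p: "1 < p" and norm1: "(\<integral>\<^sup>+x. ennreal (h x powr p) \<partial>\<mu>) \<le> 1"
  shows "(\<integral>\<^sup>+x. ennreal_powr (outer_part b h x) p * ennreal (W x) \<partial>lborel)
    \<le> ennreal (2 * C * (2 * C * C2 + 1) powr (p / p'))"
proof (rule nn_integral_le_truncated)
  have p': "1 < p'" "(p - 1) * p' = p" using p by (auto simp: p'_def field_simps)
  have C: "0 \<le> C" unfolding C_def using inner_const_nonneg[OF b(2)] K_ge_1 by simp
  have C2: "0 \<le> C2" unfolding C2_def using K_ge_1 p' by (intro divide_nonneg_nonneg mult_nonneg_nonneg) auto
  \<comment> \<open>The parameter of Young's inequality. Since L^(p') = 2 C C2 + 1, the coefficient
    C L^(-p') C2 of the self-referential term is at most 1/2.\<close>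
  define L where "L = (2 * C * C2 + 1) powr (1 / p')"
  have D: "0 < 2 * C * C2 + 1" using C C2 by (intro add_nonneg_pos mult_nonneg_nonneg) auto
  then have L: "0 < L" "L powr p' = 2 * C * C2 + 1"
    using p' by (auto simp: L_def powr_powr)
  have young: "ennreal s * M \<le> ennreal (L powr p * s powr p) + ennreal (L powr - p') * ennreal_powr M p'" if "0 \<le> s" for s M
  proof (cases M)
    case (real c)
    have "s * c = (L * s) * (c / L)" using L by simp
    also have "\<dots> \<le> (L * s) powr p / p + (c / L) powr p' / p'"
      using p p' L that real by (intro Youngs_inequality) (auto simp: p'_def field_simps)
    also have "\<dots> \<le> (L * s) powr p + (c / L) powr p'"
      using p p' mult_left_mono[of 1 p "(L * s) powr p"] mult_left_mono[of 1 p' "(c / L) powr p'"]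
      by (intro add_mono) (auto simp: divide_le_eq)
    also have "\<dots> = L powr p * s powr p + L powr - p' * c powr p'"
      using L that real by (simp add: powr_mult powr_divide powr_minus_divide)
    finally have "ennreal (s * c) \<le> ennreal (L powr p * s powr p + L powr - p' * c powr p')"
      by (rule ennreal_leI)
    then show ?thesis using that real by (simp add: ennreal_powr_ennreal ennreal_mult)
  next
    case top
    then show ?thesis using L by (simp add: ennreal_mult_top)
  qed
  fix N
  define X where "X = trunc_fun N (outer_part b h)"
  define g where "g x = X x powr (p - 1)" for x
  define I where "I = (\<integral>\<^sup>+x. ennreal (X x powr p) \<partial>\<mu>)"
  have [measurable]: "X \<in> borel_measurable borel" unfolding X_def by measurable
  have [measurable]: "g \<in> borel_measurable borel" unfolding g_def by measurable
  have X: "0 \<le> X x" "X x \<le> real N" "ennreal (X x) \<le> outer_part b h x" for x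
    by (simp_all add: X_def trunc_fun_nonneg trunc_fun_le ennreal_trunc_fun_le)
  \<comment> \<open>Half of I is subtracted from both sides at the end, so I has to be finite. The
    truncation is bounded and supported in a ball, whose weighted mass is finite.\<close>
  have "I \<le> (\<integral>\<^sup>+x. ennreal (real N powr p) * indicator (ball 0 (real N)) x \<partial>\<mu>)"
    unfolding I_def
  proof (rule nn_integral_mono)
    fix x
    show "ennreal (X x powr p) \<le> ennreal (real N powr p) * indicator (ball 0 (real N)) x"
    proof (cases "x \<in> ball 0 (real N)")
      case True
      then show ?thesis using X[of x] p by (auto intro!: ennreal_leI powr_mono2)
    next
      case False
      then have "X x = 0" unfolding X_def by (rule trunc_fun_outside)
      then show ?thesis by simp
    qed
  qed
  also have "\<dots> < top"
    by (simp add: nn_integral_cmult_indicator ennreal_mult_less_top mu_ball_finite)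
  finally have I_fin: "I < top" .
  have "I \<le> (\<integral>\<^sup>+x. outer_part b h x * ennreal (g x * W x) \<partial>lborel)"
  proof -
    have "I = (\<integral>\<^sup>+x. ennreal (X x) * ennreal (g x * W x) \<partial>lborel)"
      unfolding I_def
    proof (subst nn_integral_density, goal_cases)
      case 3
      have "X x powr p = X x * g x" for x
        using X(1)[of x] powr_mult_base[of "X x" "p - 1"] by (simp add: g_def)
      then show ?case
        using X(1) W_pos by (intro nn_integral_cong) (simp add: g_def ennreal_mult less_imp_le mult_ac)
    qed measurable
    also have "\<dots> \<le> (\<integral>\<^sup>+x. outer_part b h x * ennreal (g x * W x) \<partial>lborel)"
      using X(3) by (intro nn_integral_mono mult_right_mono) auto
    finally show ?thesis .
  qed
  also have "\<dots> = (\<integral>\<^sup>+z. ennreal (h z) * inner_part b (\<lambda>x. g x * W x) z \<partial>lborel)"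
    by (rule outer_part_adjoint) measurable
  also have "\<dots> \<le> (\<integral>\<^sup>+z. ennreal (h z) * (ennreal C * (ennreal (W z) * avg_max \<mu> g z)) \<partial>lborel)"
  proof (rule nn_integral_mono_AE)
    show "AE z in lborel. ennreal (h z) * inner_part b (\<lambda>x. g x * W x) z
        \<le> ennreal (h z) * (ennreal C * (ennreal (W z) * avg_max \<mu> g z))"
      using inner_part_weight_le_avg_max[of g b] b unfolding C_def
      by (auto simp: g_def elim!: eventually_mono intro!: mult_left_mono)
  qed
  also have "\<dots> = (\<integral>\<^sup>+z. ennreal C * (ennreal (h z) * avg_max \<mu> g z) \<partial>\<mu>)"
    by (subst nn_integral_density) (auto simp: mult_ac)
  also have "\<dots> = ennreal C * (\<integral>\<^sup>+z. ennreal (h z) * avg_max \<mu> g z \<partial>\<mu>)"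
    by (rule nn_integral_cmult) measurable
  also have "\<dots> \<le> ennreal C * (\<integral>\<^sup>+z. ennreal (L powr p * h z powr p) + ennreal (L powr - p') * ennreal_powr (avg_max \<mu> g z) p' \<partial>\<mu>)"
    using h by (intro mult_left_mono nn_integral_mono young) auto
  also have "\<dots> = ennreal C * (ennreal (L powr p) * (\<integral>\<^sup>+z. ennreal (h z powr p) \<partial>\<mu>)
      + ennreal (L powr - p') * (\<integral>\<^sup>+z. ennreal_powr (avg_max \<mu> g z) p' \<partial>\<mu>))"
    by (subst nn_integral_add) (auto simp: ennreal_mult nn_integral_cmult)
  also have "\<dots> \<le> ennreal C * (ennreal (L powr p) * 1 + ennreal (L powr - p') * (ennreal C2 * I))"
  proof -
    have "(\<integral>\<^sup>+z. ennreal_powr (avg_max \<mu> g z) p' \<partial>\<mu>) \<le> ennreal C2 * (\<integral>\<^sup>+x. ennreal (g x powr p') \<partial>\<mu>)"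
      unfolding C2_def using p' by (intro strong_type) (auto simp: g_def)
    also have "(\<integral>\<^sup>+x. ennreal (g x powr p') \<partial>\<mu>) = I"
      using p' by (simp add: I_def g_def powr_powr)
    finally show ?thesis using norm1 by (intro mult_left_mono add_mono) auto
  qed
  finally have le: "I \<le> ennreal C * (ennreal (L powr p) * 1 + ennreal (L powr - p') * (ennreal C2 * I))" .
  obtain i where i: "0 \<le> i" "I = ennreal i" using I_fin by (cases I) auto
  have "i \<le> C * (L powr p + L powr - p' * (C2 * i))"
    using le i C C2 by (simp add: ennreal_mult[symmetric] ennreal_plus[symmetric] del: ennreal_plus)
  moreover have "C * (L powr - p' * C2) \<le> 1 / 2"
  proof -
    have "L powr - p' = 1 / (2 * C * C2 + 1)" using L by (simp add: powr_minus_divide)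
    moreover have "C * (1 / (2 * C * C2 + 1) * C2) \<le> 1 / 2"
      using D by (simp add: divide_le_eq)
    ultimately show ?thesis by simp
  qed
  then have "C * (L powr - p' * C2) * i \<le> 1 / 2 * i" using i by (intro mult_right_mono)
  ultimately have "i \<le> 2 * C * L powr p" by (simp add: algebra_simps)
  also have "L powr p = (2 * C * C2 + 1) powr (p / p')" by (simp add: L_def powr_powr)
  finally have "I \<le> ennreal (2 * C * (2 * C * C2 + 1) powr (p / p'))" using i by (simp add: ennreal_leI)
  also have "I = (\<integral>\<^sup>+x. ennreal (trunc_fun N (outer_part b h) x powr p) * ennreal (W x) \<partial>lborel)"
    unfolding I_def X_def by (subst nn_integral_density) (auto simp: mult.commute)
  finally show "(\<integral>\<^sup>+x. ennreal (trunc_fun N (outer_part b h) x powr p) * ennreal (W x) \<partial>lborel)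
    \<le> ennreal (2 * C * (2 * C * C2 + 1) powr (p / p'))" .
qed (use p in simp_all)

end

lemma weighted_bound_stein:
  fixes b p :: real
  assumes b: "0 \<le> b" "b < DIM('a::euclidean_space)" and p: "1 < p"
  shows "weighted_bound (stein b :: ('a \<Rightarrow> real) \<Rightarrow> 'a \<Rightarrow> ennreal) p p"
  unfolding weighted_bound_def
proof (intro allI impI)
  fix K :: real assume K: "1 \<le> K"
  define p' where "p' = p / (p - 1)"
  define C where "C = inner_const TYPE('a) b * (K * unit_ball_vol DIM('a))"
  define C2 where "C2 = 2 * (K * 5 ^ DIM('a)) * p' * 2 powr (p' - 1) / (p' - 1)"
  define C3 where "C3 = 2 * (K * 5 ^ DIM('a)) * p * 2 powr (p - 1) / (p - 1)"
  define B1 where "B1 = C powr p * C3"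
  define B2 where "B2 = 2 * C * (2 * C * C2 + 1) powr (p / p')"
  have C: "0 \<le> C" unfolding C_def using inner_const_nonneg[OF b(2)] K by simp
  have C3: "0 \<le> C3" unfolding C3_def using K p by (intro divide_nonneg_nonneg mult_nonneg_nonneg) auto
  have B: "0 \<le> B1" "0 \<le> B2" using C C3 by (simp_all add: B1_def B2_def)
  show "\<exists>B\<ge>0. \<forall>W (h :: 'a \<Rightarrow> real). A1_weight W K \<longrightarrow> h \<in> borel_measurable borel \<longrightarrow> (\<forall>x. 0 \<le> h x) \<longrightarrow>
     (\<integral>\<^sup>+x. ennreal (h x powr p * W x powr (p / p)) \<partial>lborel) \<le> 1 \<longrightarrow>
     (\<integral>\<^sup>+x. ennreal_powr (stein b h x) p * ennreal (W x) \<partial>lborel) \<le> ennreal B"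
  proof (intro exI[of _ "2 powr p * (B1 + B2)"] conjI allI impI)
    show "0 \<le> 2 powr p * (B1 + B2)" using B by simp
    fix W h :: "'a \<Rightarrow> real"
    assume "A1_weight W K" and [measurable]: "h \<in> borel_measurable borel" and h: "\<forall>x. 0 \<le> h x"
      and norm: "(\<integral>\<^sup>+x. ennreal (h x powr p * W x powr (p / p)) \<partial>lborel) \<le> 1"
    then interpret A1_weight W K by simp
    have norm1: "(\<integral>\<^sup>+x. ennreal (h x powr p) \<partial>\<mu>) \<le> 1"
      using norm p W_pos by (simp add: nn_integral_density ennreal_mult mult.commute less_imp_le)
    have outer: "(\<integral>\<^sup>+x. ennreal_powr (outer_part b h x) p * ennreal (W x) \<partial>lborel) \<le> ennreal B2"
      unfolding B2_def C_def C2_def p'_def using b h p norm1 by (intro outer_part_bound) auto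
    have "(\<integral>\<^sup>+x. ennreal_powr (inner_part b h x) p * ennreal (W x) \<partial>lborel)
      \<le> (\<integral>\<^sup>+x. ennreal (C powr p) * (ennreal_powr (avg_max \<mu> h x) p * ennreal (W x)) \<partial>lborel)"
    proof (rule nn_integral_mono_AE)
      show "AE x in lborel. ennreal_powr (inner_part b h x) p * ennreal (W x)
         \<le> ennreal (C powr p) * (ennreal_powr (avg_max \<mu> h x) p * ennreal (W x))"
        using AE_lborel_singleton[of 0]
      proof eventually_elim
        case (elim x)
        have le: "inner_part b h x \<le> ennreal C * avg_max \<mu> h x"
          unfolding C_def using b h elim by (intro inner_part_le_avg_max) auto
        have "ennreal_powr (inner_part b h x) p \<le> ennreal (C powr p) * ennreal_powr (avg_max \<mu> h x) p"
        proof (cases "C = 0")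
          case True
          with le show ?thesis by simp
        next
          case False
          then have "ennreal_powr (ennreal C * avg_max \<mu> h x) p = ennreal (C powr p) * ennreal_powr (avg_max \<mu> h x) p"
            using C by (intro ennreal_powr_cmult) simp
          with ennreal_powr_mono[OF _ le, of p] p show ?thesis by simp
        qed
        then show ?case by (simp add: mult.assoc[symmetric] mult_right_mono)
      qed
    qed
    also have "\<dots> = ennreal (C powr p) * (\<integral>\<^sup>+x. ennreal_powr (avg_max \<mu> h x) p \<partial>\<mu>)"
      by (subst nn_integral_cmult) (auto simp: nn_integral_density mult.commute)
    also have "\<dots> \<le> ennreal (C powr p) * (ennreal C3 * (\<integral>\<^sup>+x. ennreal (h x powr p) \<partial>\<mu>))"
      unfolding C3_def using strong_type[of h p] h p by (intro mult_left_mono) auto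
    also have "\<dots> \<le> ennreal (C powr p) * (ennreal C3 * 1)"
      using norm1 by (intro mult_left_mono) auto
    also have "\<dots> = ennreal B1" using C3 by (simp add: B1_def ennreal_mult)
    finally have inner: "(\<integral>\<^sup>+x. ennreal_powr (inner_part b h x) p * ennreal (W x) \<partial>lborel) \<le> ennreal B1" .
    have "(\<integral>\<^sup>+x. ennreal_powr (stein b h x) p * ennreal (W x) \<partial>lborel)
      \<le> (\<integral>\<^sup>+x. ennreal (2 powr p) * (ennreal_powr (inner_part b h x) p * ennreal (W x)
         + ennreal_powr (outer_part b h x) p * ennreal (W x)) \<partial>lborel)"
    proof (rule nn_integral_mono)
      fix x
      have "ennreal_powr (stein b h x) p \<le> ennreal_powr (inner_part b h x + outer_part b h x) p"
        using b p by (intro ennreal_powr_mono stein_le) auto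
      also have "\<dots> \<le> ennreal (2 powr p) * (ennreal_powr (inner_part b h x) p + ennreal_powr (outer_part b h x) p)"
        using p by (intro ennreal_powr_add_le) auto
      finally have "ennreal_powr (stein b h x) p * ennreal (W x) \<le> ennreal (2 powr p) * (ennreal_powr (inner_part b h x) p + ennreal_powr (outer_part b h x) p) * ennreal (W x)"
        by (rule mult_right_mono) simp
      then show "ennreal_powr (stein b h x) p * ennreal (W x) \<le> ennreal (2 powr p) * (ennreal_powr (inner_part b h x) p * ennreal (W x)
         + ennreal_powr (outer_part b h x) p * ennreal (W x))"
        by (simp add: mult.assoc distrib_right)
    qed
    also have "\<dots> = ennreal (2 powr p) * ((\<integral>\<^sup>+x. ennreal_powr (inner_part b h x) p * ennreal (W x) \<partial>lborel)
         + (\<integral>\<^sup>+x. ennreal_powr (outer_part b h x) p * ennreal (W x) \<partial>lborel))"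
      by (subst nn_integral_cmult) (auto simp: nn_integral_add)
    also have "\<dots> \<le> ennreal (2 powr p) * (ennreal B1 + ennreal B2)"
      using inner outer by (intro mult_left_mono add_mono) auto
    also have "\<dots> = ennreal (2 powr p * (B1 + B2))"
      using B by (simp add: ennreal_mult)
    finally show "(\<integral>\<^sup>+x. ennreal_powr (stein b h x) p * ennreal (W x) \<partial>lborel) \<le> ennreal (2 powr p * (B1 + B2))" .
  qed
qed

section \<open>The modular\<close>

lemma ennreal_powr_1 [simp]: "ennreal_powr t 1 = t"
  by (cases t) (auto simp: ennreal_powr_def)

lemma ennreal_powr_SUP:
  assumes "0 < a"
  shows "ennreal_powr (SUP i\<in>I. f i) a = (SUP i\<in>I. ennreal_powr (f i) a)"
proof (rule antisym)
  let ?y = "SUP i\<in>I. ennreal_powr (f i) a"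
  have "f i \<le> ennreal_powr ?y (1 / a)" if "i \<in> I" for i
  proof -
    have "f i = ennreal_powr (ennreal_powr (f i) a) (1 / a)"
      using assms by (simp add: ennreal_powr_powr)
    also have "\<dots> \<le> ennreal_powr ?y (1 / a)"
      using assms that by (intro ennreal_powr_mono SUP_upper) auto
    finally show ?thesis .
  qed
  then have "(SUP i\<in>I. f i) \<le> ennreal_powr ?y (1 / a)" by (rule SUP_least)
  then have "ennreal_powr (SUP i\<in>I. f i) a \<le> ennreal_powr (ennreal_powr ?y (1 / a)) a"
    using assms by (intro ennreal_powr_mono) auto
  then show "ennreal_powr (SUP i\<in>I. f i) a \<le> ?y"
    using assms by (simp add: ennreal_powr_powr)
qed (use assms in \<open>auto intro!: SUP_least ennreal_powr_mono SUP_upper\<close>)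

lemma ennreal_powr_midpoint_le:
  assumes "1 \<le> a"
  shows "ennreal_powr (ennreal (1/2) * u + ennreal (1/2) * v) a
    \<le> ennreal (1/2) * ennreal_powr u a + ennreal (1/2) * ennreal_powr v a"
proof (cases "u = top \<or> v = top")
  case True
  then show ?thesis by (auto simp: ennreal_mult_top)
next
  case False
  then obtain x y where xy: "u = ennreal x" "0 \<le> x" "v = ennreal y" "0 \<le> y"
    by (metis ennreal_cases)
  have half: "((1/2) * t) powr a \<le> (1/2) * t powr a" if "0 \<le> t" for t
  proof -
    have "(1/2 :: real) powr a \<le> (1/2) powr 1" using assms by (intro powr_mono') auto
    from mult_right_mono[OF this, of "t powr a"]
    have "(1/2) powr a * t powr a \<le> (1/2) * t powr a" by simp
    then show ?thesis using that powr_mult[of "1/2" t a] by simp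
  qed
  have "((1/2) * x + (1/2) * y) powr a \<le> (1/2) * x powr a + (1/2) * y powr a"
  proof (cases "x = 0 \<or> y = 0")
    case True
    then show ?thesis using half xy assms by auto
  next
    case False
    then show ?thesis
      using xy convex_onD[OF powr_convex[OF assms], of "1/2" x y] by simp
  qed
  then have "ennreal (((1/2) * x + (1/2) * y) powr a) \<le> ennreal ((1/2) * x powr a + (1/2) * y powr a)"
    by (rule ennreal_leI)
  moreover have e: "ennreal (1/2) * ennreal a + ennreal (1/2) * ennreal b = ennreal ((1/2) * a + (1/2) * b)"
    if "0 \<le> a" "0 \<le> b" for a b
  proof -
    have "ennreal ((1/2) * a + (1/2) * b) = ennreal ((1/2) * a) + ennreal ((1/2) * b)"
      using that by (intro ennreal_plus) auto
    also have "ennreal ((1/2) * a) = ennreal (1/2) * ennreal a" using that by (intro ennreal_mult) auto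
    also have "ennreal ((1/2) * b) = ennreal (1/2) * ennreal b" using that by (intro ennreal_mult) auto
    finally show ?thesis by simp
  qed
  moreover have "0 \<le> (1/2) * x + (1/2) * y" using xy by simp
  ultimately show ?thesis
    unfolding xy(1,3) using xy(2,4) by (simp only: e ennreal_powr_ennreal powr_ge_zero)
qed

lemma modular_mono_AE:
  assumes [measurable]: "u \<in> borel_measurable lebesgue" "s \<in> borel_measurable lebesgue"
    and s: "AE x in lebesgue. 1 \<le> s x" and le: "AE x in lebesgue. u x \<le> v x"
  shows "modular s u \<le> modular s v"
  unfolding modular_def
proof (intro add_mono nn_integral_mono_AE esssup_AE_mono)
  show "AE x in lebesgue. ennreal_powr (u x) (real_of_ereal (s x)) * indicator {x. s x < \<infinity>} x
     \<le> ennreal_powr (v x) (real_of_ereal (s x)) * indicator {x. s x < \<infinity>} x"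
    using s le
  proof eventually_elim
    case (elim x)
    then have "0 \<le> real_of_ereal (s x)" by (cases "s x") auto
    with elim show ?case by (intro mult_right_mono ennreal_powr_mono) auto
  qed
  show "AE x in lebesgue. u x * indicator {x. s x = \<infinity>} x \<le> v x * indicator {x. s x = \<infinity>} x"
    using le by eventually_elim (auto simp: indicator_def)
qed measurable

lemma modular_le:
  assumes [measurable]: "u \<in> borel_measurable lebesgue" "s \<in> borel_measurable lebesgue"
    and "(\<integral>\<^sup>+x\<in>{x. s x < \<infinity>}. ennreal_powr (u x) (real_of_ereal (s x)) \<partial>lebesgue) \<le> a"
    and "AE x in lebesgue. s x = \<infinity> \<longrightarrow> u x \<le> b"
  shows "modular s u \<le> a + b"
  unfolding modular_def using assms(3)
proof (rule add_mono)
  show "esssup lebesgue (\<lambda>x. u x * indicator {x. s x = \<infinity>} x) \<le> b"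
  proof (rule esssup_I)
    show "AE x in lebesgue. u x * indicator {x. s x = \<infinity>} x \<le> b"
      using assms(4) by eventually_elim (auto simp: indicator_def)
  qed measurable
qed

lemma modular_ge_integral:
  "(\<integral>\<^sup>+x\<in>{x. s x < \<infinity>}. ennreal_powr (u x) (real_of_ereal (s x)) \<partial>lebesgue) \<le> modular s u"
  unfolding modular_def by simp

lemma AE_le_modular: "AE x in lebesgue. s x = \<infinity> \<longrightarrow> u x \<le> modular s u"
  using esssup_AE[of "\<lambda>x. u x * indicator {x. s x = \<infinity>} x" lebesgue]
proof eventually_elim
  case (elim x)
  have "esssup lebesgue (\<lambda>x. u x * indicator {x. s x = \<infinity>} x) \<le> modular s u"
    unfolding modular_def by simp
  with elim show ?case by (auto simp: indicator_def intro: order_trans)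
qed

lemma AE_finite_of_modular:
  assumes [measurable]: "u \<in> borel_measurable lebesgue" "s \<in> borel_measurable lebesgue"
    and "modular s u < top"
  shows "AE x in lebesgue. u x < top"
proof -
  have "(\<integral>\<^sup>+x\<in>{x. s x < \<infinity>}. ennreal_powr (u x) (real_of_ereal (s x)) \<partial>lebesgue) \<noteq> \<infinity>"
    using modular_ge_integral[where s=s and u=u] assms(3) by (auto simp: top_unique)
  then have "AE x in lebesgue. ennreal_powr (u x) (real_of_ereal (s x)) * indicator {x. s x < \<infinity>} x \<noteq> \<infinity>"
    by (intro nn_integral_PInf_AE) measurable
  then show ?thesis using AE_le_modular[where s=s and u=u]
  proof eventually_elim
    case (elim x)
    then show ?case using assms(3)
      by (cases "s x = \<infinity>") (auto simp: less_top[symmetric] indicator_def top_unique)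
  qed
qed

text \<open>Convexity at the midpoint suffices here: a series with the weights (1/2)^(k+1) is built
  by repeated halving.\<close>

lemma modular_midpoint_le:
  assumes [measurable]: "u \<in> borel_measurable lebesgue" "v \<in> borel_measurable lebesgue" "s \<in> borel_measurable lebesgue"
    and s: "AE x in lebesgue. 1 \<le> s x" and "modular s u \<le> 1" "modular s v \<le> 1"
  shows "modular s (\<lambda>x. ennreal (1/2) * u x + ennreal (1/2) * v x) \<le> 1"
proof -
  let ?I = "\<lambda>u. \<integral>\<^sup>+x\<in>{x. s x < \<infinity>}. ennreal_powr (u x) (real_of_ereal (s x)) \<partial>lebesgue"
  let ?E = "\<lambda>u. esssup lebesgue (\<lambda>x. u x * indicator {x. s x = \<infinity>} x)"
  have "?I (\<lambda>x. ennreal (1/2) * u x + ennreal (1/2) * v x)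
    \<le> (\<integral>\<^sup>+x. ennreal (1/2) * (ennreal_powr (u x) (real_of_ereal (s x)) * indicator {x. s x < \<infinity>} x)
      + ennreal (1/2) * (ennreal_powr (v x) (real_of_ereal (s x)) * indicator {x. s x < \<infinity>} x) \<partial>lebesgue)"
  proof (rule nn_integral_mono_AE)
    show "AE x in lebesgue. ennreal_powr (ennreal (1/2) * u x + ennreal (1/2) * v x) (real_of_ereal (s x)) * indicator {x. s x < \<infinity>} x
      \<le> ennreal (1/2) * (ennreal_powr (u x) (real_of_ereal (s x)) * indicator {x. s x < \<infinity>} x)
      + ennreal (1/2) * (ennreal_powr (v x) (real_of_ereal (s x)) * indicator {x. s x < \<infinity>} x)"
      using s
    proof eventually_elim
      case (elim x)
      show ?case
      proof (cases "s x < \<infinity>")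
        case True
        with elim have "1 \<le> real_of_ereal (s x)" by (cases "s x") auto
        then show ?thesis using True ennreal_powr_midpoint_le by simp
      qed simp
    qed
  qed
  also have "\<dots> = ennreal (1/2) * ?I u + ennreal (1/2) * ?I v"
    by (subst nn_integral_add) (auto simp: nn_integral_cmult)
  finally have "modular s (\<lambda>x. ennreal (1/2) * u x + ennreal (1/2) * v x)
     \<le> (ennreal (1/2) * ?I u + ennreal (1/2) * ?I v) + (ennreal (1/2) * ?E u + ennreal (1/2) * ?E v)"
  proof (intro modular_le)
    show "AE x in lebesgue. s x = \<infinity> \<longrightarrow> ennreal (1/2) * u x + ennreal (1/2) * v x \<le> ennreal (1/2) * ?E u + ennreal (1/2) * ?E v"
      using esssup_AE[of "\<lambda>x. u x * indicator {x. s x = \<infinity>} x" lebesgue]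
        esssup_AE[of "\<lambda>x. v x * indicator {x. s x = \<infinity>} x" lebesgue]
      by eventually_elim (auto intro!: add_mono mult_left_mono)
  qed measurable
  also have "\<dots> = ennreal (1/2) * modular s u + ennreal (1/2) * modular s v"
    unfolding modular_def by (simp add: algebra_simps)
  also have "\<dots> \<le> ennreal (1/2) * 1 + ennreal (1/2) * 1"
    using assms by (intro add_mono mult_left_mono) auto
  also have "\<dots> = ennreal (1/2 + 1/2)" by (subst ennreal_plus) auto
  finally show ?thesis by simp
qed

text \<open>Fatou property of the modular: monotone convergence for the integral part, and a
  countable union of null sets for the supremum part. It passes from partial sums to the series that
  defines the weight.\<close>

lemma modular_SUP_le:
  fixes u :: "nat \<Rightarrow> real^'n \<Rightarrow> ennreal"
  assumes [measurable]: "\<And>i. u i \<in> borel_measurable lebesgue" "s \<in> borel_measurable lebesgue"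
    and s: "AE x in lebesgue. 1 \<le> s x" and inc: "incseq u" and le: "\<And>i. modular s (u i) \<le> 1"
  shows "modular s (\<lambda>x. SUP i. u i x) \<le> 1"
proof -
  let ?I = "\<lambda>u. \<integral>\<^sup>+x\<in>{x. s x < \<infinity>}. ennreal_powr (u x) (real_of_ereal (s x)) \<partial>lebesgue"
  let ?E = "\<lambda>u. esssup lebesgue (\<lambda>x. u x * indicator {x. s x = \<infinity>} x)"
  have u_mono: "u i x \<le> u j x" if "i \<le> j" for i j x
    using inc that by (auto simp: incseq_def le_fun_def)
  have E: "?I (\<lambda>x. SUP i. u i x) = (\<integral>\<^sup>+x. (SUP i. ennreal_powr (u i x) (real_of_ereal (s x)) * indicator {x. s x < \<infinity>} x) \<partial>lebesgue)"
  proof (rule nn_integral_cong_AE)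
    show "AE x in lebesgue. ennreal_powr (SUP i. u i x) (real_of_ereal (s x)) * indicator {x. s x < \<infinity>} x
      = (SUP i. ennreal_powr (u i x) (real_of_ereal (s x)) * indicator {x. s x < \<infinity>} x)"
      using s
    proof eventually_elim
      case (elim x)
      show ?case
      proof (cases "s x < \<infinity>")
        case True
        with elim have "0 < real_of_ereal (s x)" by (cases "s x") auto
        then show ?thesis using True by (simp add: ennreal_powr_SUP)
      qed simp
    qed
  qed
  also have "\<dots> = (SUP i. ?I (u i))"
  proof (rule nn_integral_monotone_convergence_SUP_AE)
    show "AE x in lebesgue. ennreal_powr (u i x) (real_of_ereal (s x)) * indicator {x. s x < \<infinity>} x
       \<le> ennreal_powr (u (Suc i) x) (real_of_ereal (s x)) * indicator {x. s x < \<infinity>} x" for i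
      using s
    proof eventually_elim
      case (elim x)
      then have "0 \<le> real_of_ereal (s x)" by (cases "s x") auto
      then show ?case using u_mono[of i "Suc i"] by (intro mult_right_mono ennreal_powr_mono) auto
    qed
  qed measurable
  finally have "modular s (\<lambda>x. SUP i. u i x) \<le> (SUP i. ?I (u i)) + (SUP i. ?E (u i))"
  proof (intro modular_le)
    have "AE x in lebesgue. \<forall>i. u i x * indicator {x. s x = \<infinity>} x \<le> ?E (u i)"
      by (subst AE_all_countable) (intro allI esssup_AE)
    then show "AE x in lebesgue. s x = \<infinity> \<longrightarrow> (SUP i. u i x) \<le> (SUP i. ?E (u i))"
      by eventually_elim (auto intro!: SUP_mono')
  qed simp_all
  also have "\<dots> = (SUP i. ?I (u i) + ?E (u i))"
  proof (rule ennreal_SUP_add[symmetric])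
    show "incseq (\<lambda>i. ?I (u i))"
    proof (rule incseq_SucI, rule nn_integral_mono_AE)
      fix i
      show "AE x in lebesgue. ennreal_powr (u i x) (real_of_ereal (s x)) * indicator {x. s x < \<infinity>} x
       \<le> ennreal_powr (u (Suc i) x) (real_of_ereal (s x)) * indicator {x. s x < \<infinity>} x"
        using s
      proof eventually_elim
        case (elim x)
        then have "0 \<le> real_of_ereal (s x)" by (cases "s x") auto
        then show ?case using u_mono[of i "Suc i"] by (intro mult_right_mono ennreal_powr_mono) auto
      qed
    qed
    show "incseq (\<lambda>i. ?E (u i))"
      using u_mono by (intro incseq_SucI esssup_mono mult_right_mono) auto
  qed
  also have "\<dots> \<le> 1" using le unfolding modular_def by (rule SUP_least)
  finally show ?thesis .
qed

section \<open>The Rubio de Francia algorithm\<close>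

lemma hl_maximal_eq_avg_max:
  "hl_maximal f = avg_max lborel (absf f)"
proof -
  have "ball c r \<in> sets borel" for c :: "real^'n" and r by (simp add: borel_open)
  then show ?thesis
    by (simp add: hl_maximal_def avg_max_def fun_eq_iff nn_integral_completion)
qed

text \<open>Converts the norm inequality into one between modulars at level 1, which can be
  iterated. Enlarging C to C + 1 makes the bound on the infimum strict, so an admissible l lies
  below C + 1 even if the infimum is not attained.\<close>

lemma bounded_maximal_step:
  fixes s :: "real^'n \<Rightarrow> ereal"
  assumes [measurable]: "s \<in> borel_measurable lebesgue" and s: "AE x in lebesgue. 1 \<le> s x"
    and M: "bounded_from_into s s hl_maximal"
  obtains c :: real where "1 \<le> c"
    "\<And>g. g \<in> borel_measurable borel \<Longrightarrow> (\<And>x. 0 \<le> g x) \<Longrightarrow> modular s (\<lambda>x. ennreal (g x)) \<le> 1 \<Longrightarrow>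
      modular s (\<lambda>x. avg_max lborel (\<lambda>x. ennreal (g x)) x / ennreal c) \<le> 1"
proof -
  obtain C :: real where C: "0 \<le> C" "\<And>f. f \<in> var_space s \<Longrightarrow> var_norm s (hl_maximal f) \<le> ennreal C * var_norm s (absf f)"
    using M by (auto simp: bounded_from_into_def)
  show ?thesis
  proof (rule that[of "C + 1"])
    fix g :: "real^'n \<Rightarrow> real" assume [measurable]: "g \<in> borel_measurable borel" and g: "\<And>x. 0 \<le> g x"
      and mod1: "modular s (\<lambda>x. ennreal (g x)) \<le> 1"
    define f where "f x = complex_of_real (g x)" for x
    have absf: "absf f = (\<lambda>x. ennreal (g x))" using g by (simp add: f_def fun_eq_iff)
    have "f \<in> borel_measurable borel" unfolding f_def by measurable
    then have "f \<in> borel_measurable lebesgue" by (simp add: measurable_completion)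
    moreover have m1: "modular s (\<lambda>x. absf f x / ennreal 1) \<le> 1" using mod1 g by (simp add: f_def divide_ennreal_def)
    ultimately have f: "f \<in> var_space s"
      unfolding var_space_def by (auto intro!: exI[of _ "1::real"] elim!: le_less_trans)
    have "var_norm s (absf f) \<le> 1"
      unfolding var_norm_def using m1 by (intro Inf_lower) (auto intro!: exI[of _ "1::real"])
    then have "var_norm s (hl_maximal f) \<le> ennreal C * 1"
      by (intro order_trans[OF C(2)[OF f]] mult_left_mono) auto
    also have "\<dots> < ennreal (C + 1)" using C by (simp add: ennreal_less_iff del: ennreal_plus)
    finally obtain l where l: "0 < l" "ennreal l < ennreal (C + 1)" "modular s (\<lambda>x. hl_maximal f x / ennreal l) \<le> 1"
      unfolding var_norm_def Inf_less_iff by auto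
    have [measurable]: "hl_maximal f \<in> borel_measurable lebesgue"
      unfolding hl_maximal_eq_avg_max by (intro measurable_completion) simp
    have "modular s (\<lambda>x. hl_maximal f x / ennreal (C + 1)) \<le> modular s (\<lambda>x. hl_maximal f x / ennreal l)"
    proof (intro modular_mono_AE s AE_I2)
      have "l \<le> C + 1" using l C by (simp add: ennreal_less_iff del: ennreal_plus)
      then show "hl_maximal f x / ennreal (C + 1) \<le> hl_maximal f x / ennreal l" for x
        using l C by (auto simp: divide_ennreal_def inverse_ennreal simp del: ennreal_plus
            intro!: mult_left_mono ennreal_leI le_imp_inverse_le)
    qed measurable
    with l show "modular s (\<lambda>x. avg_max lborel (\<lambda>x. ennreal (g x)) x / ennreal (C + 1)) \<le> 1"
      by (simp add: hl_maximal_eq_avg_max absf del: ennreal_plus)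
  qed (use C in simp)
qed

lemma A1_weight_scale:
  assumes "A1_weight W K" "0 < k"
  shows "A1_weight (\<lambda>x. k * W x) K"
proof -
  interpret A1_weight W K by fact
  show ?thesis
  proof
    show "AE z in lborel. \<forall>c r. z \<in> ball c r \<longrightarrow>
        (\<integral>\<^sup>+y\<in>ball c r. ennreal (k * W y) \<partial>lborel) \<le> ennreal K * emeasure lborel (ball c r) * ennreal (k * W z)"
      using A1
    proof eventually_elim
      case (elim z)
      show ?case
      proof (intro allI impI)
        fix c r assume "z \<in> ball c r"
        have "(\<integral>\<^sup>+y\<in>ball c r. ennreal (k * W y) \<partial>lborel) = ennreal k * (\<integral>\<^sup>+y\<in>ball c r. ennreal (W y) \<partial>lborel)"
          using assms W_pos by (simp add: nn_integral_cmult ennreal_mult less_imp_le mult.assoc)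
        also have "\<dots> \<le> ennreal k * (ennreal K * emeasure lborel (ball c r) * ennreal (W z))"
          using elim \<open>z \<in> ball c r\<close> by (intro mult_left_mono) auto
        also have "\<dots> = ennreal K * emeasure lborel (ball c r) * ennreal (k * W z)"
          using assms W_pos[of z] by (simp add: ennreal_mult less_imp_le mult_ac)
        finally show "(\<integral>\<^sup>+y\<in>ball c r. ennreal (k * W y) \<partial>lborel) \<le> ennreal K * emeasure lborel (ball c r) * ennreal (k * W z)" .
      qed
    qed
  qed (use assms W_pos K_ge_1 in auto)
qed

text \<open>If M g vanished at one point, g would vanish almost everywhere in each ball around it.
  This is the source of the positivity of the weight.\<close>

lemma avg_max_lborel_pos:
  fixes g :: "'a::euclidean_space \<Rightarrow> real"
  assumes [measurable]: "g \<in> borel_measurable borel" and g: "\<And>x. 0 \<le> g x" and nz: "\<not> (AE x in lborel. g x = 0)"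
  shows "0 < avg_max lborel (\<lambda>x. ennreal (g x)) x"
proof (rule ccontr)
  assume "\<not> ?thesis"
  then have 0: "avg_max lborel (\<lambda>x. ennreal (g x)) x = 0" by simp
  have "AE y in lborel. y \<in> ball x (real (Suc k)) \<longrightarrow> g y = 0" for k
  proof -
    have [measurable]: "ball x r \<in> sets borel" for r by (simp add: borel_open)
    have "(\<integral>\<^sup>+y\<in>ball x (real (Suc k)). ennreal (g y) \<partial>lborel) / emeasure lborel (ball x (real (Suc k))) = 0"
      using avg_max_ge[of x x "real (Suc k)" lborel "\<lambda>x. ennreal (g x)"] 0 by simp
    then have "(\<integral>\<^sup>+y\<in>ball x (real (Suc k)). ennreal (g y) \<partial>lborel) = 0"
      using emeasure_lborel_ball_finite[of x "real (Suc k)"] by (auto simp: ennreal_divide_eq_0_iff)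
    then have "AE y in lborel. ennreal (g y) * indicator (ball x (real (Suc k))) y = 0"
      by (subst (asm) nn_integral_0_iff_AE) auto
    then show ?thesis
      by (rule eventually_mono) (use g in \<open>auto simp: indicator_def intro: antisym split: if_splits\<close>)
  qed
  then have "AE y in lborel. \<forall>k. y \<in> ball x (real (Suc k)) \<longrightarrow> g y = 0"
    by (subst AE_all_countable) blast
  then have "AE y in lborel. g y = 0"
  proof (rule eventually_mono)
    fix y assume *: "\<forall>k. y \<in> ball x (real (Suc k)) \<longrightarrow> g y = 0"
    obtain k :: nat where "dist x y < real k" using reals_Archimedean2 by blast
    then have "y \<in> ball x (real (Suc k))" by simp
    with * show "g y = 0" by blast
  qed
  with nz show False by simp
qed

text \<open>Applying M to the series shifts its index by one and costs c times the ratio 2 of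
  consecutive coefficients, hence K = 2 c. The coefficients (1/2)^(k+1) sum to 1, which keeps the
  modular of W at most 1; the first of them is 1/2, so g is dominated by 2 W.\<close>

lemma rubio_de_francia:
  fixes s :: "real^'n \<Rightarrow> ereal"
  assumes s_meas [measurable]: "s \<in> borel_measurable lebesgue" and s: "AE x in lebesgue. 1 \<le> s x"
    and M: "bounded_from_into s s hl_maximal"
  obtains K :: real where "1 \<le> K"
    "\<And>g. g \<in> borel_measurable borel \<Longrightarrow> (\<And>x. 0 \<le> g x) \<Longrightarrow> modular s (\<lambda>x. ennreal (g x)) \<le> 1 \<Longrightarrow>
      \<not> (AE x in lborel. g x = 0) \<Longrightarrow>
      \<exists>W. A1_weight W K \<and> modular s (\<lambda>x. ennreal (W x)) \<le> 1 \<and> (AE x in lborel. g x \<le> 2 * W x)"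
proof -
  obtain c :: real where c: "1 \<le> c" and step: "\<And>g. g \<in> borel_measurable borel \<Longrightarrow> (\<And>x. 0 \<le> g x) \<Longrightarrow> modular s (\<lambda>x. ennreal (g x)) \<le> 1 \<Longrightarrow>
      modular s (\<lambda>x. avg_max lborel (\<lambda>x. ennreal (g x)) x / ennreal c) \<le> 1"
    using bounded_maximal_step[OF s_meas s M] by blast
  show ?thesis
  proof (rule that[of "2 * c"])
    fix g :: "real^'n \<Rightarrow> real"
    assume g_meas [measurable]: "g \<in> borel_measurable borel" and g: "\<And>x. 0 \<le> g x"
      and mod1: "modular s (\<lambda>x. ennreal (g x)) \<le> 1" and nz: "\<not> (AE x in lborel. g x = 0)"
    \<comment> \<open>The iterates M^k g / c^k, made real valued at each step. Only a null set is
      affected, since modulars at most 1 force the maximal functions to be finite almost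
      everywhere.\<close>
    define u where "u = rec_nat g (\<lambda>_ v x. enn2real (avg_max lborel (\<lambda>x. ennreal (v x)) x / ennreal c))"
    have u_0: "u 0 = g" by (simp add: u_def)
    have u_Suc: "u (Suc k) x = enn2real (avg_max lborel (\<lambda>x. ennreal (u k x)) x / ennreal c)" for k x
      by (simp add: u_def)
    have u_meas [measurable]: "u k \<in> borel_measurable borel" for k
    proof (induction k)
      case (Suc k)
      have "(\<lambda>x. enn2real (avg_max lborel (\<lambda>x. ennreal (u k x)) x / ennreal c)) \<in> borel_measurable borel"
        by measurable
      then show ?case by (simp add: u_Suc[abs_def] cong: measurable_cong)
    qed (simp add: u_0)
    have u_lebesgue [measurable]: "u k \<in> borel_measurable lebesgue" for k
      using u_meas by (simp add: measurable_completion)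
    have u: "0 \<le> u k x" for k x by (cases k) (simp_all add: u_0 u_Suc g)
    have max_meas [measurable]: "(\<lambda>x. avg_max lborel (\<lambda>x. ennreal (u k x)) x / ennreal c) \<in> borel_measurable lebesgue" for k
      by (rule measurable_completion) measurable
    have u_mod: "modular s (\<lambda>x. ennreal (u k x)) \<le> 1"
      and max_u: "AE x in lebesgue. avg_max lborel (\<lambda>x. ennreal (u k x)) x = ennreal (c * u (Suc k) x)" for k
    proof -
      have 1: "modular s (\<lambda>x. ennreal (u k x)) \<le> 1 \<Longrightarrow> AE x in lebesgue. avg_max lborel (\<lambda>x. ennreal (u k x)) x / ennreal c < top" for k
        using step[OF u_meas u] by (intro AE_finite_of_modular[of _ s]) (auto intro: le_less_trans[OF _ ennreal_one_less_top])
      show 2: "modular s (\<lambda>x. ennreal (u k x)) \<le> 1" for k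
      proof (induction k)
        case (Suc k)
        have "modular s (\<lambda>x. ennreal (u (Suc k) x)) \<le> modular s (\<lambda>x. avg_max lborel (\<lambda>x. ennreal (u k x)) x / ennreal c)"
        proof (rule modular_mono_AE[OF _ _ s])
          show "AE x in lebesgue. ennreal (u (Suc k) x) \<le> avg_max lborel (\<lambda>x. ennreal (u k x)) x / ennreal c"
            using 1[OF Suc] by eventually_elim (simp add: u_Suc)
        qed measurable
        also have "\<dots> \<le> 1" by (rule step[OF u_meas u Suc])
        finally show ?case .
      qed (simp add: u_0 mod1)
      show "AE x in lebesgue. avg_max lborel (\<lambda>x. ennreal (u k x)) x = ennreal (c * u (Suc k) x)"
        using 1[OF 2[of k]]
      proof eventually_elim
        case (elim x)
        have "ennreal (c * u (Suc k) x) = ennreal c * (avg_max lborel (\<lambda>x. ennreal (u k x)) x / ennreal c)"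
          using elim c by (simp add: u_Suc ennreal_mult)
        also have "\<dots> = avg_max lborel (\<lambda>x. ennreal (u k x)) x"
          using c by (simp add: ennreal_times_divide mult.commute[of "ennreal c"] mult_divide_eq_ennreal)
        finally show ?case by simp
      qed
    qed
    define V where "V x = (\<Sum>k. ennreal ((1/2) ^ Suc k * u k x))" for x
    have [measurable]: "V \<in> borel_measurable borel" unfolding V_def[abs_def] by measurable
    have V_leb [measurable]: "V \<in> borel_measurable lebesgue" by (intro measurable_completion) simp
    have V_mod: "modular s V \<le> 1"
    proof -
      have fin: "modular s (\<lambda>x. \<Sum>k<N. ennreal ((1/2) ^ Suc k * u (j + k) x)) \<le> 1" for N j
      proof (induction N arbitrary: j)
        case 0
        have "modular s (\<lambda>x. 0) \<le> 0 + 0" by (intro modular_le) auto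
        then show ?case by simp
      next
        case (Suc N)
        \<comment> \<open>The sum starting at j is the midpoint of \<open>u j\<close> and the
          shorter sum starting at \<open>Suc j\<close>; hence the induction for all j at
          once.\<close>
        have "(\<Sum>k<Suc N. ennreal ((1/2) ^ Suc k * u (j + k) x))
          = ennreal (1/2) * ennreal (u j x) + ennreal (1/2) * (\<Sum>k<N. ennreal ((1/2) ^ Suc k * u (Suc j + k) x))" for x
        proof -
          have "ennreal ((1/2) ^ Suc (Suc k) * u (j + Suc k) x) = ennreal (1/2) * ennreal ((1/2) ^ Suc k * u (Suc j + k) x)" for k
            using u by (subst ennreal_mult[symmetric]) auto
          moreover have "ennreal ((1/2) ^ Suc 0 * u (j + 0) x) = ennreal (1/2) * ennreal (u j x)"
            using u by (subst ennreal_mult[symmetric]) auto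
          ultimately show ?thesis
            unfolding sum.lessThan_Suc_shift sum_distrib_left by (simp only:)
        qed
        then show ?case
          using modular_midpoint_le[OF _ _ s_meas s u_mod[of j] Suc[of "Suc j"]] by simp
      qed
      have "modular s (\<lambda>x. SUP N. \<Sum>k<N. ennreal ((1/2) ^ Suc k * u (0 + k) x)) \<le> 1"
        by (rule modular_SUP_le[OF _ s_meas s _ fin])
          (auto intro!: incseq_SucI le_funI)
      then show ?thesis by (simp add: V_def[abs_def] suminf_eq_SUP)
    qed
    have V_fin: "AE x in lebesgue. V x < top"
      using V_mod by (intro AE_finite_of_modular[of _ s]) (auto intro: le_less_trans[OF _ ennreal_one_less_top])
    have V_ge: "ennreal ((1/2) ^ Suc k * u k x) \<le> V x" for k x
    proof -
      have "(\<Sum>i\<in>{k}. ennreal ((1/2) ^ Suc i * u i x)) \<le> V x"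
        unfolding V_def by (rule sum_le_suminf) auto
      then show ?thesis by simp
    qed
    \<comment> \<open>The term k = 0 is g itself and may vanish; the term k = 1 is a multiple of M
      g, which is positive.\<close>
    have V_pos: "AE x in lebesgue. 0 < V x"
      using max_u[of 0]
    proof eventually_elim
      case (elim x)
      have "0 < ennreal (c * u 1 x)"
        using avg_max_lborel_pos[OF g_meas g nz, of x] elim by (simp add: u_0)
      then have "0 < u 1 x" using c by (simp add: zero_less_mult_iff)
      then have "0 < ennreal ((1/2) ^ Suc 1 * u 1 x)" by simp
      then show ?case using V_ge[of 1 x] by (rule less_le_trans)
    qed
    \<comment> \<open>V altered on a null set, so that the weight is positive and finite at every
      point.\<close>
    define W where "W x = (if 0 < V x \<and> V x < top then enn2real (V x) else 1)" for x
    have [measurable]: "W \<in> borel_measurable borel" unfolding W_def[abs_def] by measurable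
    have W_leb [measurable]: "W \<in> borel_measurable lebesgue" by (intro measurable_completion) simp
    have W_pos: "0 < W x" for x by (auto simp: W_def enn2real_positive_iff)
    have WV: "AE x in lebesgue. ennreal (W x) = V x"
      using V_fin V_pos by eventually_elim (simp add: W_def)
    then have WV': "AE x in lborel. ennreal (W x) = V x" by (simp add: AE_completion_iff)
    have "modular s (\<lambda>x. ennreal (W x)) \<le> modular s V"
      using WV by (intro modular_mono_AE[OF _ _ s]) (auto elim!: eventually_mono)
    then have "modular s (\<lambda>x. ennreal (W x)) \<le> 1" using V_mod by simp
    moreover have "AE x in lborel. g x \<le> 2 * W x"
      using WV'
    proof eventually_elim
      case (elim x)
      have "ennreal ((1/2) * g x) \<le> ennreal (W x)" using V_ge[of 0 x] elim by (simp add: u_0)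
      then show ?case using W_pos[of x] by (simp add: less_imp_le)
    qed
    moreover have "A1_weight W (2 * c)"
    proof
      have "AE x in lebesgue. \<forall>k. avg_max lborel (\<lambda>x. ennreal (u k x)) x = ennreal (c * u (Suc k) x)"
        using max_u by (subst AE_all_countable) blast
      then have "AE x in lborel. \<forall>k. avg_max lborel (\<lambda>x. ennreal (u k x)) x = ennreal (c * u (Suc k) x)"
        by (simp add: AE_completion_iff)
      with WV' show "AE z in lborel. \<forall>a r. z \<in> ball a r \<longrightarrow>
          (\<integral>\<^sup>+y\<in>ball a r. ennreal (W y) \<partial>lborel) \<le> ennreal (2 * c) * emeasure lborel (ball a r) * ennreal (W z)"
      proof eventually_elim
        case (elim z)
        show ?case
        proof (intro allI impI)
          fix a r assume z: "z \<in> ball a r"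
          have [measurable]: "ball a r \<in> sets borel" by (simp add: borel_open)
          let ?b = "emeasure lborel (ball a r)"
          have r: "0 < r" using z by (metis mem_ball dist_not_less_zero le_less_trans not_le zero_le_dist)
          have "0 < ?b" using r by (simp add: emeasure_ball)
          then have b: "?b \<noteq> 0" "?b \<noteq> top" using emeasure_lborel_ball_finite[of a r] by auto
          have "(\<integral>\<^sup>+y\<in>ball a r. ennreal (W y) \<partial>lborel) = (\<integral>\<^sup>+y\<in>ball a r. V y \<partial>lborel)"
            using WV' by (intro nn_integral_cong_AE) (auto elim!: eventually_mono)
          also have "\<dots> = (\<Sum>k. \<integral>\<^sup>+y\<in>ball a r. ennreal ((1/2) ^ Suc k * u k y) \<partial>lborel)"
            unfolding V_def by (subst nn_integral_suminf[symmetric]) auto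
          \<comment> \<open>The average of \<open>u k\<close> over a ball containing z is at most c
            times \<open>u (Suc k) z\<close>; the new coefficient is half the old one, and the 2 in
            2 c compensates.\<close>
          also have "\<dots> \<le> (\<Sum>k. (ennreal (2 * c) * ?b) * ennreal ((1/2) ^ Suc (Suc k) * u (Suc k) z))"
          proof (intro suminf_le)
            fix k
            have "(\<integral>\<^sup>+y\<in>ball a r. ennreal ((1/2) ^ Suc k * u k y) \<partial>lborel)
              = ennreal ((1/2) ^ Suc k) * (\<integral>\<^sup>+y\<in>ball a r. ennreal (u k y) \<partial>lborel)"
            proof -
              have "ennreal ((1/2) ^ Suc k * u k y) = ennreal ((1/2) ^ Suc k) * ennreal (u k y)" for y
                using u by (intro ennreal_mult) auto
              then show ?thesis
                by (subst nn_integral_cmult[symmetric]) (simp_all only: mult.assoc, measurable)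
            qed
            also have "(\<integral>\<^sup>+y\<in>ball a r. ennreal (u k y) \<partial>lborel) \<le> ?b * ennreal (c * u (Suc k) z)"
            proof -
              have "(\<integral>\<^sup>+y\<in>ball a r. ennreal (u k y) \<partial>lborel) = ?b * ((\<integral>\<^sup>+y\<in>ball a r. ennreal (u k y) \<partial>lborel) / ?b)"
                using b by (simp add: ennreal_times_divide mult.commute[of ?b] mult_divide_eq_ennreal)
              also have "\<dots> \<le> ?b * avg_max lborel (\<lambda>x. ennreal (u k x)) z"
                by (intro mult_left_mono avg_max_ge z) simp
              finally show ?thesis using elim(2) by simp
            qed
            also have "ennreal ((1/2) ^ Suc k) * (?b * ennreal (c * u (Suc k) z))
              = (ennreal (2 * c) * ?b) * ennreal ((1/2) ^ Suc (Suc k) * u (Suc k) z)"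
            proof -
              have "ennreal ((1/2) ^ Suc k) * ennreal (c * u (Suc k) z) = ennreal ((1/2) ^ Suc k * (c * u (Suc k) z))"
                using u[of "Suc k" z] c by (intro ennreal_mult[symmetric]) auto
              also have "(1/2) ^ Suc k * (c * u (Suc k) z) = (2 * c) * ((1/2) ^ Suc (Suc k) * u (Suc k) z)"
                by simp
              also have "ennreal ((2 * c) * ((1/2) ^ Suc (Suc k) * u (Suc k) z))
                 = ennreal (2 * c) * ennreal ((1/2) ^ Suc (Suc k) * u (Suc k) z)"
                using u[of "Suc k" z] c by (intro ennreal_mult) auto
              finally show ?thesis by (metis mult.assoc mult.commute)
            qed
            finally show "(\<integral>\<^sup>+y\<in>ball a r. ennreal ((1/2) ^ Suc k * u k y) \<partial>lborel)
              \<le> (ennreal (2 * c) * ?b) * ennreal ((1/2) ^ Suc (Suc k) * u (Suc k) z)"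
              by (simp add: mult_left_mono)
          qed auto
          also have "\<dots> = (ennreal (2 * c) * ?b) * (\<Sum>k. ennreal ((1/2) ^ Suc (Suc k) * u (Suc k) z))"
            by (rule ennreal_suminf_cmult)
          also have "\<dots> \<le> (ennreal (2 * c) * ?b) * V z"
          proof (intro mult_left_mono)
            have "(\<Sum>k. ennreal ((1/2) ^ Suc (Suc k) * u (Suc k) z)) \<le> (\<Sum>k. ennreal ((1/2) ^ Suc (k + 1) * u (k + 1) z)) + (\<Sum>k<1. ennreal ((1/2) ^ Suc k * u k z))"
              by simp
            also have "\<dots> = V z" unfolding V_def by (rule suminf_offset[symmetric]) simp
            finally show "(\<Sum>k. ennreal ((1/2) ^ Suc (Suc k) * u (Suc k) z)) \<le> V z" .
          qed simp
          finally show "(\<integral>\<^sup>+y\<in>ball a r. ennreal (W y) \<partial>lborel) \<le> ennreal (2 * c) * ?b * ennreal (W z)"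
            using elim(1) by simp
        qed
      qed
    qed (use c W_pos in auto)
    ultimately show "\<exists>W. A1_weight W (2 * c) \<and> modular s (\<lambda>x. ennreal (W x)) \<le> 1 \<and> (AE x in lborel. g x \<le> 2 * W x)"
      by blast
  qed (use c in simp)
qed

section \<open>Extrapolation to variable exponents\<close>

text \<open>The left side is p0/q0 times the conjugate of p/p0, the right side the conjugate of
  q/q0. Both equal 1/(q0 d), where d is the common value of 1/p0 - 1/p and 1/q0 - 1/q.\<close>

lemma extrapolation_dual_exponent:
  fixes p q p0 q0 :: real
  assumes "1 < p0" "p0 \<le> p" "0 < q0" "q0 < q" "1 / p0 - 1 / q0 = 1 / p - 1 / q"
  shows "p0 < p" "p0 / q0 * ((p / p0) / (p / p0 - 1)) = (q / q0) / (q / q0 - 1)"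
proof -
  have e: "1 / p0 - 1 / p = 1 / q0 - 1 / q" using assms(5) by linarith
  have "1 / q < 1 / q0" using assms by (simp add: frac_less2)
  with e have "1 / p < 1 / p0" by linarith
  then show pp: "p0 < p" using assms by (auto simp: field_simps)
  have 1: "p0 / q0 * ((p / p0) / (p / p0 - 1)) = 1 / (q0 * (1 / p0 - 1 / p))"
    using assms pp by (simp add: field_simps)
  have 2: "(q / q0) / (q / q0 - 1) = 1 / (q0 * (1 / q0 - 1 / q))"
    using assms by (simp add: field_simps)
  show "p0 / q0 * ((p / p0) / (p / p0 - 1)) = (q / q0) / (q / q0 - 1)"
    unfolding 1 2 e ..
qed

text \<open>A norm inequality in modular form: c plays the role of the inverse of the operator norm,
  and h may be taken Borel and nonnegative because the kernels are positive.\<close>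

definition strong_bound ::
  "('a::euclidean_space \<Rightarrow> real) \<Rightarrow> ('a \<Rightarrow> real) \<Rightarrow> real \<Rightarrow> (('a \<Rightarrow> real) \<Rightarrow> 'a \<Rightarrow> ennreal) \<Rightarrow> bool" where
  "strong_bound p q c S \<longleftrightarrow> (\<forall>h. h \<in> borel_measurable borel \<longrightarrow> (\<forall>x. 0 \<le> h x) \<longrightarrow>
     (\<integral>\<^sup>+x. ennreal (h x powr p x) \<partial>lborel) \<le> 1 \<longrightarrow>
     (\<integral>\<^sup>+x. ennreal_powr (ennreal c * S h x) (q x) \<partial>lborel) \<le> 1)"

text \<open>Duality: the truncation of \<open>(S h)\<^bsup>q0\<^esup>\<close> is tested against its own dual function \<open>g\<close>, which the
  Rubio de Francia algorithm dominates by an A1 weight without leaving the unit ball of the dual space.\<close>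

lemma extrapolation:
  fixes S :: "(real^'n \<Rightarrow> real) \<Rightarrow> real^'n \<Rightarrow> ennreal" and p q :: "real^'n \<Rightarrow> real" and s :: "real^'n \<Rightarrow> ereal"
  assumes S: "weighted_bound S p0 q0" "\<And>h. h \<in> borel_measurable borel \<Longrightarrow> S h \<in> borel_measurable borel"
    and [measurable]: "p \<in> borel_measurable borel" "q \<in> borel_measurable borel" and s_meas [measurable]: "s \<in> borel_measurable lebesgue"
    and p0: "1 < p0" and q0: "0 < q0"
    and pq: "AE x in lborel. p0 \<le> p x \<and> q0 \<le> q x \<and> q x \<le> Q \<and> 1 / p0 - 1 / q0 = 1 / p x - 1 / q x"
    and s: "AE x in lborel. s x = conj_exponent (q x / q0)"
    and M: "bounded_from_into s s hl_maximal"
  shows "\<exists>c>0. strong_bound p q c S"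
proof -
  define r where "r x = q x / q0" for x
  have [measurable]: "r \<in> borel_measurable borel" unfolding r_def[abs_def] by measurable
  have r_leb [measurable]: "r \<in> borel_measurable lebesgue" by (intro measurable_completion) simp
  have r: "AE x in lborel. 1 \<le> r x \<and> r x \<le> Q / q0"
    using pq q0 by (auto simp: r_def divide_le_cancel field_simps elim!: eventually_mono)
  \<comment> \<open>The dichotomy of the whole proof: either q = q0, and then p = p0 and the dual
    exponent is infinite, or all conjugate exponents are finite.\<close>
  have s_cases: "AE x in lborel. (r x = 1 \<and> s x = \<infinity> \<and> p x = p0) \<or>
     (1 < r x \<and> s x = ereal (r x / (r x - 1)) \<and> p0 < p x \<and> p0 / q0 * ((p x / p0) / (p x / p0 - 1)) = r x / (r x - 1))"
    using pq s r
  proof eventually_elim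
    case (elim x)
    show ?case
    proof (cases "r x = 1")
      case True
      then have "q x = q0" using q0 by (simp add: r_def)
      with elim p0 True show ?thesis by (simp add: r_def conj_exponent_def)
    next
      case False
      then have "1 < r x" using elim by simp
      then have "q0 < q x" using q0 by (simp add: r_def)
      with elim \<open>1 < r x\<close> p0 q0 extrapolation_dual_exponent[of p0 "p x" q0 "q x"] show ?thesis
        by (simp add: r_def conj_exponent_def)
    qed
  qed
  have s1: "AE x in lebesgue. 1 \<le> s x"
    using s_cases unfolding AE_completion_iff
    by eventually_elim (auto simp: one_ereal_def field_simps)
  obtain K where K: "1 \<le> K" and rubio: "\<And>g. g \<in> borel_measurable borel \<Longrightarrow> (\<And>x. 0 \<le> g x) \<Longrightarrow> modular s (\<lambda>x. ennreal (g x)) \<le> 1 \<Longrightarrow>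
      \<not> (AE x in lborel. g x = 0) \<Longrightarrow>
      \<exists>W. A1_weight W K \<and> modular s (\<lambda>x. ennreal (W x)) \<le> 1 \<and> (AE x in lborel. g x \<le> 2 * W x)"
    using rubio_de_francia[OF s_meas s1 M] by blast
  obtain B where B: "0 \<le> B" and bound: "\<And>W h. A1_weight W K \<Longrightarrow> h \<in> borel_measurable borel \<Longrightarrow> (\<forall>x. 0 \<le> h x) \<Longrightarrow>
     (\<integral>\<^sup>+x. ennreal (h x powr p0 * W x powr (p0 / q0)) \<partial>lborel) \<le> 1 \<Longrightarrow>
     (\<integral>\<^sup>+x. ennreal_powr (S h x) q0 * ennreal (W x) \<partial>lborel) \<le> ennreal B"
    using S(1) K unfolding weighted_bound_def by meson
  \<comment> \<open>Scaling the weight by k halves \<open>W powr (p0 / q0)\<close>, which brings the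
    sum of two modulars, each at most 1, down to the normalisation 1. The A1 constant does not
    change.\<close>
  define k where "k = (1/2 :: real) powr (q0 / p0)"
  have k: "0 < k" "k powr (p0 / q0) = 1/2" using p0 q0 by (simp_all add: k_def powr_powr)
  define K1 where "K1 = 2 / k * B"
  have K1: "0 \<le> K1" using k B by (simp add: K1_def)
  \<comment> \<open>The argument by contradiction ends in m / 2 \<le> K1, which this choice
    excludes.\<close>
  define m where "m = 2 * K1 + 1"
  have m: "0 < m" using K1 by (simp add: m_def)
  show ?thesis unfolding strong_bound_def
  proof (intro exI[of _ "m powr - (1 / q0)"] conjI allI impI)
    show "0 < m powr - (1 / q0)" using m by simp
    fix h :: "real^'n \<Rightarrow> real"
    assume h_meas [measurable]: "h \<in> borel_measurable borel" and "\<forall>x. 0 \<le> h x"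
      and hp: "(\<integral>\<^sup>+x. ennreal (h x powr p x) \<partial>lborel) \<le> 1"
    then have h: "0 \<le> h x" for x by simp
    have [measurable]: "S h \<in> borel_measurable borel" by (rule S(2)) fact
    define F where "F x = ennreal_powr (S h x) q0" for x
    have [measurable]: "F \<in> borel_measurable borel" unfolding F_def[abs_def] by measurable
    have trunc: "(\<integral>\<^sup>+x. ennreal (trunc_fun N F x powr r x) * ennreal (m powr - r x) \<partial>lborel) \<le> 1" for N
    proof (rule ccontr)
      define X where "X x = trunc_fun N F x / m" for x
      define I where "I = (\<integral>\<^sup>+x. ennreal (X x powr r x) \<partial>lborel)"
      have [measurable]: "X \<in> borel_measurable borel" unfolding X_def[abs_def] by measurable
      have X: "0 \<le> X x" "X x \<le> real N / m" for x
        using m by (simp_all add: X_def trunc_fun_nonneg trunc_fun_le divide_right_mono)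
      assume "\<not> ?thesis"
      moreover have "ennreal (trunc_fun N F x powr r x) * ennreal (m powr - r x) = ennreal (X x powr r x)" for x
        using m by (simp add: X_def powr_divide powr_minus_divide trunc_fun_nonneg ennreal_mult[symmetric])
      ultimately have I1: "1 < I" by (simp add: I_def)
      \<comment> \<open>Finiteness of I rests on the truncation and on the bound Q for the exponent
        q; the base is raised to at least 1 so that the power grows with the exponent.\<close>
      have "I \<le> (\<integral>\<^sup>+x. ennreal (max 1 (real N / m) powr (Q / q0)) * indicator (ball (0 :: real^'n) (real N)) x \<partial>lborel)"
        unfolding I_def
      proof (rule nn_integral_mono_AE)
        show "AE x in lborel. ennreal (X x powr r x) \<le> ennreal (max 1 (real N / m) powr (Q / q0)) * indicator (ball (0 :: real^'n) (real N)) x"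
          using r
        proof eventually_elim
          case (elim x)
          show ?case
          proof (cases "x \<in> ball 0 (real N)")
            case True
            have "X x powr r x \<le> max 1 (real N / m) powr r x"
              using X[of x] elim by (intro powr_mono2) auto
            also have "\<dots> \<le> max 1 (real N / m) powr (Q / q0)"
              using elim by (intro powr_mono) auto
            finally show ?thesis using True by (simp add: ennreal_leI)
          next
            case False
            then show ?thesis by (simp add: X_def trunc_fun_outside)
          qed
        qed
      qed
      also have "\<dots> < top"
        using emeasure_lborel_ball_finite[of "0 :: real^'n" "real N"]
        by (subst nn_integral_cmult_indicator) (auto simp: ennreal_mult_less_top borel_open)
      finally obtain i where i: "I = ennreal i" "1 < i"
        using I1 by (cases I) (auto simp: one_less_ennreal)
      \<comment> \<open>The function dual to X, with the budget split in two. Where s is finite, g^s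
        is at most X^r / (2 i), with integral 1/2; where s = \<infinity>, r = 1 gives g \<le> 1/2
        because i > 1.\<close>
      define g where "g x = X x powr (r x - 1) / (2 * i)" for x
      have [measurable]: "g \<in> borel_measurable borel" unfolding g_def[abs_def] by measurable
      have g_leb [measurable]: "g \<in> borel_measurable lebesgue" by (intro measurable_completion) simp
      have g: "0 \<le> g x" for x using i by (simp add: g_def)
      have g_mod: "modular s (\<lambda>x. ennreal (g x)) \<le> 1"
      proof -
        have "(\<integral>\<^sup>+x\<in>{x. s x < \<infinity>}. ennreal_powr (ennreal (g x)) (real_of_ereal (s x)) \<partial>lebesgue)
          \<le> (\<integral>\<^sup>+x. ennreal (1 / (2 * i)) * ennreal (X x powr r x) \<partial>lebesgue)"
        proof (rule nn_integral_mono_AE)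
          show "AE x in lebesgue. ennreal_powr (ennreal (g x)) (real_of_ereal (s x)) * indicator {x. s x < \<infinity>} x
              \<le> ennreal (1 / (2 * i)) * ennreal (X x powr r x)"
            using s_cases unfolding AE_completion_iff
          proof eventually_elim
            case (elim x)
            show ?case
            proof (cases "s x < \<infinity>")
              case True
              then have rx: "1 < r x" "real_of_ereal (s x) = r x / (r x - 1)" using elim by auto
              let ?s = "r x / (r x - 1)"
              have s_ge: "1 \<le> ?s" using rx by (simp add: field_simps)
              have "g x powr ?s = X x powr r x / (2 * i) powr ?s"
                using rx i by (simp add: g_def powr_divide powr_powr)
              also have "\<dots> \<le> X x powr r x / (2 * i)"
              proof (intro divide_left_mono)
                show "2 * i \<le> (2 * i) powr ?s" using powr_mono[OF s_ge, of "2 * i"] i by simp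
              qed (use i in auto)
              finally have "ennreal (g x powr ?s) \<le> ennreal (1 / (2 * i) * X x powr r x)"
                by (intro ennreal_leI) simp
              also have "\<dots> = ennreal (1 / (2 * i)) * ennreal (X x powr r x)"
                using i by (intro ennreal_mult) auto
              finally show ?thesis using rx g by (simp add: ennreal_powr_ennreal indicator_def)
            qed simp
          qed
        qed
        also have "\<dots> = ennreal (1 / (2 * i)) * I"
          by (simp add: nn_integral_cmult nn_integral_completion I_def)
        also have "\<dots> = ennreal (1/2)" using i by (simp add: ennreal_mult[symmetric])
        finally have "modular s (\<lambda>x. ennreal (g x)) \<le> ennreal (1/2) + ennreal (1/2)"
        proof (rule modular_le[rotated 2])
          show "AE x in lebesgue. s x = \<infinity> \<longrightarrow> ennreal (g x) \<le> ennreal (1/2)"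
            using s_cases unfolding AE_completion_iff
          proof eventually_elim
            case (elim x)
            show ?case
            proof
              assume "s x = \<infinity>"
              then have "r x = 1" using elim by auto
              then have "g x \<le> 1/2" using i by (simp add: g_def)
              then show "ennreal (g x) \<le> ennreal (1/2)" by (rule ennreal_leI)
            qed
          qed
        qed simp_all
        also have "\<dots> = ennreal (1/2 + 1/2)" by (rule ennreal_plus[symmetric]) auto
        finally show ?thesis by simp
      qed
      have "\<not> (AE x in lborel. g x = 0)"
      proof
        assume "AE x in lborel. g x = 0"
        then have "AE x in lborel. ennreal (X x powr r x) = 0"
          by eventually_elim (use i in \<open>simp add: g_def\<close>)
        then have "I = (\<integral>\<^sup>+x. 0 \<partial>(lborel :: (real^'n) measure))" unfolding I_def by (rule nn_integral_cong_AE)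
        then show False using I1 by simp
      qed
      from rubio[OF _ g g_mod this] obtain W where W: "A1_weight W K" "modular s (\<lambda>x. ennreal (W x)) \<le> 1"
        and gW: "AE x in lborel. g x \<le> 2 * W x" by auto
      interpret A1_weight W K by fact
      have W_leb [measurable]: "W \<in> borel_measurable lebesgue" by (intro measurable_completion) simp
      have W_inf: "AE x in lborel. s x = \<infinity> \<longrightarrow> W x \<le> 1"
        using AE_le_modular[where s=s and u="\<lambda>x. ennreal (W x)"] unfolding AE_completion_iff
        by eventually_elim (use W(2) in \<open>auto dest: order_trans\<close>)
      \<comment> \<open>The weighted norm of h: Young's inequality with exponent p/p0 where s is
        finite, and W \<le> 1 together with p = p0 where s is infinite.\<close>
      have "(\<integral>\<^sup>+x. ennreal (h x powr p0 * (k * W x) powr (p0 / q0)) \<partial>lborel)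
        \<le> (\<integral>\<^sup>+x. ennreal (1/2) * (ennreal (h x powr p x)
          + ennreal_powr (ennreal (W x)) (real_of_ereal (s x)) * indicator {x. s x < \<infinity>} x) \<partial>lborel)"
      proof (rule nn_integral_mono_AE)
        show "AE x in lborel. ennreal (h x powr p0 * (k * W x) powr (p0 / q0)) \<le> ennreal (1/2) * (ennreal (h x powr p x)
          + ennreal_powr (ennreal (W x)) (real_of_ereal (s x)) * indicator {x. s x < \<infinity>} x)"
          using s_cases W_inf
        proof eventually_elim
          case (elim x)
          have w: "0 < W x" by (rule W_pos)
          have split: "ennreal (h x powr p0 * (k * W x) powr (p0 / q0)) = ennreal (1/2) * ennreal (h x powr p0 * W x powr (p0 / q0))"
          proof -
            have "h x powr p0 * (k * W x) powr (p0 / q0) = 1/2 * (h x powr p0 * W x powr (p0 / q0))"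
              using k w by (simp add: powr_mult)
            then show ?thesis by (simp only: ennreal_mult[of "1/2"] zero_le_divide_1_iff zero_le_numeral mult_nonneg_nonneg powr_ge_zero)
          qed
          show ?case unfolding split
          proof (intro mult_left_mono)
            show "ennreal (h x powr p0 * W x powr (p0 / q0)) \<le> ennreal (h x powr p x)
              + ennreal_powr (ennreal (W x)) (real_of_ereal (s x)) * indicator {x. s x < \<infinity>} x"
            proof (cases "s x = \<infinity>")
              case True
              then have "W x \<le> 1" "p x = p0" using elim by auto
              moreover have "W x powr (p0 / q0) \<le> 1 powr (p0 / q0)"
                using \<open>W x \<le> 1\<close> w p0 q0 by (intro powr_mono2) auto
              ultimately have "h x powr p0 * W x powr (p0 / q0) \<le> h x powr p x * 1"
                by (intro mult_mono) auto
              then show ?thesis using True by (simp add: ennreal_leI)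
            next
              case False
              with elim have rx: "1 < r x" "s x = ereal (r x / (r x - 1))" "p0 < p x"
                and e: "p0 / q0 * ((p x / p0) / (p x / p0 - 1)) = r x / (r x - 1)" by auto
              define a where "a = p x / p0"
              have a: "1 < a" using rx p0 by (simp add: a_def)
              then have a': "1 < a / (a - 1)" by (simp add: field_simps)
              have "h x powr p0 * W x powr (p0 / q0)
                \<le> (h x powr p0) powr a / a + (W x powr (p0 / q0)) powr (a / (a - 1)) / (a / (a - 1))"
                using a a' by (intro Youngs_inequality) (auto simp: field_simps)
              also have "\<dots> \<le> (h x powr p0) powr a + (W x powr (p0 / q0)) powr (a / (a - 1))"
              proof (intro add_mono)
                have div: "t / c \<le> t" if "1 < c" "0 \<le> t" for t c :: real
                  using that by (simp add: divide_le_eq mult_le_cancel_left1)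
                show "(h x powr p0) powr a / a \<le> (h x powr p0) powr a" using a by (intro div) auto
                show "(W x powr (p0 / q0)) powr (a / (a - 1)) / (a / (a - 1)) \<le> (W x powr (p0 / q0)) powr (a / (a - 1))"
                  using a' by (intro div) auto
              qed
              also have "(h x powr p0) powr a = h x powr p x" using p0 by (simp add: powr_powr a_def)
              also have "(W x powr (p0 / q0)) powr (a / (a - 1)) = W x powr (r x / (r x - 1))"
                using e by (simp only: powr_powr a_def)
              finally have "ennreal (h x powr p0 * W x powr (p0 / q0)) \<le> ennreal (h x powr p x + W x powr (r x / (r x - 1)))"
                by (rule ennreal_leI)
              then show ?thesis using rx w by (simp add: ennreal_powr_ennreal)
            qed
          qed simp
        qed
      qed
      also have "\<dots> = (\<integral>\<^sup>+x. ennreal (1/2) * (ennreal (h x powr p x)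
          + ennreal_powr (ennreal (W x)) (real_of_ereal (s x)) * indicator {x. s x < \<infinity>} x) \<partial>lebesgue)"
        by (rule nn_integral_completion[symmetric])
      also have "\<dots> = ennreal (1/2) * ((\<integral>\<^sup>+x. ennreal (h x powr p x) \<partial>lebesgue)
          + (\<integral>\<^sup>+x\<in>{x. s x < \<infinity>}. ennreal_powr (ennreal (W x)) (real_of_ereal (s x)) \<partial>lebesgue))"
      proof -
        have "(\<lambda>x. ennreal (h x powr p x)) \<in> borel_measurable lebesgue" by (rule measurable_completion) measurable
        then show ?thesis by (subst nn_integral_cmult) (auto simp: nn_integral_add)
      qed
      also have "\<dots> \<le> ennreal (1/2) * (1 + 1)"
        using hp order_trans[OF modular_ge_integral W(2)]
        by (intro mult_left_mono add_mono) (auto simp: nn_integral_completion)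
      also have "\<dots> = ennreal (1/2) * ennreal 2" by simp
      also have "\<dots> = ennreal (1/2 * 2)" by (rule ennreal_mult[symmetric]) auto
      also have "\<dots> = 1" by simp
      finally have norm1: "(\<integral>\<^sup>+x. ennreal (h x powr p0 * (k * W x) powr (p0 / q0)) \<partial>lborel) \<le> 1" .
      have FW: "(\<integral>\<^sup>+x. F x * ennreal (k * W x) \<partial>lborel) \<le> ennreal B"
        unfolding F_def using k h W by (intro bound A1_weight_scale norm1) auto
      \<comment> \<open>By the choice of g the product of the truncation with g is m X^r / (2 i),
        whose integral is exactly m / 2. Replacing g by 2 W then allows the weighted bound to be
        used.\<close>
      have "ennreal (m / 2) = ennreal (m / (2 * i)) * I"
        using i m by (simp add: ennreal_mult[symmetric])
      also have "\<dots> = (\<integral>\<^sup>+x. ennreal (m / (2 * i)) * ennreal (X x powr r x) \<partial>lborel)"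
        unfolding I_def by (rule nn_integral_cmult[symmetric]) measurable
      also have "\<dots> \<le> (\<integral>\<^sup>+x. ennreal (2 / k) * (F x * ennreal (k * W x)) \<partial>lborel)"
      proof (rule nn_integral_mono_AE)
        show "AE x in lborel. ennreal (m / (2 * i)) * ennreal (X x powr r x) \<le> ennreal (2 / k) * (F x * ennreal (k * W x))"
          using gW
        proof eventually_elim
          case (elim x)
          have "X x powr r x = X x * X x powr (r x - 1)"
            using X(1)[of x] powr_mult_base[of "X x" "r x - 1"] by simp
          then have "m / (2 * i) * X x powr r x = trunc_fun N F x * g x"
            using m by (simp add: g_def X_def)
          also have "\<dots> \<le> trunc_fun N F x * (2 * W x)"
            using elim by (intro mult_left_mono) (auto simp: trunc_fun_nonneg)
          also have "\<dots> = 2 / k * (trunc_fun N F x * (k * W x))" using k by simp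
          finally have "ennreal (m / (2 * i) * X x powr r x) \<le> ennreal (2 / k * (trunc_fun N F x * (k * W x)))"
            by (rule ennreal_leI)
          moreover have "ennreal (m / (2 * i)) * ennreal (X x powr r x) = ennreal (m / (2 * i) * X x powr r x)"
            using m i by (intro ennreal_mult[symmetric]) auto
          ultimately have "ennreal (m / (2 * i)) * ennreal (X x powr r x) \<le> ennreal (2 / k * (trunc_fun N F x * (k * W x)))"
            by simp
          also have "\<dots> = ennreal (2 / k) * (ennreal (trunc_fun N F x) * ennreal (k * W x))"
            using k W_pos[of x] trunc_fun_nonneg[of N F x] by (subst ennreal_mult, simp, simp, subst ennreal_mult) auto
          also have "\<dots> \<le> ennreal (2 / k) * (F x * ennreal (k * W x))"
            by (intro mult_left_mono mult_right_mono ennreal_trunc_fun_le) auto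
          finally show ?case .
        qed
      qed
      also have "\<dots> = ennreal (2 / k) * (\<integral>\<^sup>+x. F x * ennreal (k * W x) \<partial>lborel)"
        by (rule nn_integral_cmult) measurable
      also have "\<dots> \<le> ennreal (2 / k) * ennreal B" using FW by (intro mult_left_mono) auto
      also have "\<dots> = ennreal K1" using k B unfolding K1_def by (intro ennreal_mult[symmetric]) auto
      finally have "m / 2 \<le> K1" using K1 by (simp add: ennreal_le_iff)
      then show False by (simp add: m_def)
    qed
    have "(\<integral>\<^sup>+x. ennreal_powr (ennreal (m powr - (1 / q0)) * S h x) (q x) \<partial>lborel)
      = (\<integral>\<^sup>+x. ennreal_powr (F x) (r x) * ennreal (m powr - r x) \<partial>lborel)"
    proof (rule nn_integral_cong)
      fix x
      have "ennreal_powr (ennreal (m powr - (1 / q0)) * S h x) (q x) = ennreal ((m powr - (1 / q0)) powr q x) * ennreal_powr (S h x) (q x)"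
        using m by (intro ennreal_powr_cmult) simp
      also have "(m powr - (1 / q0)) powr q x = m powr - r x" by (simp add: powr_powr r_def)
      also have "ennreal_powr (S h x) (q x) = ennreal_powr (F x) (r x)"
        using q0 by (simp add: F_def ennreal_powr_powr r_def)
      finally show "ennreal_powr (ennreal (m powr - (1 / q0)) * S h x) (q x) = ennreal_powr (F x) (r x) * ennreal (m powr - r x)"
        by (simp add: mult.commute)
    qed
    also have "\<dots> \<le> 1"
    proof (rule nn_integral_le_truncated)
      show "AE x in lborel. 0 < r x" using r by eventually_elim simp
    qed (use trunc in auto)
    finally show "(\<integral>\<^sup>+x. ennreal_powr (ennreal (m powr - (1 / q0)) * S h x) (q x) \<partial>lborel) \<le> 1" .
  qed
qed

section \<open>The kernel of the fractional operator\<close>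

lemma borel_measurable_matrix_vector_mult [measurable]:
  fixes A :: "real^'n^'m"
  shows "(*v) A \<in> borel_measurable borel"
  by (intro borel_measurable_continuous_onI linear_continuous_on) (simp add: matrix_vector_mul_bounded_linear)

lemma exists_nearest_index:
  fixes t :: "nat \<Rightarrow> real"
  assumes "1 \<le> m"
  obtains i where "i \<in> {1..m}" "\<And>j. j \<in> {1..m} \<Longrightarrow> t i \<le> t j"
proof -
  have "finite {1..m}" "{1..m} \<noteq> {}" using assms by auto
  then obtain i where "i \<in> {1..m}" "\<forall>j\<in>{1..m}. t i \<le> t j"
    using ex_is_arg_min_if_finite[of "{1..m}" t] by (auto simp: is_arg_min_linorder)
  then show ?thesis using that by blast
qed

lemma frac_kernel_eq_0:
  assumes "i \<in> {1..m}" "norm (x - A i *v y) = 0"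
  shows "frac_kernel m a A x y = 0"
proof -
  have "(\<Prod>i=1..m. norm (x - A i *v y) powr a i) = 0"
    using assms by (intro prod_zero) (auto intro!: bexI[of _ i])
  then show ?thesis by (simp add: frac_kernel_def)
qed

lemma frac_kernel_nonneg: "0 \<le> frac_kernel m a A x y"
  by (simp add: frac_kernel_def prod_nonneg)

text \<open>Each factor is bounded below by the smallest one. Summing over all i afterwards avoids a
  dependence of the index on x and y. If the smallest factor vanishes, division by zero makes the
  kernel 0.\<close>

lemma frac_kernel_le_riesz:
  fixes A :: "nat \<Rightarrow> real^'n^'n"
  assumes "1 \<le> m" and a: "\<And>i. i \<in> {1..m} \<Longrightarrow> 0 < a i" and sum: "(\<Sum>i=1..m. a i) = d"
  shows "frac_kernel m a A x y \<le> (\<Sum>i=1..m. norm (x - A i *v y) powr - d)"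
proof -
  obtain i where i: "i \<in> {1..m}" "\<And>j. j \<in> {1..m} \<Longrightarrow> norm (x - A i *v y) \<le> norm (x - A j *v y)"
    using exists_nearest_index[OF assms(1), of "\<lambda>i. norm (x - A i *v y)"] by blast
  let ?t = "norm (x - A i *v y)"
  have "frac_kernel m a A x y \<le> ?t powr - d"
  proof (cases "?t = 0")
    case True
    then show ?thesis by (simp only: frac_kernel_eq_0[of i m x A y a, OF i(1) True] powr_ge_zero)
  next
    case False
    then have t: "0 < ?t" by simp
    have "?t powr d = (\<Prod>j=1..m. ?t powr a j)"
      using t by (simp add: powr_sum sum[symmetric])
    also have "\<dots> \<le> (\<Prod>j=1..m. norm (x - A j *v y) powr a j)"
      using i a by (intro prod_mono conjI powr_mono2) (auto intro: less_imp_le)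
    finally have "?t powr d \<le> (\<Prod>j=1..m. norm (x - A j *v y) powr a j)" .
    then show ?thesis using t by (simp add: frac_kernel_def powr_minus_divide frac_le)
  qed
  also have "\<dots> \<le> (\<Sum>i=1..m. norm (x - A i *v y) powr - d)"
    using i(1) by (intro member_le_sum) auto
  finally show ?thesis .
qed

text \<open>The difference of x - A y and x - B y is (B - A) y. Invertibility thus bounds |y| by the
  larger of the two distances, which by assumption is |x - B y|; then A y and x are bounded by it as
  well.\<close>

lemma nearest_separation:
  fixes A B :: "real^'n^'n"
  assumes "invertible (B - A)"
  obtains c where "0 < c"
    "\<And>x y. norm (x - A *v y) \<le> norm (x - B *v y) \<Longrightarrow> norm x + norm (A *v y) \<le> c * norm (x - B *v y)"
proof -
  obtain D where D: "D ** (B - A) = mat 1" using assms by (auto simp: invertible_def)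
  obtain K1 where K1: "0 < K1" "\<And>y. norm (D *v y) \<le> norm y * K1"
    using bounded_linear.pos_bounded[OF matrix_vector_mul_bounded_linear[of D]] by blast
  obtain K2 where K2: "0 < K2" "\<And>y. norm (A *v y) \<le> norm y * K2"
    using bounded_linear.pos_bounded[OF matrix_vector_mul_bounded_linear[of A]] by blast
  show ?thesis
  proof (rule that[of "1 + 4 * K1 * K2"])
    fix x y :: "real^'n"
    let ?d = "norm (x - B *v y)"
    assume le: "norm (x - A *v y) \<le> ?d"
    have "y = D *v ((B - A) *v y)" using D by (simp add: matrix_vector_mul_assoc)
    also have "(B - A) *v y = (x - A *v y) - (x - B *v y)" by (simp add: matrix_vector_mult_diff_rdistrib)
    finally have "norm y \<le> norm ((x - A *v y) - (x - B *v y)) * K1" using K1(2) by metis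
    also have "\<dots> \<le> (2 * ?d) * K1"
      using norm_triangle_ineq4[of "x - A *v y" "x - B *v y"] le K1(1) by (intro mult_right_mono) auto
    finally have "norm (A *v y) \<le> 2 * ?d * K1 * K2"
      using K2 by (meson less_imp_le mult_right_mono order_trans)
    moreover have "norm x \<le> norm (x - A *v y) + norm (A *v y)"
      using norm_triangle_ineq[of "x - A *v y" "A *v y"] by simp
    ultimately have "norm x + norm (A *v y) \<le> ?d + 4 * (?d * K1 * K2)" using le by linarith
    then show "norm x + norm (A *v y) \<le> (1 + 4 * K1 * K2) * ?d" by (simp add: algebra_simps)
  qed (use K1 K2 in \<open>simp add: add_pos_pos\<close>)
qed

text \<open>Only the nearest factor can be small: by the separation every other one is at least a
  constant times |x| + |A_i y|. The exponents of the others sum to d - a_i.\<close>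

lemma frac_kernel_le_stein:
  fixes A :: "nat \<Rightarrow> real^'n^'n"
  assumes m: "1 \<le> m" and a: "\<And>i. i \<in> {1..m} \<Longrightarrow> 0 < a i" and sum: "(\<Sum>i=1..m. a i) = d"
    and inv: "\<And>i j. i \<in> {1..m} \<Longrightarrow> j \<in> {1..m} \<Longrightarrow> i \<noteq> j \<Longrightarrow> invertible (A i - A j)"
  shows "\<exists>C\<ge>0. \<forall>x y. frac_kernel m a A x y \<le> C * (\<Sum>i=1..m. norm (x - A i *v y) powr - a i * (norm x + norm (A i *v y)) powr (a i - d))"
proof -
  have "\<forall>i\<in>{1..m}. \<forall>j\<in>{1..m}. \<exists>c>0. i \<noteq> j \<longrightarrow> (\<forall>x y. norm (x - A i *v y) \<le> norm (x - A j *v y) \<longrightarrow>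
      norm x + norm (A i *v y) \<le> c * norm (x - A j *v y))"
  proof (intro ballI)
    fix i j assume "i \<in> {1..m}" "j \<in> {1..m}"
    show "\<exists>c>0. i \<noteq> j \<longrightarrow> (\<forall>x y. norm (x - A i *v y) \<le> norm (x - A j *v y) \<longrightarrow>
      norm x + norm (A i *v y) \<le> c * norm (x - A j *v y))"
    proof (cases "i = j")
      case False
      then have "invertible (A j - A i)" using inv[of j i] \<open>i \<in> _\<close> \<open>j \<in> _\<close> by auto
      from nearest_separation[OF this] show ?thesis by metis
    qed (auto intro: exI[of _ "1::real"])
  qed
  then obtain c where c: "\<And>i j. i \<in> {1..m} \<Longrightarrow> j \<in> {1..m} \<Longrightarrow> 0 < c i j"
    "\<And>i j x y. i \<in> {1..m} \<Longrightarrow> j \<in> {1..m} \<Longrightarrow> i \<noteq> j \<Longrightarrow> norm (x - A i *v y) \<le> norm (x - A j *v y) \<Longrightarrow>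
      norm x + norm (A i *v y) \<le> c i j * norm (x - A j *v y)"
    unfolding bchoice_iff by metis
  \<comment> \<open>Dominates every c i j, and is at least 1 so that the powers with exponent d -
    a_i are at most \<kappa>^d.\<close>
  define \<kappa> where "\<kappa> = 1 + (\<Sum>i=1..m. \<Sum>j=1..m. c i j)"
  have c_nn: "0 \<le> (\<Sum>j=1..m. c i j)" if "i \<in> {1..m}" for i
    using c(1)[OF that] by (intro sum_nonneg) (simp add: less_imp_le)
  have \<kappa>: "1 \<le> \<kappa>" using sum_nonneg[of "{1..m}" "\<lambda>i. \<Sum>j=1..m. c i j"] c_nn unfolding \<kappa>_def by auto
  have c_le: "c i j \<le> \<kappa>" if "i \<in> {1..m}" "j \<in> {1..m}" for i j
  proof -
    have "c i j \<le> (\<Sum>j=1..m. c i j)"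
      using that c(1) by (intro member_le_sum) (auto intro: less_imp_le)
    also have "\<dots> \<le> (\<Sum>i=1..m. \<Sum>j=1..m. c i j)"
      using that c_nn by (intro member_le_sum[of i _ "\<lambda>i. \<Sum>j=1..m. c i j"]) auto
    finally show ?thesis by (simp add: \<kappa>_def)
  qed
  have d: "a i \<le> d" if "i \<in> {1..m}" for i
    using that a unfolding sum[symmetric] by (intro member_le_sum) (auto intro: less_imp_le)
  show ?thesis
  proof (intro exI[of _ "\<kappa> powr d"] conjI allI)
    fix x y :: "real^'n"
    obtain i where i: "i \<in> {1..m}" "\<And>j. j \<in> {1..m} \<Longrightarrow> norm (x - A i *v y) \<le> norm (x - A j *v y)"
      using exists_nearest_index[OF m, of "\<lambda>i. norm (x - A i *v y)"] by blast
    let ?t = "norm (x - A i *v y)" and ?s = "norm x + norm (A i *v y)"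
    have "frac_kernel m a A x y \<le> \<kappa> powr d * (?t powr - a i * ?s powr (a i - d))"
    proof (cases "?t = 0")
      case True
      then show ?thesis by (simp only: frac_kernel_eq_0[of i m x A y a, OF i(1) True] mult_nonneg_nonneg powr_ge_zero)
    next
      case False
      then have t: "0 < ?t" by simp
      have s: "0 < ?s" using norm_triangle_ineq4[of x "A i *v y"] t by linarith
      have low: "(?s / \<kappa>) powr a j \<le> norm (x - A j *v y) powr a j" if "j \<in> {1..m} - {i}" for j
      proof (intro powr_mono2)
        have "?s \<le> c i j * norm (x - A j *v y)" using c(2)[of i j] i that by auto
        also have "\<dots> \<le> \<kappa> * norm (x - A j *v y)" using c_le[of i j] i that by (intro mult_right_mono) auto
        finally show "?s / \<kappa> \<le> norm (x - A j *v y)" using \<kappa> by (simp add: divide_le_eq mult.commute)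
      qed (use that a \<kappa> in \<open>auto intro: less_imp_le\<close>)
      have "?t powr a i * (?s / \<kappa>) powr (d - a i) = ?t powr a i * (\<Prod>j\<in>{1..m} - {i}. (?s / \<kappa>) powr a j)"
      proof -
        have "d - a i = (\<Sum>j\<in>{1..m} - {i}. a j)" using i(1) by (simp add: sum[symmetric] sum_diff1)
        moreover have "?s / \<kappa> \<noteq> 0" using s \<kappa> by simp
        ultimately show ?thesis by (simp add: powr_sum)
      qed
      also have "\<dots> \<le> ?t powr a i * (\<Prod>j\<in>{1..m} - {i}. norm (x - A j *v y) powr a j)"
        using low by (intro mult_left_mono prod_mono) auto
      also have "\<dots> = (\<Prod>j=1..m. norm (x - A j *v y) powr a j)"
        using i(1) by (subst prod.remove[of _ i]) auto
      finally have "?t powr a i * (?s / \<kappa>) powr (d - a i) \<le> (\<Prod>j=1..m. norm (x - A j *v y) powr a j)" .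
      then have "frac_kernel m a A x y \<le> 1 / (?t powr a i * (?s / \<kappa>) powr (d - a i))"
        unfolding frac_kernel_def using t s \<kappa> by (intro frac_le) (auto intro!: mult_pos_pos)
      also have "\<dots> = \<kappa> powr (d - a i) * (?t powr - a i * ?s powr (a i - d))"
        using s \<kappa> powr_minus_divide[of ?s "d - a i"] by (simp add: powr_divide powr_minus_divide)
      also have "\<dots> \<le> \<kappa> powr d * (?t powr - a i * ?s powr (a i - d))"
        using \<kappa> a[OF i(1)] by (intro mult_right_mono powr_mono) auto
      finally show ?thesis .
    qed
    also have "\<dots> \<le> \<kappa> powr d * (\<Sum>i=1..m. norm (x - A i *v y) powr - a i * (norm x + norm (A i *v y)) powr (a i - d))"
      using i(1) by (intro mult_left_mono member_le_sum) auto
    finally show "frac_kernel m a A x y \<le> \<kappa> powr d * (\<Sum>i=1..m. norm (x - A i *v y) powr - a i * (norm x + norm (A i *v y)) powr (a i - d))" .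
  qed simp
qed

section \<open>Change of variables and superposition\<close>

text \<open>The substitution z = A y replaces h by its composition with the inverse of A. The
  invariance of p under A keeps the exponent unchanged, so the modular only picks up the Jacobian
  factor.\<close>

lemma strong_bound_change_variables:
  fixes k :: "real^'n \<Rightarrow> real^'n \<Rightarrow> real" and p q :: "real^'n \<Rightarrow> real" and A :: "real^'n^'n"
  assumes inv: "invertible A"
    and [measurable]: "p \<in> borel_measurable borel" "q \<in> borel_measurable borel"
      "\<And>x. k x \<in> borel_measurable borel"
    and p1: "AE x in lborel. 1 \<le> p x" and q1: "AE x in lborel. 1 \<le> q x"
    and pA: "AE x in lborel. p (A *v x) = p x"
    and c: "0 < c" and bound: "strong_bound p q c (\<lambda>h x. \<integral>\<^sup>+z. ennreal (k x z) * ennreal (h z) \<partial>lborel)"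
  shows "\<exists>c'>0. strong_bound p q c' (\<lambda>h x. \<integral>\<^sup>+z. ennreal (k x (A *v z)) * ennreal (h z) \<partial>lborel)"
proof -
  obtain B where B: "A ** B = mat 1" "B ** A = mat 1" using inv by (auto simp: invertible_def)
  have AB: "A *v (B *v x) = x" "B *v (A *v x) = x" for x
    using B by (simp_all add: matrix_vector_mul_assoc)
  have lin: "linear ((*v) A)" "linear ((*v) B)" by simp_all
  have bij: "bij ((*v) A)" "bij ((*v) B)"
    by (rule bij_betw_byWitness[where f'="(*v) B"], auto simp: AB)
      (rule bij_betw_byWitness[where f'="(*v) A"], auto simp: AB)
  obtain e :: real where e: "0 \<le> e"
    "\<And>h. h \<in> borel_measurable borel \<Longrightarrow> (\<integral>\<^sup>+y. h (A *v y) \<partial>lborel) = ennreal e * (\<integral>\<^sup>+x. h x \<partial>lborel)"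
    using nn_integral_lborel_linear[OF lin(1) bij(1)] by blast
  obtain d :: real where d: "0 \<le> d"
    "\<And>h. h \<in> borel_measurable borel \<Longrightarrow> (\<integral>\<^sup>+y. h (B *v y) \<partial>lborel) = ennreal d * (\<integral>\<^sup>+x. h x \<partial>lborel)"
    using nn_integral_lborel_linear[OF lin(2) bij(2)] by blast
  \<comment> \<open>At least 1, so that dividing h by N divides the modular by N at least, as p
    \<ge> 1; and at least d, which compensates the Jacobian factor of the inverse.\<close>
  define N where "N = max 1 d"
  have N: "1 \<le> N" "d \<le> N" by (simp_all add: N_def)
  have eN: "0 < e * N + 1" using e N by (intro add_nonneg_pos) auto
  show ?thesis unfolding strong_bound_def
  \<comment> \<open>The operator of h is e N times that of g; the added 1 keeps the denominator
    positive, as e is only known to be nonnegative.\<close>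
  proof (intro exI[of _ "c / (e * N + 1)"] conjI allI impI)
    show "0 < c / (e * N + 1)" using c eN by simp
    fix h :: "real^'n \<Rightarrow> real"
    assume [measurable]: "h \<in> borel_measurable borel" and "\<forall>x. 0 \<le> h x"
      and hp: "(\<integral>\<^sup>+x. ennreal (h x powr p x) \<partial>lborel) \<le> 1"
    then have h: "0 \<le> h x" for x by simp
    define g where "g z = h (B *v z) / N" for z
    have [measurable]: "g \<in> borel_measurable borel" unfolding g_def[abs_def] by measurable
    have g: "0 \<le> g x" for x using h N by (simp add: g_def)
    have "(\<integral>\<^sup>+z. ennreal (g z powr p z) \<partial>lborel) \<le> (\<integral>\<^sup>+z. ennreal (1 / N) * ennreal (h (B *v z) powr p (A *v (B *v z))) \<partial>lborel)"
    proof (rule nn_integral_mono_AE)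
      show "AE z in lborel. ennreal (g z powr p z) \<le> ennreal (1 / N) * ennreal (h (B *v z) powr p (A *v (B *v z)))"
        using p1
      proof eventually_elim
        case (elim z)
        have "g z powr p z = h (B *v z) powr p z / N powr p z"
          using h N by (simp add: g_def powr_divide)
        also have "\<dots> \<le> h (B *v z) powr p z / N"
          using N elim powr_mono[of 1 "p z" N] by (intro divide_left_mono) auto
        finally have "ennreal (g z powr p z) \<le> ennreal (1 / N * h (B *v z) powr p z)"
          by (intro ennreal_leI) simp
        also have "\<dots> = ennreal (1 / N) * ennreal (h (B *v z) powr p z)"
          using N by (intro ennreal_mult) auto
        finally show ?case by (simp add: AB)
      qed
    qed
    also have "\<dots> = ennreal (1 / N) * (\<integral>\<^sup>+z. ennreal (h (B *v z) powr p (A *v (B *v z))) \<partial>lborel)"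
      by (rule nn_integral_cmult) measurable
    also have "(\<integral>\<^sup>+z. ennreal (h (B *v z) powr p (A *v (B *v z))) \<partial>lborel) = ennreal d * (\<integral>\<^sup>+y. ennreal (h y powr p (A *v y)) \<partial>lborel)"
      by (rule d(2)) measurable
    also have "(\<integral>\<^sup>+y. ennreal (h y powr p (A *v y)) \<partial>lborel) = (\<integral>\<^sup>+y. ennreal (h y powr p y) \<partial>lborel)"
      using pA by (intro nn_integral_cong_AE) (auto elim!: eventually_mono)
    also have "ennreal (1 / N) * (ennreal d * (\<integral>\<^sup>+y. ennreal (h y powr p y) \<partial>lborel)) \<le> ennreal (1 / N) * (ennreal d * 1)"
      using hp by (intro mult_left_mono) auto
    also have "\<dots> = ennreal (1 / N * d)" using N d(1) by (simp only: mult_1_right) (intro ennreal_mult[symmetric], auto)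
    also have "\<dots> \<le> ennreal 1" using N by (intro ennreal_leI) simp
    finally have gp: "(\<integral>\<^sup>+z. ennreal (g z powr p z) \<partial>lborel) \<le> 1" by simp
    have op: "(\<integral>\<^sup>+z. ennreal (k x (A *v z)) * ennreal (h z) \<partial>lborel) = ennreal (e * N) * (\<integral>\<^sup>+z. ennreal (k x z) * ennreal (g z) \<partial>lborel)" for x
    proof -
      have "(\<integral>\<^sup>+z. ennreal (k x (A *v z)) * ennreal (h z) \<partial>lborel)
        = (\<integral>\<^sup>+y. ennreal (k x (A *v y)) * ennreal (N * g (A *v y)) \<partial>lborel)"
        using N by (simp add: g_def AB)
      also have "\<dots> = ennreal e * (\<integral>\<^sup>+z. ennreal (k x z) * ennreal (N * g z) \<partial>lborel)"
        by (rule e(2)) measurable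
      also have "(\<integral>\<^sup>+z. ennreal (k x z) * ennreal (N * g z) \<partial>lborel) = (\<integral>\<^sup>+z. ennreal N * (ennreal (k x z) * ennreal (g z)) \<partial>lborel)"
        using N g by (intro nn_integral_cong) (simp add: ennreal_mult mult.left_commute)
      also have "\<dots> = ennreal N * (\<integral>\<^sup>+z. ennreal (k x z) * ennreal (g z) \<partial>lborel)"
        by (rule nn_integral_cmult) measurable
      finally show ?thesis using e(1) N by (simp add: ennreal_mult mult.assoc)
    qed
    have "(\<integral>\<^sup>+x. ennreal_powr (ennreal (c / (e * N + 1)) * (\<integral>\<^sup>+z. ennreal (k x (A *v z)) * ennreal (h z) \<partial>lborel)) (q x) \<partial>lborel)
      \<le> (\<integral>\<^sup>+x. ennreal_powr (ennreal c * (\<integral>\<^sup>+z. ennreal (k x z) * ennreal (g z) \<partial>lborel)) (q x) \<partial>lborel)"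
    proof (rule nn_integral_mono_AE)
      have le: "c / (e * N + 1) * (e * N) \<le> c" using c eN by (simp add: field_simps)
      show "AE x in lborel. ennreal_powr (ennreal (c / (e * N + 1)) * (\<integral>\<^sup>+z. ennreal (k x (A *v z)) * ennreal (h z) \<partial>lborel)) (q x)
         \<le> ennreal_powr (ennreal c * (\<integral>\<^sup>+z. ennreal (k x z) * ennreal (g z) \<partial>lborel)) (q x)"
        using q1
      proof eventually_elim
        case (elim x)
        have "ennreal (c / (e * N + 1)) * (ennreal (e * N) * (\<integral>\<^sup>+z. ennreal (k x z) * ennreal (g z) \<partial>lborel))
          = ennreal (c / (e * N + 1) * (e * N)) * (\<integral>\<^sup>+z. ennreal (k x z) * ennreal (g z) \<partial>lborel)"
          using c eN e N by (subst ennreal_mult) (auto simp: mult.assoc)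
        also have "\<dots> \<le> ennreal c * (\<integral>\<^sup>+z. ennreal (k x z) * ennreal (g z) \<partial>lborel)"
          using le by (intro mult_right_mono ennreal_leI) auto
        finally show ?case unfolding op using elim by (intro ennreal_powr_mono) auto
      qed
    qed
    also have "\<dots> \<le> 1" using bound g gp unfolding strong_bound_def by simp
    finally show "(\<integral>\<^sup>+x. ennreal_powr (ennreal (c / (e * N + 1)) * (\<integral>\<^sup>+z. ennreal (k x (A *v z)) * ennreal (h z) \<partial>lborel)) (q x) \<partial>lborel) \<le> 1" .
  qed
qed

text \<open>One factor 1/m turns the sum into at most its largest term. The other one survives the
  power, since q \<ge> 1, and lets m modulars, each at most 1, average to at most 1.\<close>

lemma ennreal_powr_sum_le:
  fixes t :: "nat \<Rightarrow> ennreal"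
  assumes m: "1 \<le> m" and q: "1 \<le> q"
  shows "ennreal_powr (ennreal (1 / (real m)\<^sup>2) * (\<Sum>i=1..m. t i)) q \<le> ennreal (1 / real m) * (\<Sum>i=1..m. ennreal_powr (t i) q)"
proof -
  have "finite {1..m}" "{1..m} \<noteq> {}" using m by auto
  then obtain i where i: "i \<in> {1..m}" "\<And>j. j \<in> {1..m} \<Longrightarrow> t j \<le> t i"
    using Max_in[of "t ` {1..m}"] Max_ge[of "t ` {1..m}"] by (metis (no_types, lifting) finite_imageI imageE image_eqI image_is_empty)
  have m0: "0 < 1 / real m" using m by simp
  have "(\<Sum>i=1..m. t i) \<le> of_nat (card {1..m}) * t i"
    by (rule sum_bounded_above) (use i in auto)
  then have "ennreal (1 / (real m)\<^sup>2) * (\<Sum>i=1..m. t i) \<le> ennreal (1 / (real m)\<^sup>2) * (ennreal (real m) * t i)"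
    by (intro mult_left_mono) (auto simp: ennreal_of_nat_eq_real_of_nat)
  also have "\<dots> = ennreal (1 / real m) * t i"
    using m by (simp add: mult.assoc[symmetric] ennreal_mult[symmetric] power2_eq_square)
  finally have "ennreal_powr (ennreal (1 / (real m)\<^sup>2) * (\<Sum>i=1..m. t i)) q \<le> ennreal_powr (ennreal (1 / real m) * t i) q"
    using q by (intro ennreal_powr_mono) auto
  also have "\<dots> = ennreal ((1 / real m) powr q) * ennreal_powr (t i) q"
    by (rule ennreal_powr_cmult[OF m0])
  also have "\<dots> \<le> ennreal (1 / real m) * (\<Sum>i=1..m. ennreal_powr (t i) q)"
  proof (intro mult_mono ennreal_leI)
    show "(1 / real m) powr q \<le> 1 / real m"
      using powr_mono'[of 1 q "1 / real m"] q m by simp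
    show "ennreal_powr (t i) q \<le> (\<Sum>i=1..m. ennreal_powr (t i) q)"
      using i by (intro member_le_sum) auto
  qed auto
  finally show ?thesis .
qed

lemma frac_kernel_strong_bound:
  fixes k :: "nat \<Rightarrow> real^'n \<Rightarrow> real^'n \<Rightarrow> real" and p q :: "real^'n \<Rightarrow> real" and A :: "nat \<Rightarrow> real^'n^'n"
  assumes m: "1 \<le> m" and inv: "\<And>i. i \<in> {1..m} \<Longrightarrow> invertible (A i)"
    and p_meas [measurable]: "p \<in> borel_measurable borel" and q_meas [measurable]: "q \<in> borel_measurable borel"
    and k_meas [measurable]: "\<And>i. (\<lambda>(x, z). k i x z) \<in> borel_measurable (borel \<Otimes>\<^sub>M borel)" and k: "\<And>i x z. 0 \<le> k i x z"
    and p1: "AE x in lborel. 1 \<le> p x" and q1: "AE x in lborel. 1 \<le> q x"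
    and pA: "\<And>i. i \<in> {1..m} \<Longrightarrow> AE x in lborel. p (A i *v x) = p x"
    and C: "0 \<le> C" and kernel: "\<And>x y. frac_kernel m a A x y \<le> C * (\<Sum>i=1..m. k i x (A i *v y))"
    and bound: "\<And>i. i \<in> {1..m} \<Longrightarrow>
      \<exists>c>0. strong_bound p q c (\<lambda>h x. \<integral>\<^sup>+z. ennreal (k i x z) * ennreal (h z) \<partial>lborel)"
  shows "\<exists>c>0. strong_bound p q c (\<lambda>h x. \<integral>\<^sup>+y. ennreal (frac_kernel m a A x y) * ennreal (h y) \<partial>lborel)"
proof -
  have k_slice [measurable]: "k i x \<in> borel_measurable borel" for i x
    using measurable_compose[OF measurable_Pair1'[of x borel borel] k_meas[of i]] by simp
  let ?P = "\<lambda>i c. 0 < c \<and> strong_bound p q c (\<lambda>h x. \<integral>\<^sup>+z. ennreal (k i x (A i *v z)) * ennreal (h z) \<partial>lborel)"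
  have "\<forall>i\<in>{1..m}. \<exists>c. ?P i c"
  proof
    fix i assume i: "i \<in> {1..m}"
    obtain c where "0 < c" "strong_bound p q c (\<lambda>h x. \<integral>\<^sup>+z. ennreal (k i x z) * ennreal (h z) \<partial>lborel)"
      using bound[OF i] by (elim exE conjE)
    then show "\<exists>c. ?P i c"
      by (rule strong_bound_change_variables[OF inv[OF i] p_meas q_meas k_slice p1 q1 pA[OF i]])
  qed
  from bchoice[OF this] obtain c where *: "\<forall>i\<in>{1..m}. ?P i (c i)" by (elim exE)
  have c: "0 < c i" if "i \<in> {1..m}" for i using bspec[OF * that] by (rule conjunct1)
  have cb: "strong_bound p q (c i) (\<lambda>h x. \<integral>\<^sup>+z. ennreal (k i x (A i *v z)) * ennreal (h z) \<partial>lborel)"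
    if "i \<in> {1..m}" for i using bspec[OF * that] by (rule conjunct2)
  \<comment> \<open>Chosen so that C \<le> E c_i for every i; the summand 1 keeps E positive if C =
    0.\<close>
  define E where "E = 1 + (\<Sum>i=1..m. C / c i)"
  have Cc: "0 \<le> C / c i" if "i \<in> {1..m}" for i using C c[OF that] by simp
  have E: "0 < E" unfolding E_def using Cc by (intro add_pos_nonneg sum_nonneg) auto
  have E_ge: "C \<le> E * c i" if "i \<in> {1..m}" for i
  proof -
    have "C / c i \<le> (\<Sum>i=1..m. C / c i)" using that Cc by (intro member_le_sum) auto
    then have "C / c i \<le> E" by (simp add: E_def)
    then show ?thesis using c[OF that] by (simp add: divide_le_eq)
  qed
  show ?thesis unfolding strong_bound_def
  proof (intro exI[of _ "1 / (real m)\<^sup>2 * (1 / E)"] conjI allI impI)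
    show "0 < 1 / (real m)\<^sup>2 * (1 / E)" using m E by simp
    fix h :: "real^'n \<Rightarrow> real"
    assume [measurable]: "h \<in> borel_measurable borel" and h: "\<forall>x. 0 \<le> h x"
      and hp: "(\<integral>\<^sup>+x. ennreal (h x powr p x) \<partial>lborel) \<le> 1"
    define T where "T i x = ennreal (c i) * (\<integral>\<^sup>+z. ennreal (k i x (A i *v z)) * ennreal (h z) \<partial>lborel)" for i x
    have [measurable]: "T i \<in> borel_measurable borel" for i
      unfolding T_def[abs_def] by measurable
    have T: "(\<integral>\<^sup>+y. ennreal (frac_kernel m a A x y) * ennreal (h y) \<partial>lborel) \<le> ennreal E * (\<Sum>i=1..m. T i x)" for x
    proof -
      have "(\<integral>\<^sup>+y. ennreal (frac_kernel m a A x y) * ennreal (h y) \<partial>lborel)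
        \<le> (\<integral>\<^sup>+y. (\<Sum>i=1..m. ennreal (E * c i) * (ennreal (k i x (A i *v y)) * ennreal (h y))) \<partial>lborel)"
      proof (rule nn_integral_mono)
        fix y
        have "frac_kernel m a A x y \<le> (\<Sum>i=1..m. C * k i x (A i *v y))"
          using kernel by (simp add: sum_distrib_left)
        also have "\<dots> \<le> (\<Sum>i=1..m. E * c i * k i x (A i *v y))"
          using E_ge k by (intro sum_mono mult_right_mono) auto
        finally have "ennreal (frac_kernel m a A x y) \<le> ennreal (\<Sum>i=1..m. E * c i * k i x (A i *v y))"
          by (rule ennreal_leI)
        also have "\<dots> = (\<Sum>i=1..m. ennreal (E * c i) * ennreal (k i x (A i *v y)))"
          using E c k by (subst sum_ennreal[symmetric]) (auto simp: ennreal_mult less_imp_le intro!: mult_nonneg_nonneg sum.cong)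
        finally have "ennreal (frac_kernel m a A x y) * ennreal (h y) \<le> (\<Sum>i=1..m. ennreal (E * c i) * ennreal (k i x (A i *v y))) * ennreal (h y)"
          by (rule mult_right_mono) simp
        then show "ennreal (frac_kernel m a A x y) * ennreal (h y) \<le> (\<Sum>i=1..m. ennreal (E * c i) * (ennreal (k i x (A i *v y)) * ennreal (h y)))"
          by (simp add: sum_distrib_right mult.assoc)
      qed
      also have "\<dots> = (\<Sum>i=1..m. ennreal (E * c i) * (\<integral>\<^sup>+y. ennreal (k i x (A i *v y)) * ennreal (h y) \<partial>lborel))"
        by (subst nn_integral_sum) (auto simp: nn_integral_cmult)
      also have "\<dots> = ennreal E * (\<Sum>i=1..m. T i x)"
        using E c by (auto simp: T_def sum_distrib_left ennreal_mult less_imp_le mult.assoc intro!: sum.cong)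
      finally show ?thesis .
    qed
    have "(\<integral>\<^sup>+x. ennreal_powr (ennreal (1 / (real m)\<^sup>2 * (1 / E)) * (\<integral>\<^sup>+y. ennreal (frac_kernel m a A x y) * ennreal (h y) \<partial>lborel)) (q x) \<partial>lborel)
      \<le> (\<integral>\<^sup>+x. ennreal (1 / real m) * (\<Sum>i=1..m. ennreal_powr (T i x) (q x)) \<partial>lborel)"
    proof (rule nn_integral_mono_AE)
      show "AE x in lborel. ennreal_powr (ennreal (1 / (real m)\<^sup>2 * (1 / E)) * (\<integral>\<^sup>+y. ennreal (frac_kernel m a A x y) * ennreal (h y) \<partial>lborel)) (q x)
         \<le> ennreal (1 / real m) * (\<Sum>i=1..m. ennreal_powr (T i x) (q x))"
        using q1
      proof eventually_elim
        case (elim x)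
        have "ennreal (1 / (real m)\<^sup>2 * (1 / E)) * (\<integral>\<^sup>+y. ennreal (frac_kernel m a A x y) * ennreal (h y) \<partial>lborel)
          \<le> ennreal (1 / (real m)\<^sup>2 * (1 / E)) * (ennreal E * (\<Sum>i=1..m. T i x))"
          using T by (intro mult_left_mono) auto
        also have "\<dots> = ennreal (1 / (real m)\<^sup>2 * (1 / E) * E) * (\<Sum>i=1..m. T i x)"
          using E by (subst ennreal_mult[of "1 / (real m)\<^sup>2 * (1 / E)"]) (auto simp: mult.assoc)
        also have "1 / (real m)\<^sup>2 * (1 / E) * E = 1 / (real m)\<^sup>2" using E by simp
        finally have "ennreal_powr (ennreal (1 / (real m)\<^sup>2 * (1 / E)) * (\<integral>\<^sup>+y. ennreal (frac_kernel m a A x y) * ennreal (h y) \<partial>lborel)) (q x)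
          \<le> ennreal_powr (ennreal (1 / (real m)\<^sup>2) * (\<Sum>i=1..m. T i x)) (q x)"
          using elim by (intro ennreal_powr_mono) auto
        also have "\<dots> \<le> ennreal (1 / real m) * (\<Sum>i=1..m. ennreal_powr (T i x) (q x))"
          by (rule ennreal_powr_sum_le[OF m elim])
        finally show ?case .
      qed
    qed
    also have "\<dots> = ennreal (1 / real m) * (\<Sum>i=1..m. \<integral>\<^sup>+x. ennreal_powr (T i x) (q x) \<partial>lborel)"
      by (subst nn_integral_cmult) (auto simp: nn_integral_sum)
    also have "\<dots> \<le> ennreal (1 / real m) * (\<Sum>i=1..m. 1)"
      using cb h hp unfolding T_def strong_bound_def by (intro mult_left_mono sum_mono) auto
    also have "\<dots> = ennreal (1 / real m) * ennreal (real m)"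
      by (simp add: ennreal_of_nat_eq_real_of_nat)
    also have "\<dots> = ennreal (1 / real m * real m)" by (rule ennreal_mult[symmetric]) auto
    also have "\<dots> = 1" using m by simp
    finally show "(\<integral>\<^sup>+x. ennreal_powr (ennreal (1 / (real m)\<^sup>2 * (1 / E)) * (\<integral>\<^sup>+y. ennreal (frac_kernel m a A x y) * ennreal (h y) \<partial>lborel)) (q x) \<partial>lborel) \<le> 1" .
  qed
qed

section \<open>Passage to variable Lebesgue spaces\<close>

lemma borel_measurable_frac_kernel [measurable]:
  fixes A :: "nat \<Rightarrow> real^'n^'n"
  shows "(\<lambda>(x, y). frac_kernel m a A x y) \<in> borel_measurable (borel \<Otimes>\<^sub>M borel)"
proof -
  have "(\<lambda>(x, y). 1 / (\<Prod>i=1..m. norm (x - A i *v y) powr a i)) \<in> borel_measurable (borel \<Otimes>\<^sub>M borel)"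
    by measurable
  then show ?thesis by (simp add: frac_kernel_def[abs_def])
qed

text \<open>The estimates above concern Borel functions and \<open>lborel\<close>, the spaces
  consist of Lebesgue measurable functions; this connects them.\<close>

lemma complex_lebesgue_borel_representative:
  fixes f :: "'a::euclidean_space \<Rightarrow> complex"
  assumes f: "f \<in> borel_measurable lebesgue"
  obtains g where "g \<in> borel_measurable borel" "AE x in lborel. f x = g x"
proof -
  have "(\<lambda>x. Re (f x)) \<in> borel_measurable lebesgue" "(\<lambda>x. Im (f x)) \<in> borel_measurable lebesgue"
    using f by measurable
  then obtain u v where uv: "u \<in> borel_measurable lborel" "v \<in> borel_measurable lborel"
    and ae: "AE x in lborel. Re (f x) = u x" "AE x in lborel. Im (f x) = v x"
    using completion_ex_borel_measurable_real by metis
  have "(\<lambda>x. Complex (u x) (v x)) \<in> borel_measurable borel"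
    using uv by (simp add: borel_measurable_complex_iff)
  moreover have "AE x in lborel. f x = Complex (u x) (v x)"
    using ae by eventually_elim (simp add: complex_eq_iff)
  ultimately show ?thesis using that by blast
qed

lemma var_norm_le_cmult:
  assumes C: "0 < C" and le: "\<And>l. 0 < l \<Longrightarrow> modular s (\<lambda>x. g x / ennreal l) \<le> 1 \<Longrightarrow> modular t (\<lambda>x. h x / ennreal (C * l)) \<le> 1"
  shows "var_norm t h \<le> ennreal C * var_norm s g"
proof -
  have "ennreal (1 / C) * var_norm t h \<le> var_norm s g"
    unfolding var_norm_def[of s]
  proof (rule Inf_greatest, safe)
    fix l :: real assume l: "0 < l" "modular s (\<lambda>x. g x / ennreal l) \<le> 1"
    have "var_norm t h \<le> ennreal (C * l)"
      unfolding var_norm_def using le[OF l] C l(1) by (intro Inf_lower) auto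
    then have "ennreal (1 / C) * var_norm t h \<le> ennreal (1 / C) * ennreal (C * l)"
      by (rule mult_left_mono) simp
    also have "\<dots> = ennreal l" using C l by (simp add: ennreal_mult[symmetric])
    finally show "ennreal (1 / C) * var_norm t h \<le> ennreal l" .
  qed
  then have "ennreal C * (ennreal (1 / C) * var_norm t h) \<le> ennreal C * var_norm s g"
    by (rule mult_left_mono) simp
  moreover have "ennreal C * (ennreal (1 / C) * var_norm t h) = var_norm t h"
    using C by (simp add: mult.assoc[symmetric] ennreal_mult[symmetric])
  ultimately show ?thesis by simp
qed

lemma exponent_lower_AE:
  fixes p :: "real^'n \<Rightarrow> real"
  assumes "1 < exponent_lower p"
  shows "AE x in lebesgue. exponent_lower p \<le> p x"
proof -
  let ?E = "esssup lebesgue (\<lambda>x. - ereal (p x))"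
  have e: "exponent_lower p = real_of_ereal (- ?E)" by (simp add: exponent_lower_def ess_inf_def)
  \<comment> \<open>The coercion to reals sends both infinities to 0, so a value above 1 shows that
    the essential infimum is finite.\<close>
  then obtain r where r: "?E = ereal r" using assms by (cases ?E) auto
  then have "exponent_lower p = - r" using e by simp
  moreover have "AE x in lebesgue. - ereal (p x) \<le> ereal r"
    using esssup_AE[of "\<lambda>x. - ereal (p x)" lebesgue] unfolding r .
  ultimately show ?thesis by (auto elim!: eventually_mono)
qed

lemma exponent_upper_AE:
  fixes p :: "real^'n \<Rightarrow> real"
  shows "AE x in lebesgue. ereal (p x) \<le> exponent_upper p"
  unfolding exponent_upper_def by (rule esssup_AE)

lemma modular_finite_exponent_lborel:
  fixes p :: "real^'n \<Rightarrow> real"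
  shows "modular (\<lambda>x. ereal (p x)) g = (\<integral>\<^sup>+x. ennreal_powr (g x) (p x) \<partial>lborel)"
  by (simp only: modular_finite_exponent nn_integral_completion)

text \<open>Positivity of the kernel bounds |T f| by T |f|. The modular estimate makes T |f| finite
  almost everywhere, which gives absolute convergence of the integral defining T f.\<close>

lemma strong_bound_frac_op:
  fixes p q p' q' :: "real^'n \<Rightarrow> real" and A :: "nat \<Rightarrow> real^'n^'n"
  assumes bound: "strong_bound p' q' c (\<lambda>h x. \<integral>\<^sup>+y. ennreal (frac_kernel m a A x y) * ennreal (h y) \<partial>lborel)"
    and c: "0 < c" and pp: "AE x in lborel. p x = p' x" and qq: "AE x in lborel. q x = q' x"
    and p1: "\<And>x. 1 \<le> p x" and q1: "AE x in lborel. 1 \<le> q' x"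
    and [measurable]: "p' \<in> borel_measurable borel" "q' \<in> borel_measurable borel"
  shows "(\<forall>f \<in> var_space (\<lambda>x. ereal (p x)).
            (AE x in lebesgue. integrable lebesgue (\<lambda>y. frac_kernel m a A x y *\<^sub>R f y)) \<and>
            frac_op m a A f \<in> var_space (\<lambda>x. ereal (q x))) \<and>
         bounded_from_into (\<lambda>x. ereal (p x)) (\<lambda>x. ereal (q x)) (\<lambda>f. absf (frac_op m a A f))"
proof -
  have k_slice [measurable]: "frac_kernel m a A x \<in> borel_measurable borel" for x
    using measurable_compose[OF measurable_Pair1'[of x borel borel] borel_measurable_frac_kernel[of m a A]] by simp
  have op_measurable: "frac_op m a A f \<in> borel_measurable lebesgue" if f: "f \<in> borel_measurable lebesgue" for f
  proof -
    obtain f' where [measurable]: "f' \<in> borel_measurable borel" and ff: "AE x in lborel. f x = f' x"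
      using complex_lebesgue_borel_representative[OF f] .
    have "frac_op m a A f x = (\<integral>y. frac_kernel m a A x y *\<^sub>R f' y \<partial>lborel)" for x
    proof -
      have [measurable]: "frac_kernel m a A x \<in> borel_measurable lebesgue" "f' \<in> borel_measurable lebesgue"
        by (intro measurable_completion; measurable)+
      have "frac_op m a A f x = (\<integral>y. frac_kernel m a A x y *\<^sub>R f' y \<partial>lebesgue)"
        unfolding frac_op_def using f ff
        by (intro integral_cong_AE) (auto simp: AE_completion_iff elim!: eventually_mono)
      also have "\<dots> = (\<integral>y. frac_kernel m a A x y *\<^sub>R f' y \<partial>lborel)"
        by (rule integral_completion) measurable
      finally show ?thesis .
    qed
    moreover have "(\<lambda>x. \<integral>y. frac_kernel m a A x y *\<^sub>R f' y \<partial>lborel) \<in> borel_measurable borel"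
      by measurable
    ultimately show ?thesis by (simp add: measurable_completion fun_eq_iff[symmetric] cong: measurable_cong)
  qed
  have main: "(AE x in lebesgue. integrable lebesgue (\<lambda>y. frac_kernel m a A x y *\<^sub>R f y)) \<and>
      modular (\<lambda>x. ereal (q x)) (\<lambda>x. absf (frac_op m a A f) x / ennreal (1 / c * l)) \<le> 1"
    if f: "f \<in> borel_measurable lebesgue" and l: "0 < l" and mod1: "modular (\<lambda>x. ereal (p x)) (\<lambda>x. absf f x / ennreal l) \<le> 1" for f l
  proof -
    obtain f' where f'_meas [measurable]: "f' \<in> borel_measurable borel" and ff: "AE x in lborel. f x = f' x"
      using complex_lebesgue_borel_representative[OF f] .
    define h where "h x = norm (f' x) / l" for x
    have [measurable]: "h \<in> borel_measurable borel" unfolding h_def[abs_def] by measurable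
    have h: "0 \<le> h x" for x using l by (simp add: h_def)
    have "(\<integral>\<^sup>+x. ennreal (h x powr p' x) \<partial>lborel) = (\<integral>\<^sup>+x. ennreal_powr (absf f x / ennreal l) (p x) \<partial>lborel)"
    proof (rule nn_integral_cong_AE)
      show "AE x in lborel. ennreal (h x powr p' x) = ennreal_powr (absf f x / ennreal l) (p x)"
        using ff pp by eventually_elim (use l in \<open>simp add: h_def divide_ennreal ennreal_powr_ennreal\<close>)
    qed
    also have "\<dots> \<le> 1" using mod1 by (simp only: modular_finite_exponent_lborel)
    finally have hp: "(\<integral>\<^sup>+x. ennreal (h x powr p' x) \<partial>lborel) \<le> 1" .
    define T where "T x = (\<integral>\<^sup>+y. ennreal (frac_kernel m a A x y) * ennreal (h y) \<partial>lborel)" for x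
    have [measurable]: "T \<in> borel_measurable borel" unfolding T_def[abs_def] by measurable
    have Tq: "(\<integral>\<^sup>+x. ennreal_powr (ennreal c * T x) (q' x) \<partial>lborel) \<le> 1"
      using bound h hp unfolding strong_bound_def T_def by simp
    have "AE x in lborel. ennreal_powr (ennreal c * T x) (q' x) \<noteq> \<infinity>"
      using Tq by (intro nn_integral_PInf_AE) (auto simp: top_unique)
    then have T_fin: "AE x in lborel. T x < top"
      by eventually_elim (use c in \<open>auto simp: less_top[symmetric] ennreal_mult_eq_top_iff\<close>)
    have norm_int: "(\<integral>\<^sup>+y. ennreal (norm (frac_kernel m a A x y *\<^sub>R f y)) \<partial>lebesgue) = ennreal l * T x" for x
    proof -
      have "(\<integral>\<^sup>+y. ennreal (norm (frac_kernel m a A x y *\<^sub>R f y)) \<partial>lebesgue)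
        = (\<integral>\<^sup>+y. ennreal l * (ennreal (frac_kernel m a A x y) * ennreal (h y)) \<partial>lborel)"
        unfolding nn_integral_completion
      proof (rule nn_integral_cong_AE)
        show "AE y in lborel. ennreal (norm (frac_kernel m a A x y *\<^sub>R f y)) = ennreal l * (ennreal (frac_kernel m a A x y) * ennreal (h y))"
          using ff
        proof eventually_elim
          case (elim y)
          have nm: "norm (frac_kernel m a A x y *\<^sub>R f y) = l * (frac_kernel m a A x y * h y)"
            using l frac_kernel_nonneg[of m a A x y] elim by (simp add: h_def)
          show ?case unfolding nm using l h[of y] frac_kernel_nonneg[of m a A x y] by (simp add: ennreal_mult)
        qed
      qed
      then show ?thesis unfolding T_def by (simp add: nn_integral_cmult)
    qed
    have kf_meas: "(\<lambda>y. frac_kernel m a A x y *\<^sub>R f y) \<in> borel_measurable lebesgue" for x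
    proof -
      have "frac_kernel m a A x \<in> borel_measurable lebesgue" by (intro measurable_completion) measurable
      then show ?thesis using f by measurable
    qed
    have int: "AE x in lebesgue. integrable lebesgue (\<lambda>y. frac_kernel m a A x y *\<^sub>R f y)"
      unfolding AE_completion_iff using T_fin
    proof eventually_elim
      case (elim x)
      then show ?case
        using kf_meas by (intro integrableI_bounded) (simp_all only: norm_int, simp add: ennreal_mult_less_top)
    qed
    \<comment> \<open>The bound holds at every x: where the integrand is not integrable, the Bochner
      integral is 0 by convention.\<close>
    have op_le: "ennreal (norm (frac_op m a A f x)) \<le> ennreal l * T x" for x
    proof (cases "integrable lebesgue (\<lambda>y. frac_kernel m a A x y *\<^sub>R f y)")
      case True
      then show ?thesis
        using integral_norm_bound_ennreal[OF True] unfolding frac_op_def norm_int by simp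
    next
      case False
      then show ?thesis by (simp add: frac_op_def not_integrable_integral_eq)
    qed
    have "modular (\<lambda>x. ereal (q x)) (\<lambda>x. absf (frac_op m a A f) x / ennreal (1 / c * l))
      \<le> (\<integral>\<^sup>+x. ennreal_powr (ennreal c * T x) (q' x) \<partial>lborel)"
      unfolding modular_finite_exponent_lborel
    proof (rule nn_integral_mono_AE)
      show "AE x in lborel. ennreal_powr (absf (frac_op m a A f) x / ennreal (1 / c * l)) (q x) \<le> ennreal_powr (ennreal c * T x) (q' x)"
        using qq q1
      proof eventually_elim
        case (elim x)
        have "absf (frac_op m a A f) x / ennreal (1 / c * l) = ennreal (c / l) * absf (frac_op m a A f) x"
          using c l by (simp add: divide_ennreal ennreal_mult[symmetric] field_simps)
        also have "\<dots> \<le> ennreal (c / l) * (ennreal l * T x)"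
          by (intro mult_left_mono op_le) simp
        also have "\<dots> = ennreal c * T x"
          using c l by (simp add: mult.assoc[symmetric] ennreal_mult[symmetric])
        finally show ?case using elim by (auto intro!: ennreal_powr_mono)
      qed
    qed
    with Tq int show ?thesis by auto
  qed
  \<comment> \<open>Membership in the space provides a finite modular, not one that is at most 1.
    Because p \<ge> 1, multiplying l by N \<ge> 1 divides the modular by at least N.\<close>
  have scale: "\<exists>l>0. modular (\<lambda>x. ereal (p x)) (\<lambda>x. absf f x / ennreal l) \<le> 1"
    if f: "f \<in> var_space (\<lambda>x. ereal (p x))" for f
  proof -
    obtain l where l: "0 < l" "modular (\<lambda>x. ereal (p x)) (\<lambda>x. absf f x / ennreal l) < \<infinity>"
      using f by (auto simp: var_space_def)
    have f_meas: "f \<in> borel_measurable lebesgue" using f by (simp add: var_space_def)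
    obtain f' where f'_meas [measurable]: "f' \<in> borel_measurable borel" and ff: "AE x in lborel. f x = f' x"
      using complex_lebesgue_borel_representative[OF f_meas] .
    have mod_eq: "modular (\<lambda>x. ereal (p x)) (\<lambda>x. absf f x / ennreal l) = (\<integral>\<^sup>+x. ennreal ((norm (f' x) / l) powr p' x) \<partial>lborel)"
      if "0 < l" for l
      unfolding modular_finite_exponent_lborel
    proof (rule nn_integral_cong_AE)
      show "AE x in lborel. ennreal_powr (absf f x / ennreal l) (p x) = ennreal ((norm (f' x) / l) powr p' x)"
        using ff pp by eventually_elim (use that in \<open>simp add: divide_ennreal ennreal_powr_ennreal\<close>)
    qed
    obtain M where M: "0 \<le> M" "modular (\<lambda>x. ereal (p x)) (\<lambda>x. absf f x / ennreal l) = ennreal M"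
      using l(2) by (cases "modular (\<lambda>x. ereal (p x)) (\<lambda>x. absf f x / ennreal l)") auto
    define N where "N = max 1 M"
    have N: "1 \<le> N" "M \<le> N" by (simp_all add: N_def)
    have "modular (\<lambda>x. ereal (p x)) (\<lambda>x. absf f x / ennreal (N * l)) \<le> (\<integral>\<^sup>+x. ennreal (1 / N) * ennreal ((norm (f' x) / l) powr p' x) \<partial>lborel)"
      unfolding mod_eq[of "N * l", OF mult_pos_pos[OF less_le_trans[OF zero_less_one N(1)] l(1)]]
    proof (rule nn_integral_mono_AE)
      show "AE x in lborel. ennreal ((norm (f' x) / (N * l)) powr p' x) \<le> ennreal (1 / N) * ennreal ((norm (f' x) / l) powr p' x)"
        using pp
      proof eventually_elim
        case (elim x)
        then have px: "1 \<le> p' x" using p1[of x] by simp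
        have "(norm (f' x) / (N * l)) powr p' x = (norm (f' x) / l) powr p' x / N powr p' x"
          using N l by (subst powr_divide[symmetric]) (auto simp: mult.commute)
        also have "\<dots> \<le> (norm (f' x) / l) powr p' x / N"
          using N px powr_mono[of 1 "p' x" N] by (intro divide_left_mono) auto
        finally have "ennreal ((norm (f' x) / (N * l)) powr p' x) \<le> ennreal (1 / N * (norm (f' x) / l) powr p' x)"
          by (intro ennreal_leI) simp
        also have "\<dots> = ennreal (1 / N) * ennreal ((norm (f' x) / l) powr p' x)"
          using N by (intro ennreal_mult) auto
        finally show ?case .
      qed
    qed
    also have "\<dots> = ennreal (1 / N) * ennreal M"
      unfolding M(2)[symmetric] mod_eq[OF l(1)] by (rule nn_integral_cmult) measurable
    also have "\<dots> = ennreal (1 / N * M)" using N M by (intro ennreal_mult[symmetric]) auto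
    also have "\<dots> \<le> ennreal 1" using N by (intro ennreal_leI) (simp add: divide_le_eq)
    finally show ?thesis using N l by (intro exI[of _ "N * l"]) (auto intro!: mult_pos_pos)
  qed
  show ?thesis
  proof (intro conjI ballI)
    fix f assume f: "f \<in> var_space (\<lambda>x. ereal (p x))"
    then have f_meas: "f \<in> borel_measurable lebesgue" by (simp add: var_space_def)
    obtain l where l: "0 < l" "modular (\<lambda>x. ereal (p x)) (\<lambda>x. absf f x / ennreal l) \<le> 1"
      using scale[OF f] by blast
    note main = main[OF f_meas l]
    then show "AE x in lebesgue. integrable lebesgue (\<lambda>y. frac_kernel m a A x y *\<^sub>R f y)" by (rule conjunct1)
    have "modular (\<lambda>x. ereal (q x)) (\<lambda>x. absf (frac_op m a A f) x / ennreal (1 / c * l)) < \<infinity>"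
      using le_less_trans[OF conjunct2[OF main] ennreal_one_less_top] by simp
    moreover have "0 < 1 / c * l" using c l by simp
    ultimately show "frac_op m a A f \<in> var_space (\<lambda>x. ereal (q x))"
      unfolding var_space_def using op_measurable[OF f_meas] by blast
  next
    have "var_norm (\<lambda>x. ereal (q x)) (absf (frac_op m a A f)) \<le> ennreal (1 / c) * var_norm (\<lambda>x. ereal (p x)) (absf f)"
      if "f \<in> var_space (\<lambda>x. ereal (p x))" for f
      using main that c by (intro var_norm_le_cmult) (auto simp: var_space_def)
    then show "bounded_from_into (\<lambda>x. ereal (p x)) (\<lambda>x. ereal (q x)) (\<lambda>f. absf (frac_op m a A f))"
      unfolding bounded_from_into_def using c by (intro exI[of _ "1 / c"]) auto
  qed
qed

theorem theorem6:
  fixes m :: nat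
    and \<alpha> :: real
    and a :: "nat \<Rightarrow> real"
    and A :: "nat \<Rightarrow> real^'n^'n"
    and p q :: "real^'n \<Rightarrow> real"
  assumes "m \<ge> 1"
    and "0 \<le> \<alpha>" and "\<alpha> < real CARD('n)"
    and "\<And>i. i \<in> {1..m} \<Longrightarrow> 0 < a i \<and> a i < real CARD('n)"
    and "(\<Sum>i=1..m. a i) = real CARD('n) - \<alpha>"
    and "\<And>i. i \<in> {1..m} \<Longrightarrow> invertible (A i)"
    and "\<And>i j. i \<in> {1..m} \<Longrightarrow> j \<in> {1..m} \<Longrightarrow> i \<noteq> j \<Longrightarrow> invertible (A i - A j)"
    and "p \<in> borel_measurable lebesgue"
    and "\<And>x. 1 \<le> p x"
    and "1 < exponent_lower p"
    and "ereal (exponent_lower p) \<le> exponent_upper p"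
    and "exponent_upper p < (if \<alpha> = 0 then \<infinity> else ereal (real CARD('n) / \<alpha>))"
    and "\<And>i. i \<in> {1..m} \<Longrightarrow> AE x in lebesgue. p (A i *v x) = p x"
    and "\<And>x. 1 / p x - 1 / q x = \<alpha> / real CARD('n)"
    and "let s = (\<lambda>x. conj_exponent
                  ((real CARD('n) - \<alpha> * exponent_lower p) / (real CARD('n) * exponent_lower p) * q x))
         in bounded_from_into s s hl_maximal"
  shows "(\<forall>f \<in> var_space (\<lambda>x. ereal (p x)).
            (AE x in lebesgue. integrable lebesgue (\<lambda>y. frac_kernel m a A x y *\<^sub>R f y)) \<and>
            frac_op m a A f \<in> var_space (\<lambda>x. ereal (q x))) \<and>
         bounded_from_into (\<lambda>x. ereal (p x)) (\<lambda>x. ereal (q x)) (\<lambda>f. absf (frac_op m a A f))"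
proof -
  note m = assms(1) and \<alpha> = assms(2,3) and a = assms(4) and sum_a = assms(5) and inv = assms(6) and inv_diff = assms(7)
    and p_leb = assms(8) and p_ge = assms(9) and p0 = assms(10) and upper = assms(12) and pA = assms(13) and pq = assms(14)
  define n where "n = real CARD('n)"
  define p0 where "p0 = exponent_lower p"
  have n: "0 < n" by (simp add: n_def)
  have p0_gt: "1 < p0" using assms(10) by (simp add: p0_def)
  obtain P where P: "ereal P = exponent_upper p" "p0 \<le> P" "\<alpha> * P < n"
  proof -
    have "ereal p0 \<le> exponent_upper p" using assms(11) by (simp add: p0_def)
    moreover have "exponent_upper p < \<infinity>" using upper by (auto split: if_splits intro: less_trans)
    ultimately obtain P where P: "exponent_upper p = ereal P" by (cases "exponent_upper p") auto
    moreover have "\<alpha> * P < n"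
    proof (cases "\<alpha> = 0")
      case False
      then have "P < n / \<alpha>" using upper P by (simp add: n_def)
      then show ?thesis using False \<alpha> by (simp add: field_simps)
    qed (use n in simp)
    ultimately show ?thesis using that \<open>ereal p0 \<le> exponent_upper p\<close> by simp
  qed
  define D where "D = n - \<alpha> * p0"
  have "\<alpha> * p0 \<le> \<alpha> * P" using P \<alpha> by (intro mult_left_mono) auto
  then have D: "0 < D" using P by (simp add: D_def)
  \<comment> \<open>Then 1/q0 is exactly the factor in front of q(.) in the hypothesis on the
    maximal operator, so its exponent is the conjugate of q(.)/q0.\<close>
  define q0 where "q0 = n * p0 / D"
  have q0: "0 < q0" using n p0_gt D by (simp add: q0_def)
  have q0_inv: "1 / q0 = 1 / p0 - \<alpha> / n"
    using n p0_gt D by (simp add: q0_def D_def field_simps)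
  have q0_ge: "p0 \<le> q0"
  proof -
    have "1 / q0 \<le> 1 / p0" using q0_inv \<alpha> n by simp
    then show ?thesis using q0 p0_gt by (simp add: field_simps)
  qed
  \<comment> \<open>The value of q that belongs to p = p_+. It is finite because p_+ < n/\<alpha>,
    and it bounds q from above as the extrapolation requires.\<close>
  define Q where "Q = 1 / (1 / P - \<alpha> / n)"
  have P_pos: "0 < P" using P p0_gt by simp
  have Q_den: "0 < 1 / P - \<alpha> / n" using P n P_pos by (simp add: field_simps)
  obtain p' where p'_meas: "p' \<in> borel_measurable lborel" and pp: "AE x in lborel. p x = p' x"
    using completion_ex_borel_measurable_real[OF p_leb] by blast
  \<comment> \<open>Built from the Borel version of p by the formula for q, so that q' is Borel and
    the relation between the exponents carries over to p' and q'.\<close>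
  define q' where "q' x = 1 / (1 / p' x - \<alpha> / n)" for x
  have q_eq: "q x = 1 / (1 / p x - \<alpha> / n)" for x
  proof -
    have "1 / q x = 1 / p x - \<alpha> / n" using pq[of x] unfolding n_def by linarith
    then have "1 / (1 / q x) = 1 / (1 / p x - \<alpha> / n)" by (rule arg_cong)
    then show ?thesis by simp
  qed
  have qq: "AE x in lborel. q x = q' x" using pp by eventually_elim (simp add: q_eq q'_def)
  have p'_borel [measurable]: "p' \<in> borel_measurable borel" using p'_meas by simp
  then have q'_meas [measurable]: "q' \<in> borel_measurable borel" unfolding q'_def[abs_def] by measurable
  have exps: "AE x in lborel. p0 \<le> p' x \<and> q0 \<le> q' x \<and> q' x \<le> Q \<and> 1 / p0 - 1 / q0 = 1 / p' x - 1 / q' x"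
    using exponent_lower_AE[OF p0] exponent_upper_AE[of p] pp unfolding AE_completion_iff
  proof eventually_elim
    case (elim x)
    have px: "p0 \<le> p' x" "p' x \<le> P" using elim unfolding P(1)[symmetric] p0_def by simp_all
    have "1 / P \<le> 1 / p' x" "1 / p' x \<le> 1 / p0" using px p0_gt by (simp_all add: frac_le)
    then have den: "1 / P - \<alpha> / n \<le> 1 / p' x - \<alpha> / n" "1 / p' x - \<alpha> / n \<le> 1 / q0" by (simp_all add: q0_inv)
    have "0 < 1 / p' x - \<alpha> / n" using den Q_den by linarith
    then have "1 / (1 / q0) \<le> q' x" unfolding q'_def using den by (intro frac_le) simp_all
    then have "q0 \<le> q' x" by simp
    moreover have "q' x \<le> Q" unfolding q'_def Q_def using den Q_den by (intro frac_le) simp_all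
    moreover have "1 / p0 - 1 / q0 = 1 / p' x - 1 / q' x" unfolding q0_inv q'_def by simp
    ultimately show ?case using px by simp
  qed
  have p1': "AE x in lborel. 1 \<le> p' x"
    using exps by eventually_elim (use p0_gt in linarith)
  have q1': "AE x in lborel. 1 \<le> q' x"
    using exps by eventually_elim (use p0_gt q0_ge in linarith)
  define s where "s x = conj_exponent ((real CARD('n) - \<alpha> * exponent_lower p) / (real CARD('n) * exponent_lower p) * q x)" for x
  have M: "bounded_from_into s s hl_maximal"
    using assms(15) unfolding Let_def s_def[abs_def] .
  have s_eq: "s x = conj_exponent (q x / q0)" for x
    by (simp add: s_def q0_def D_def n_def p0_def mult.commute)
  have s_meas: "s \<in> borel_measurable lebesgue"
  proof -
    have [measurable]: "p \<in> borel_measurable lebesgue" by (rule p_leb)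
    have "(\<lambda>x. conj_exponent (1 / (1 / p x - \<alpha> / n) / q0)) \<in> borel_measurable lebesgue"
      unfolding conj_exponent_def by measurable
    then show ?thesis by (simp add: s_eq[abs_def] q_eq)
  qed
  have s_AE: "AE x in lborel. s x = conj_exponent (q' x / q0)"
    using qq by eventually_elim (simp add: s_eq)
  have pA': "AE x in lborel. p' (A i *v x) = p' x" if i: "i \<in> {1..m}" for i
  proof -
    have "bij ((*v) (A i))" using inv[OF i] by (simp add: invertible_eq_bij)
    then have "AE x in lborel. p (A i *v x) = p' (A i *v x)"
      using AE_lborel_linear[of "(*v) (A i)", OF _ _ pp] by simp
    with pA[OF i] pp show ?thesis unfolding AE_completion_iff by eventually_elim simp
  qed
  have "\<exists>c>0. strong_bound p' q' c (\<lambda>h x. \<integral>\<^sup>+y. ennreal (frac_kernel m a A x y) * ennreal (h y) \<partial>lborel)"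
  proof (cases "\<alpha> = 0")
    case False
    then have \<alpha>_pos: "0 < \<alpha>" using \<alpha> by simp
    have wb: "weighted_bound (riesz \<alpha> :: (real^'n \<Rightarrow> real) \<Rightarrow> real^'n \<Rightarrow> ennreal) p0 q0"
      using \<alpha>_pos \<alpha> p0_gt q0 q0_inv by (intro weighted_bound_riesz) (auto simp: n_def)
    have "\<exists>c>0. strong_bound p' q' c (riesz \<alpha>)"
      by (rule extrapolation[OF wb borel_measurable_riesz p'_borel q'_meas s_meas p0_gt q0 exps s_AE M])
    then have sb: "\<exists>c>0. strong_bound p' q' c (\<lambda>h x. \<integral>\<^sup>+z. ennreal (norm (x - z) powr (\<alpha> - n)) * ennreal (h z) \<partial>lborel)"
      by (simp add: riesz_def[abs_def] n_def)
    show ?thesis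
    proof (rule frac_kernel_strong_bound[where k="\<lambda>i x z. norm (x - z) powr (\<alpha> - n)" and C=1, OF m inv p'_borel q'_meas _ _ p1' q1' pA'])
      show "frac_kernel m a A x y \<le> 1 * (\<Sum>i=1..m. norm (x - A i *v y) powr (\<alpha> - n))" for x y
        using frac_kernel_le_riesz[OF m, of a "n - \<alpha>" A x y] a sum_a by (simp add: n_def)
    qed (use sb in auto)
  next
    case True
    have sum_n: "(\<Sum>i=1..m. a i) = n" using sum_a True by (simp add: n_def)
    have "q0 = p0" using q0_inv True q0 p0_gt by simp
    have sb: "\<exists>c>0. strong_bound p' q' c (\<lambda>h x. \<integral>\<^sup>+z. ennreal (norm (x - z) powr - a i * (norm x + norm z) powr (a i - n)) * ennreal (h z) \<partial>lborel)"
      if i: "i \<in> {1..m}" for i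
    proof -
      have wb: "weighted_bound (stein (a i) :: (real^'n \<Rightarrow> real) \<Rightarrow> real^'n \<Rightarrow> ennreal) p0 q0"
        unfolding \<open>q0 = p0\<close> using a[OF i] p0_gt by (intro weighted_bound_stein) auto
      have "\<exists>c>0. strong_bound p' q' c (stein (a i))"
        by (rule extrapolation[OF wb borel_measurable_stein p'_borel q'_meas s_meas p0_gt q0 exps s_AE M])
      then show ?thesis by (simp add: stein_def[abs_def] n_def)
    qed
    have "\<exists>C\<ge>0. \<forall>x y. frac_kernel m a A x y \<le> C * (\<Sum>i=1..m. norm (x - A i *v y) powr - a i * (norm x + norm (A i *v y)) powr (a i - n))"
      by (rule frac_kernel_le_stein[OF m _ sum_n inv_diff]) (use a in auto)
    then obtain C where C: "0 \<le> C" "frac_kernel m a A x y \<le> C * (\<Sum>i=1..m. norm (x - A i *v y) powr - a i * (norm x + norm (A i *v y)) powr (a i - n))" for x y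
      by (elim exE conjE) simp
    show ?thesis
      by (rule frac_kernel_strong_bound[where k="\<lambda>i x z. norm (x - z) powr - a i * (norm x + norm z) powr (a i - n)",
          OF m inv p'_borel q'_meas _ _ p1' q1' pA' C sb]) auto
  qed
  then obtain c where c: "0 < c" "strong_bound p' q' c (\<lambda>h x. \<integral>\<^sup>+y. ennreal (frac_kernel m a A x y) * ennreal (h y) \<partial>lborel)"
    by (elim exE conjE)
  show ?thesis
    by (rule strong_bound_frac_op[OF c(2,1) pp qq p_ge q1' p'_borel q'_meas])
qed

end
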